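(* Let $n\ge 2$ and $d\ge 1$ be integers. Let $\mathcal C$ be the class of all co-adapted couplings $c=(X^c,Y^c)$ of two copies of the continuous-time simple symmetric random walk on $K_n^d$, let $\tau^c$ be the coupling time of $c$, and let $\hat c\in\mathcal C$ be the specific coupling defined in the context, with coupling time $\hat\tau$. For $x,y\in K_n^d$ and $t\ge 0$ put $\hat v(x,y,t)=\mathbb P(\hat\tau>t\mid \hat X_0=x,\hat Y_0=y)$. Then for all states $x,y\in K_n^d$ and all times $t\ge 0$, $$\hat v(x,y,t)=\inf_{c\in\mathcal C}\mathbb P\left(\tau^c>t\mid X^c_0=x,\;Y^c_0=y\right).$$
   Context: Random walk. $K_n$ is the complete graph on vertices $\{0,1,\dots,n-1\}$ and $K_n^d$ is the set of $d$-tuples $(x(1),\dots,x(d))$ with $x(i)\in K_n$. The simple symmetric continuous-time random walk $X$ on $K_n^d$: each coordinate, independently of the others, at the incident times of a unit rate Poisson process jumps to a uniformly chosen value among the $n-1$ values different from its current one (so each coordinate jumps from $r$ to each $s\ne r$ at rate $1/(n-1)$). Couplings. A coupling of walks $X$ and $Y$ (with given initial states) is a process $(X^c,Y^c)$ with $X^c\stackrel{\mathcal D}{=}X$ and $Y^c\stackrel{\mathcal D}{=}Y$ as processes. Its coupling time is $\tau^c=\inf\{t: X^c_s=Y^c_s\ \text{for all } s\ge t\}$. It is co-adapted if there is a filtration $(\mathcal F_t)_{t\ge0}$ to which $X^c$ and $Y^c$ are both adapted and such that for all $0\le s\le t$, $\mathcal L(X^c_t\mid\mathcal F_s)=\mathcal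 L(X^c_t\mid X^c_s)$ and $\mathcal L(Y^c_t\mid\mathcal F_s)=\mathcal L(Y^c_t\mid Y^c_s)$. The coupling $\hat c=(\hat X,\hat Y)$. Let $\hat U_t=\{i:\hat X_t(i)\ne\hat Y_t(i)\}$, $\hat M_t=\{i:\hat X_t(i)=\hat Y_t(i)\}$, $\hat N_t=|\hat U_t|$. For coordinates $i,j\in\{1,\dots,d\}$ and values $k,l\in\{0,\dots,n-1\}$, at rate $\hat q_{(i,k)(j,l)}(t)/(n-1)$ one simultaneously sets $\hat X_t(i)=k$ and $\hat Y_t(j)=l$, all other coordinates being unchanged (either assignment may leave the value unchanged). The non-zero entries of the doubly stochastic $(nd)\times(nd)$ matrix $\hat q(t)$ are given as follows, where $2(n-1)/(n-2)$ is read as $+\infty$ if $n=2$: [C1] $\hat q_{(i,k)(i,k)}(t)=1$ for all $i\in\hat M_{t-}$ and all $k$. [C2] If $\hat N_{t-}$ is even or $\hat N_{t-}\ge 2(n-1)/(n-2)$: (i) for $i\neq j$ in $\hat U_{t-}$, $\hat q_{(i,k)(j,l)}(t)=\frac1{\hat N_{t-}-1}$ if $k=\hat Y_{t-}(i)$ and $l=\hat X_{t-}(j)$, and $0$ otherwise; (ii) for $i\in\hat U_{t-}$, $\hat q_{(i,k)(i,k)}(t)=1$ if $k\ne\hat X_{t-}(i)$ and $k\neq\hat Y_{t-}(i)$, and $0$ otherwise; and $\hat q_{(i,\hat X_{t-}(i))(i,\hat Y_{t-}(i))}(t)=1$ for $i\in\hat U_{t-}$ (this causes no change of state). [C3] If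 $\hat N_{t-}$ is odd and $\hat N_{t-}<2(n-1)/(n-2)$: $\hat q_{(i,k)(i,k)}(t)=1$ for all $i\in\hat U_{t-}$ and all $k$. *)

theory Defs
  imports "HOL-Probability.Probability"
begin

text \<open>
  A state of \<open>K\<^sub>n\<^sup>d\<close> is a function \<open>x :: 'd \<Rightarrow> 'n\<close> on a finite type of coordinates with values in a
  finite type of vertices, where \<open>d = CARD('d)\<close> and \<open>n = CARD('n)\<close>.
  Processes are indexed by \<^typ>\<open>real\<close>, but only times \<open>t \<ge> 0\<close> are ever constrained.
\<close>

definition cadlag_paths :: "'w measure \<Rightarrow> (real \<Rightarrow> 'w \<Rightarrow> 's) \<Rightarrow> bool" where
  "cadlag_paths M Z \<longleftrightarrow>
     (\<forall>\<omega>\<in>space M.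
        (\<forall>t\<ge>0. \<forall>\<^sub>F s in at_right t. Z s \<omega> = Z t \<omega>) \<and>
        (\<forall>t>0. \<exists>z. \<forall>\<^sub>F s in at_left t. Z s \<omega> = z))"

definition path_law :: "'w measure \<Rightarrow> (real \<Rightarrow> 'w \<Rightarrow> 's) \<Rightarrow> (real \<Rightarrow> 's) measure" where
  "path_law M Z =
     distr M (PiM {0..} (\<lambda>_. count_space UNIV)) (\<lambda>\<omega>. \<lambda>t\<in>{0..}. Z t \<omega>)"


subsection \<open>The random walk\<close>

text \<open>
  The \<open>k\<close>-th entry for coordinate \<open>i\<close> consists of the \<open>k\<close>-th waiting time of the unit rate Poisson
  clock of \<open>i\<close> (exponential with parameter 1) and of a uniformly random map \<open>f\<close> without fixed
  points; for every \<open>r\<close>, the value \<open>f r\<close> is uniform on the \<open>n - 1\<close> values different from \<open>r\<close>.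
\<close>

definition walk_space :: "('d::finite \<Rightarrow> nat \<Rightarrow> real \<times> ('n::finite \<Rightarrow> 'n)) measure" where
  "walk_space =
     PiM UNIV (\<lambda>_. PiM UNIV (\<lambda>_.
       density lborel (\<lambda>u. ennreal (exponential_density 1 u)) \<Otimes>\<^sub>M
       measure_pmf (pmf_of_set {f. \<forall>r. f r \<noteq> r})))"

definition clock :: "(nat \<Rightarrow> real \<times> 'b) \<Rightarrow> real \<Rightarrow> nat" where
  "clock \<eta> t = card {k. (\<Sum>j\<le>k. fst (\<eta> j)) \<le> t}"

primrec jump_chain :: "'n \<Rightarrow> (nat \<Rightarrow> real \<times> ('n \<Rightarrow> 'n)) \<Rightarrow> nat \<Rightarrow> 'n" where
  "jump_chain r \<eta> 0 = r"
| "jump_chain r \<eta> (Suc k) = snd (\<eta> k) (jump_chain r \<eta> k)"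

definition walk ::
  "('d \<Rightarrow> 'n) \<Rightarrow> real \<Rightarrow> ('d \<Rightarrow> nat \<Rightarrow> real \<times> ('n \<Rightarrow> 'n)) \<Rightarrow> 'd \<Rightarrow> 'n" where
  "walk x t \<omega> = (\<lambda>i. jump_chain (x i) (\<omega> i) (clock (\<omega> i) t))"

text \<open>
  Equality in distribution as processes: the paths are right-continuous with left limits, and the law on path
  space is that of \<^const>\<open>walk\<close>.
\<close>

definition copy_of_walk ::
  "('d::finite \<Rightarrow> 'n::finite) \<Rightarrow> 'w measure \<Rightarrow> (real \<Rightarrow> 'w \<Rightarrow> 'd \<Rightarrow> 'n) \<Rightarrow> bool" where
  "copy_of_walk x M X \<longleftrightarrow>
     (\<forall>t\<ge>0. X t \<in> measurable M (count_space UNIV)) \<and>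
     cadlag_paths M X \<and>
     path_law M X = path_law walk_space (walk x)"


subsection \<open>Co-adapted couplings\<close>

text \<open>The value is \<open>\<infinity>\<close> if the two paths never coalesce.\<close>

definition coupling_time :: "(real \<Rightarrow> 'w \<Rightarrow> 's) \<Rightarrow> (real \<Rightarrow> 'w \<Rightarrow> 's) \<Rightarrow> 'w \<Rightarrow> ereal" where
  "coupling_time X Y \<omega> = Inf {ereal t | t. 0 \<le> t \<and> (\<forall>s\<ge>t. X s \<omega> = Y s \<omega>)}"

text \<open>
  The conditional laws of \<open>X t\<close> given \<open>F s\<close> and given \<open>X s\<close> agree. As the state space is finite, it
  suffices to compare the conditional probabilities of the single states.
\<close>

definition markov_wrt :: "'w measure \<Rightarrow> (real \<Rightarrow> 'w measure) \<Rightarrow> (real \<Rightarrow> 'w \<Rightarrow> 's::finite) \<Rightarrow> bool" where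
  "markov_wrt M F X \<longleftrightarrow>
     (\<forall>s t z. 0 \<le> s \<and> s \<le> t \<longrightarrow>
        (AE \<omega> in M.
           real_cond_exp M (F s) (indicator {\<omega>'\<in>space M. X t \<omega>' = z}) \<omega> =
           real_cond_exp M (vimage_algebra (space M) (X s) (count_space UNIV))
             (indicator {\<omega>'\<in>space M. X t \<omega>' = z}) \<omega>))"

definition adapted_to :: "(real \<Rightarrow> 'w measure) \<Rightarrow> (real \<Rightarrow> 'w \<Rightarrow> 's) \<Rightarrow> bool" where
  "adapted_to F X \<longleftrightarrow> (\<forall>t\<ge>0. X t \<in> measurable (F t) (count_space UNIV))"

definition coadapted ::
  "'w measure \<Rightarrow> (real \<Rightarrow> 'w \<Rightarrow> 's::finite) \<Rightarrow> (real \<Rightarrow> 'w \<Rightarrow> 's) \<Rightarrow> bool" where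
  "coadapted M X Y \<longleftrightarrow>
     (\<exists>F. filtration (space M) F \<and> (\<forall>t. subalgebra M (F t)) \<and>
        adapted_to F X \<and> adapted_to F Y \<and> markov_wrt M F X \<and> markov_wrt M F Y)"

text \<open>
  The class of co-adapted couplings started in \<open>(x, y)\<close>, over all probability spaces whose points
  are taken from the type \<open>'w\<close>.
\<close>

definition coadapted_couplings ::
  "('d::finite \<Rightarrow> 'n::finite) \<Rightarrow> ('d \<Rightarrow> 'n) \<Rightarrow>
   ('w measure \<times> (real \<Rightarrow> 'w \<Rightarrow> 'd \<Rightarrow> 'n) \<times> (real \<Rightarrow> 'w \<Rightarrow> 'd \<Rightarrow> 'n)) set" where
  "coadapted_couplings x y =
     {(M, X, Y). prob_space M \<and> copy_of_walk x M X \<and> copy_of_walk y M Y \<and> coadapted M X Y}"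


subsection \<open>Jump processes with given rates on a finite state space\<close>

text \<open>
  In the following, \<open>q a b\<close> is the rate of jumps from \<open>a\<close> to \<open>b\<close>; diagonal values of \<open>q\<close> are
  irrelevant. The transition function is the matrix exponential of the generator.
\<close>

definition generator :: "('s \<Rightarrow> 's \<Rightarrow> real) \<Rightarrow> 's::finite \<Rightarrow> 's \<Rightarrow> real" where
  "generator q a b = (if a = b then - (\<Sum>c\<in>UNIV - {a}. q a c) else q a b)"

primrec matrix_power :: "('s::finite \<Rightarrow> 's \<Rightarrow> real) \<Rightarrow> nat \<Rightarrow> 's \<Rightarrow> 's \<Rightarrow> real" where
  "matrix_power G 0 = (\<lambda>a b. if a = b then 1 else 0)"
| "matrix_power G (Suc k) = (\<lambda>a b. \<Sum>c\<in>UNIV. G a c * matrix_power G k c b)"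

definition transition :: "('s::finite \<Rightarrow> 's \<Rightarrow> real) \<Rightarrow> real \<Rightarrow> 's \<Rightarrow> 's \<Rightarrow> real" where
  "transition q t a b = (\<Sum>k. t ^ k / fact k * matrix_power (generator q) k a b)"

definition jump_process ::
  "('s::finite \<Rightarrow> 's \<Rightarrow> real) \<Rightarrow> 's \<Rightarrow> 'w measure \<Rightarrow> (real \<Rightarrow> 'w \<Rightarrow> 's) \<Rightarrow> bool" where
  "jump_process q z M Z \<longleftrightarrow>
     prob_space M \<and>
     (\<forall>t\<ge>0. Z t \<in> measurable M (count_space UNIV)) \<and>
     cadlag_paths M Z \<and>
     (\<forall>(m::nat) (ts::nat \<Rightarrow> real) (zs::nat \<Rightarrow> 's). 0 \<le> ts 0 \<and> mono ts \<longrightarrow>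
        measure M {\<omega>\<in>space M. \<forall>k\<le>m. Z (ts k) \<omega> = zs k} =
          transition q (ts 0) z (zs 0) *
          (\<Prod>k<m. transition q (ts (Suc k) - ts k) (zs k) (zs (Suc k))))"


subsection \<open>The specific coupling\<close>

definition unmatched :: "('d \<Rightarrow> 'n) \<Rightarrow> ('d \<Rightarrow> 'n) \<Rightarrow> 'd set" where
  "unmatched x y = {i. x i \<noteq> y i}"

text \<open>The disjunct \<open>n \<noteq> 2 \<and> \<dots>\<close> reads \<open>2 (n - 1) / (n - 2)\<close> as \<open>\<infinity>\<close> for \<open>n = 2\<close>.\<close>

definition pairing_regime :: "('d::finite \<Rightarrow> 'n::finite) \<Rightarrow> ('d \<Rightarrow> 'n) \<Rightarrow> bool" where
  "pairing_regime x y \<longleftrightarrow>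
     (let n = real CARD('n); N = card (unmatched x y)
      in even N \<or> (n \<noteq> 2 \<and> real N \<ge> 2 * (n - 1) / (n - 2)))"

text \<open>\<open>q_hat x y (i, k) (j, l)\<close> is the matrix entry when the current states are \<open>x\<close> and \<open>y\<close>.\<close>

definition q_hat ::
  "('d::finite \<Rightarrow> 'n::finite) \<Rightarrow> ('d \<Rightarrow> 'n) \<Rightarrow> 'd \<times> 'n \<Rightarrow> 'd \<times> 'n \<Rightarrow> real" where
  "q_hat x y = (\<lambda>(i, k) (j, l).
     if i \<in> unmatched x y \<and> pairing_regime x y then
       (if j \<in> unmatched x y \<and> j \<noteq> i \<and> k = y i \<and> l = x j
          then 1 / (real (card (unmatched x y)) - 1)
        else if j = i \<and> l = k \<and> k \<noteq> x i \<and> k \<noteq> y i then 1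
        else if j = i \<and> k = x i \<and> l = y i then 1
        else 0)
     else if j = i \<and> l = k then 1 else 0)"

definition hat_rate ::
  "('d::finite \<Rightarrow> 'n::finite) \<times> ('d \<Rightarrow> 'n) \<Rightarrow> ('d \<Rightarrow> 'n) \<times> ('d \<Rightarrow> 'n) \<Rightarrow> real" where
  "hat_rate = (\<lambda>(x, y) (x', y').
     \<Sum>(i, k)\<in>UNIV. \<Sum>(j, l)\<in>UNIV.
       if x' = x(i := k) \<and> y' = y(j := l)
       then q_hat x y (i, k) (j, l) / (real CARD('n) - 1) else 0)"

definition hat_coupling ::
  "('d::finite \<Rightarrow> 'n::finite) \<Rightarrow> ('d \<Rightarrow> 'n) \<Rightarrow>
   'w measure \<Rightarrow> (real \<Rightarrow> 'w \<Rightarrow> 'd \<Rightarrow> 'n) \<Rightarrow> (real \<Rightarrow> 'w \<Rightarrow> 'd \<Rightarrow> 'n) \<Rightarrow> bool" where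
  "hat_coupling x y M X Y \<longleftrightarrow> jump_process hat_rate (x, y) M (\<lambda>t \<omega>. (X t \<omega>, Y t \<omega>))"

end

theory Submission
  imports Defs
begin

text \<open>
  Under the specific coupling the number of unmatched coordinates is a death chain; let \<open>p\<^sub>N t\<close> be
  the probability that it has not reached 0 by time \<open>t\<close> when started from \<open>N\<close>. For every coupling,
  the joint law of the two states after a short time \<open>h\<close> is, given the present states, a coupling of
  two laws which each change more than one coordinate with probability \<open>O(h\<^sup>2)\<close> only. Weak duality
  for this transport problem bounds the decrease of the expected value of \<open>p\<^sub>N\<close> from above: with
  \<open>n - 1\<close> as unit of time, its rate is at most
  \<open>N max {p\<^sub>N - p\<^sub>N\<^sub>-\<^sub>2, 2 (p\<^sub>N - p\<^sub>N\<^sub>-\<^sub>1)} + N (n - 2) (p\<^sub>N - p\<^sub>N\<^sub>-\<^sub>1)\<close>. The specific coupling attains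
  this rate, because \<open>p\<^sub>N - 2 p\<^sub>N\<^sub>-\<^sub>1 + p\<^sub>N\<^sub>-\<^sub>2\<close> has the sign that matches the regime of \<open>N\<close> at all times,
  which follows by comparison from the linear differential equations for these second differences.
  Summing over a partition of \<open>[0, t]\<close> of mesh \<open>h \<rightarrow> 0\<close> shows that no co-adapted coupling has a
  smaller probability of \<open>X\<^sub>t \<noteq> Y\<^sub>t\<close>, and the specific coupling stays together once it has met.
\<close>

subsection \<open>Matrix exponentials\<close>

text \<open>A co-adapted coupling need not be Markov, so there is no generator of the pair to
  optimise over. Co-adaptedness is exploited in one way only: given that the pair is in
  \<open>(a, b)\<close> at time \<open>s\<close>, each walk at time \<open>s + h\<close> has its
  transition law. These two marginals are all that \<open>coupling_step\<close> sees, and its error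
  constant depends neither on the states nor on the remaining time; this uniformity allows the
  errors of a partition to be added up. The form of the rate comes from the two ways to match a
  coordinate. Either one walk jumps to the value of the other, which is worth a whole single match
  or half of a double match, whence the maximum; or both jump to one of the \<open>n - 2\<close>
  other values, and each pays half of a single match. The obstacle is the sign of the second
  differences. The levels \<open>N\<close> outside the pairing regime are 1 for
  \<open>n \<ge> 4\<close>, 1 and 3 for \<open>n = 3\<close>, and all odd \<open>N\<close> for
  \<open>n = 2\<close>. These patterns need different inductions, because a level just above such an
  \<open>N\<close> has a source term without an obvious sign.\<close>

lemma exp_series_summable:
  fixes a :: "nat \<Rightarrow> real"
  assumes "\<And>k. \<bar>a k\<bar> \<le> C ^ k"
  shows "summable (\<lambda>k. t ^ k / fact k * a k)"
proof (rule summable_comparison_test')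
  show "summable (\<lambda>k. (\<bar>t\<bar> * C) ^ k /\<^sub>R fact k)"
    by (rule summable_exp_generic)
  show "norm (t ^ k / fact k * a k) \<le> (\<bar>t\<bar> * C) ^ k /\<^sub>R fact k" for k
    using mult_left_mono[OF assms, of "\<bar>t\<bar> ^ k / fact k" k]
    by (simp add: abs_mult power_abs field_simps)
qed

lemma exp_series_has_derivative:
  fixes a :: "nat \<Rightarrow> real"
  assumes "\<And>k. \<bar>a k\<bar> \<le> C ^ k"
  shows "((\<lambda>t. \<Sum>k. t ^ k / fact k * a k) has_real_derivative
           (\<Sum>k. t ^ k / fact k * a (Suc k))) (at t)"
proof -
  have "((\<lambda>t. \<Sum>k. a k / fact k * t ^ k) has_real_derivative
           (\<Sum>k. diffs (\<lambda>k. a k / fact k) k * t ^ k)) (at t)"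
    using exp_series_summable[OF assms]
    by (intro termdiffs_strong_converges_everywhere) (simp add: mult_ac)
  moreover have "diffs (\<lambda>k. a k / fact k) k * t ^ k = t ^ k / fact k * a (Suc k)" for k
    by (simp add: diffs_def del: of_nat_Suc)
  ultimately show ?thesis
    by (simp add: mult_ac)
qed

definition mexp :: "('s::finite \<Rightarrow> 's \<Rightarrow> real) \<Rightarrow> real \<Rightarrow> 's \<Rightarrow> 's \<Rightarrow> real" where
  "mexp G t a b = (\<Sum>k. t ^ k / fact k * matrix_power G k a b)"

lemma transition_eq_mexp: "transition q = mexp (generator q)"
  by (intro ext) (simp add: transition_def mexp_def)

lemma matrix_power_bound:
  "\<bar>matrix_power G k a b\<bar> \<le> (\<Sum>a\<in>UNIV. \<Sum>b\<in>UNIV. \<bar>G a b\<bar>) ^ k"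
proof (induction k arbitrary: a)
  case (Suc k)
  let ?K = "\<Sum>a\<in>UNIV. \<Sum>b\<in>UNIV. \<bar>G a b\<bar>"
  have K: "?K \<ge> 0" by (intro sum_nonneg) auto
  have "\<bar>matrix_power G (Suc k) a b\<bar> \<le> (\<Sum>c\<in>UNIV. \<bar>G a c\<bar> * ?K ^ k)"
    unfolding matrix_power.simps
    by (rule order_trans[OF sum_abs]) (intro sum_mono, simp add: abs_mult mult_left_mono Suc)
  also have "\<dots> = (\<Sum>c\<in>UNIV. \<bar>G a c\<bar>) * ?K ^ k"
    by (simp add: sum_distrib_right)
  also have "\<dots> \<le> ?K * ?K ^ k"
    by (intro mult_right_mono member_le_sum[of a UNIV "\<lambda>a. \<Sum>b\<in>UNIV. \<bar>G a b\<bar>"])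
      (auto intro!: sum_nonneg zero_le_power)
  finally show ?case by simp
qed auto

lemma matrix_power_Suc_right:
  "matrix_power G (Suc k) a b = (\<Sum>c\<in>UNIV. matrix_power G k a c * G c b)"
proof (induction k arbitrary: a)
  case 0
  show ?case by (simp add: if_distrib if_distribR cong: if_cong)
next
  case (Suc k)
  have "matrix_power G (Suc (Suc k)) a b
      = (\<Sum>e\<in>UNIV. G a e * (\<Sum>c\<in>UNIV. matrix_power G k e c * G c b))"
    by (subst matrix_power.simps(2)) (simp only: Suc)
  also have "\<dots> = (\<Sum>c\<in>UNIV. \<Sum>e\<in>UNIV. G a e * matrix_power G k e c * G c b)"
    unfolding sum_distrib_left mult.assoc by (rule sum.swap)
  finally show ?case
    by (simp add: sum_distrib_right)
qed

lemma mexp_summable: "summable (\<lambda>k. t ^ k / fact k * matrix_power G k a b)"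
  by (rule exp_series_summable) (rule matrix_power_bound)

lemma mexp_has_derivative:
  "((\<lambda>t. mexp G t a b) has_real_derivative (\<Sum>c\<in>UNIV. G a c * mexp G t c b)) (at t)"
proof -
  have "((\<lambda>t. mexp G t a b) has_real_derivative
          (\<Sum>k. t ^ k / fact k * matrix_power G (Suc k) a b)) (at t)"
    unfolding mexp_def by (rule exp_series_has_derivative) (rule matrix_power_bound)
  also have "(\<Sum>k. t ^ k / fact k * matrix_power G (Suc k) a b)
      = (\<Sum>k. \<Sum>c\<in>UNIV. G a c * (t ^ k / fact k * matrix_power G k c b))"
    by (simp add: sum_distrib_left mult_ac)
  also have "\<dots> = (\<Sum>c\<in>UNIV. \<Sum>k. G a c * (t ^ k / fact k * matrix_power G k c b))"
    by (rule suminf_sum) (intro summable_mult mexp_summable)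
  also have "\<dots> = (\<Sum>c\<in>UNIV. G a c * mexp G t c b)"
    unfolding mexp_def by (intro sum.cong refl suminf_mult mexp_summable)
  finally show ?thesis .
qed

lemma mexp_has_derivative_right:
  "((\<lambda>t. mexp G t a b) has_real_derivative (\<Sum>c\<in>UNIV. mexp G t a c * G c b)) (at t)"
proof -
  have "((\<lambda>t. mexp G t a b) has_real_derivative
          (\<Sum>k. t ^ k / fact k * matrix_power G (Suc k) a b)) (at t)"
    unfolding mexp_def by (rule exp_series_has_derivative) (rule matrix_power_bound)
  also have "(\<Sum>k. t ^ k / fact k * matrix_power G (Suc k) a b)
      = (\<Sum>k. \<Sum>c\<in>UNIV. t ^ k / fact k * matrix_power G k a c * G c b)"
    by (simp only: matrix_power_Suc_right sum_distrib_left mult.assoc)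
  also have "\<dots> = (\<Sum>c\<in>UNIV. \<Sum>k. t ^ k / fact k * matrix_power G k a c * G c b)"
    by (rule suminf_sum) (intro summable_mult2 mexp_summable)
  also have "\<dots> = (\<Sum>c\<in>UNIV. mexp G t a c * G c b)"
    unfolding mexp_def by (intro sum.cong refl suminf_mult2[symmetric] mexp_summable)
  finally show ?thesis .
qed

lemma mexp_0: "mexp G 0 a b = (if a = b then 1 else 0)"
proof -
  have "mexp G 0 a b = (\<Sum>k. (matrix_power G k a b / fact k) * 0 ^ k)"
    by (simp add: mexp_def mult_ac)
  then show ?thesis by (simp only: powser_zero) simp
qed

text \<open>\<open>mexp G (t - s)\<close> applied to \<open>u s\<close> does not depend on
  \<open>s\<close>, so a solution of the backward equation is determined by its initial value.
  Lumping, products, uniformisation and the survival probabilities of the specific coupling are all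
  obtained by checking this equation instead of manipulating series.\<close>

lemma mexp_unique:
  fixes u :: "real \<Rightarrow> 's::finite \<Rightarrow> real"
  assumes u: "\<And>t a. ((\<lambda>t. u t a) has_real_derivative (\<Sum>c\<in>UNIV. G a c * u t c)) (at t)"
  shows "u t a = (\<Sum>c\<in>UNIV. mexp G t a c * u 0 c)"
proof -
  let ?v = "\<lambda>s. \<Sum>c\<in>UNIV. mexp G (t - s) a c * u s c"
  have "(?v has_real_derivative 0) (at s)" for s
  proof -
    have "((\<lambda>s. mexp G (t - s) a c) has_real_derivative
            (\<Sum>e\<in>UNIV. mexp G (t - s) a e * G e c) * (- 1)) (at s)" for c
      by (rule DERIV_chain2[where f = "\<lambda>r. mexp G r a c"], rule mexp_has_derivative_right)
        (auto intro!: derivative_eq_intros)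
    then have "(?v has_real_derivative
        (\<Sum>c\<in>UNIV. ((\<Sum>e\<in>UNIV. mexp G (t - s) a e * G e c) * (- 1)) * u s c +
            (\<Sum>e\<in>UNIV. G c e * u s e) * mexp G (t - s) a c)) (at s)"
      by (intro DERIV_sum DERIV_mult u)
    moreover have "(\<Sum>c\<in>UNIV. ((\<Sum>e\<in>UNIV. mexp G (t - s) a e * G e c) * (- 1)) * u s c +
            (\<Sum>e\<in>UNIV. G c e * u s e) * mexp G (t - s) a c) = 0"
    proof -
      have "(\<Sum>c\<in>UNIV. (\<Sum>e\<in>UNIV. mexp G (t - s) a e * G e c) * u s c)
          = (\<Sum>c\<in>UNIV. (\<Sum>e\<in>UNIV. G c e * u s e) * mexp G (t - s) a c)"
        unfolding sum_distrib_right by (subst sum.swap) (simp add: mult_ac)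
      then show ?thesis
        by (simp only: sum.distrib mult_minus1_right mult_minus_left sum_negf)
    qed
    ultimately show ?thesis by simp
  qed
  then have "?v t = ?v 0" by (intro DERIV_isconst_all) blast
  then show ?thesis by (simp add: mexp_0 if_distrib if_distribR cong: if_cong)
qed

lemma mexp_scale: "mexp (\<lambda>a b. c * G a b) t a b = mexp G (c * t) a b"
proof -
  have "matrix_power (\<lambda>a b. c * G a b) k a b = c ^ k * matrix_power G k a b" for k a
    by (induction k arbitrary: a) (simp_all add: sum_distrib_left mult_ac)
  then show ?thesis by (simp add: mexp_def power_mult_distrib mult_ac)
qed

text \<open>By hypothesis \<open>G\<close> maps functions of \<open>\<phi>\<close> to functions of
  \<open>\<phi>\<close> and acts on them as \<open>H\<close>; composition with \<open>\<phi>\<close>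
  therefore turns solutions for \<open>H\<close> into solutions for \<open>G\<close>.\<close>

lemma mexp_lump:
  fixes \<phi> :: "'s::finite \<Rightarrow> 'r::finite"
  assumes "\<And>a f. (\<Sum>c\<in>UNIV. G a c * f (\<phi> c)) = (\<Sum>r\<in>UNIV. H (\<phi> a) r * f r)"
  shows "(\<Sum>c\<in>UNIV. mexp G t a c * f (\<phi> c)) = (\<Sum>r\<in>UNIV. mexp H t (\<phi> a) r * f r)"
proof -
  have d: "((\<lambda>t. \<Sum>r\<in>UNIV. mexp H t b r * f r) has_real_derivative
      (\<Sum>e\<in>UNIV. H b e * (\<Sum>r\<in>UNIV. mexp H t e r * f r))) (at t)" for t b
  proof -
    have "((\<lambda>t. \<Sum>r\<in>UNIV. mexp H t b r * f r) has_real_derivative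
      (\<Sum>r\<in>UNIV. (\<Sum>e\<in>UNIV. H b e * mexp H t e r) * f r)) (at t)"
      by (intro DERIV_sum DERIV_cmult_right mexp_has_derivative)
    also have "(\<Sum>r\<in>UNIV. (\<Sum>e\<in>UNIV. H b e * mexp H t e r) * f r)
        = (\<Sum>e\<in>UNIV. H b e * (\<Sum>r\<in>UNIV. mexp H t e r * f r))"
      unfolding sum_distrib_right sum_distrib_left by (subst sum.swap) (simp add: mult_ac)
    finally show ?thesis .
  qed
  have "((\<lambda>t. \<Sum>r\<in>UNIV. mexp H t (\<phi> a) r * f r) has_real_derivative
      (\<Sum>c\<in>UNIV. G a c * (\<Sum>r\<in>UNIV. mexp H t (\<phi> c) r * f r))) (at t)" for t a
    unfolding assms[of a "\<lambda>b. \<Sum>r\<in>UNIV. mexp H t b r * f r"] by (rule d)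
  from mexp_unique[of "\<lambda>t a. \<Sum>r\<in>UNIV. mexp H t (\<phi> a) r * f r" G, OF this, of t a]
  show ?thesis by (simp add: mexp_0 if_distrib if_distribR cong: if_cong)
qed

lemma mexp_const:
  assumes "\<And>a. (\<Sum>c\<in>UNIV. G a c) = 0"
  shows "(\<Sum>c\<in>UNIV. mexp G t a c) = 1"
  using mexp_unique[of "\<lambda>t a. 1" G t a] assms by simp

text \<open>For \<open>h \<le> 1\<close> the series from its quadratic term on is at most
  \<open>h\<^sup>2\<close> times a fixed convergent series. One constant serves all pairs of
  states.\<close>

lemma mexp_first_order:
  fixes G :: "'s::finite \<Rightarrow> 's \<Rightarrow> real"
  obtains C where "C \<ge> 0"
    "\<And>h a b. 0 \<le> h \<Longrightarrow> h \<le> 1 \<Longrightarrow> \<bar>mexp G h a b - (if a = b then 1 else 0) - h * G a b\<bar> \<le> C * h\<^sup>2"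
proof -
  define K where "K = (\<Sum>a\<in>UNIV. \<Sum>b\<in>UNIV. \<bar>G a b\<bar>)"
  have K: "K \<ge> 0" unfolding K_def by (intro sum_nonneg) auto
  define C where "C = (\<Sum>k. K ^ (k + 2) / fact (k + 2))"
  have sK: "summable (\<lambda>k. K ^ k / fact k)"
    using summable_exp_generic[of K] by (simp add: field_simps)
  have sK2: "summable (\<lambda>k. K ^ (k + 2) / fact (k + 2))"
    by (rule summable_ignore_initial_segment[OF sK])
  have "C \<ge> 0" unfolding C_def by (intro suminf_nonneg sK2) (use K in auto)
  moreover have "\<bar>mexp G h a b - (if a = b then 1 else 0) - h * G a b\<bar> \<le> C * h\<^sup>2"
    if h: "0 \<le> h" "h \<le> 1" for h a b
  proof -
    let ?f = "\<lambda>k. h ^ k / fact k * matrix_power G k a b"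
    have m1: "matrix_power G (Suc 0) a b = G a b"
      by (simp add: if_distrib if_distribR cong: if_cong)
    have "mexp G h a b = (\<Sum>k. ?f (k + 2)) + (\<Sum>k<2. ?f k)"
      unfolding mexp_def by (rule suminf_split_initial_segment[OF mexp_summable])
    also have "(\<Sum>k<2. ?f k) = (if a = b then 1 else 0) + h * G a b"
      using m1 by (simp add: numeral_2_eq_2 del: matrix_power.simps(2))
    finally have eq: "mexp G h a b - (if a = b then 1 else 0) - h * G a b = (\<Sum>k. ?f (k + 2))"
      by simp
    have bd: "norm (?f (k + 2)) \<le> K ^ (k + 2) / fact (k + 2) * h\<^sup>2" for k
    proof -
      have "h ^ k \<le> 1" using h by (simp add: power_le_one)
      have "norm (?f (k + 2)) = h ^ k * h\<^sup>2 * \<bar>matrix_power G (k + 2) a b\<bar> / fact (k + 2)"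
        using h by (simp add: abs_mult power_add power2_eq_square field_simps del: matrix_power.simps)
      also have "\<dots> \<le> 1 * h\<^sup>2 * K ^ (k + 2) / fact (k + 2)"
        using \<open>h ^ k \<le> 1\<close> matrix_power_bound[of G "k + 2" a b] K h
        by (intro divide_right_mono mult_mono) (auto simp: K_def simp del: matrix_power.simps)
      finally show ?thesis by (simp add: field_simps)
    qed
    have "norm (\<Sum>k. ?f (k + 2)) \<le> (\<Sum>k. K ^ (k + 2) / fact (k + 2) * h\<^sup>2)"
      using bd by (intro norm_suminf_le summable_mult2 sK2)
    also have "\<dots> = C * h\<^sup>2"
      unfolding C_def by (rule suminf_mult2[symmetric, OF sK2])
    finally show ?thesis by (simp only: eq real_norm_def)
  qed
  ultimately show ?thesis by (rule that)
qed

text \<open>\<open>H\<close> moves one coordinate at a time, each according to \<open>G\<close>. By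
  the product rule the product of the one-coordinate exponentials solves the backward equation of
  \<open>H\<close>, with the indicator of \<open>b\<close> as initial value.\<close>

lemma mexp_prod:
  fixes G :: "'n::finite \<Rightarrow> 'n \<Rightarrow> real" and H :: "('d::finite \<Rightarrow> 'n) \<Rightarrow> ('d \<Rightarrow> 'n) \<Rightarrow> real"
  assumes "\<And>a f. (\<Sum>c\<in>UNIV. H a c * f c) = (\<Sum>i\<in>UNIV. \<Sum>k\<in>UNIV. G (a i) k * f (a(i := k)))"
  shows "mexp H t a b = (\<Prod>i\<in>UNIV. mexp G t (a i) (b i))"
proof -
  have "((\<lambda>t. \<Prod>i\<in>UNIV. mexp G t (a i) (b i)) has_real_derivative
      (\<Sum>c\<in>UNIV. H a c * (\<Prod>i\<in>UNIV. mexp G t (c i) (b i)))) (at t)" for t a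
  proof -
    have "((\<lambda>t. \<Prod>i\<in>UNIV. mexp G t (a i) (b i)) has_real_derivative
      (\<Sum>i\<in>UNIV. (\<Sum>k\<in>UNIV. G (a i) k * mexp G t k (b i)) * (\<Prod>j\<in>UNIV - {i}. mexp G t (a j) (b j)))) (at t)"
      by (rule has_field_derivative_prod) (rule mexp_has_derivative)
    moreover have "(\<Prod>j\<in>UNIV. mexp G t ((a(i := k)) j) (b j))
        = mexp G t k (b i) * (\<Prod>j\<in>UNIV - {i}. mexp G t (a j) (b j))" for i k
      by (subst prod.remove[of _ i]) (auto intro!: prod.cong)
    ultimately show ?thesis
      unfolding assms by (simp add: sum_distrib_right mult_ac)
  qed
  from mexp_unique[of "\<lambda>t a. \<Prod>i\<in>UNIV. mexp G t (a i) (b i)" H, OF this, of t a]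
  have "(\<Prod>i\<in>UNIV. mexp G t (a i) (b i)) = (\<Sum>c\<in>UNIV. mexp H t a c * (if c = b then 1 else 0))"
  proof -
    have "(\<Prod>i\<in>UNIV. mexp G 0 (c i) (b i)) = (if c = b then 1 else 0)" for c
      by (auto simp: mexp_0 fun_eq_iff)
    then show ?thesis
      using \<open>(\<Prod>i\<in>UNIV. mexp G t (a i) (b i)) = _\<close> by simp
  qed
  then show ?thesis by (simp add: if_distrib cong: if_cong)
qed

subsection \<open>The number of unmatched coordinates\<close>

definition paired :: "nat \<Rightarrow> nat \<Rightarrow> bool" where
  "paired n N \<longleftrightarrow> even N \<or> (n \<noteq> 2 \<and> real N \<ge> 2 * (real n - 1) / (real n - 2))"

text \<open>The generator of the number of unmatched coordinates, with time measured in units of \<open>n - 1\<close>.\<close>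

definition death :: "nat \<Rightarrow> (nat \<Rightarrow> real) \<Rightarrow> nat \<Rightarrow> real" where
  "death n F N =
     (if paired n N
      then real N * (F (N - 2) - F N) + real N * (real n - 2) * (F (N - 1) - F N)
      else real N * real n * (F (N - 1) - F N))"

primrec death_power :: "nat \<Rightarrow> nat \<Rightarrow> nat \<Rightarrow> real" where
  "death_power n 0 = (\<lambda>N. if N = 0 then 0 else 1)"
| "death_power n (Suc k) = death n (death_power n k)"

text \<open>The semigroup of the death chain applied to the indicator of
  \<open>N \<noteq> 0\<close>. The chain lives on all of \<open>nat\<close>, whereas
  \<open>mexp\<close> is for finite types; the series converges because \<open>death\<close> at
  \<open>N\<close> looks only at levels up to \<open>N\<close>.\<close>

definition surv :: "nat \<Rightarrow> real \<Rightarrow> nat \<Rightarrow> real" where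
  "surv n t N = (\<Sum>k. t ^ k / fact k * death_power n k N)"

lemma death_power_bound:
  assumes "n \<ge> 2"
  shows "M \<le> N \<Longrightarrow> \<bar>death_power n k M\<bar> \<le> (2 * real N * real n) ^ k"
proof (induction k arbitrary: M)
  case (Suc k)
  let ?C = "(2 * real N * real n) ^ k"
  let ?F = "death_power n k"
  have F: "\<bar>?F a - ?F b\<bar> \<le> 2 * ?C" if "a \<le> N" "b \<le> N" for a b
    using Suc.IH[OF that(1)] Suc.IH[OF that(2)] by linarith
  have "\<bar>death n ?F M\<bar> \<le> real M * real n * (2 * ?C)"
  proof (cases "paired n M")
    case True
    have "\<bar>death n ?F M\<bar> \<le> real M * \<bar>?F (M - 2) - ?F M\<bar> + real M * (real n - 2) * \<bar>?F (M - 1) - ?F M\<bar>"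
      using True assms by (simp add: death_def order_trans[OF abs_triangle_ineq] abs_mult)
    also have "\<dots> \<le> real M * (2 * ?C) + real M * (real n - 2) * (2 * ?C)"
      using assms Suc.prems by (intro add_mono mult_left_mono F) auto
    also have "\<dots> = real M * (real n - 1) * (2 * ?C)" by (simp add: algebra_simps)
    also have "\<dots> \<le> real M * real n * (2 * ?C)"
      by (intro mult_right_mono mult_left_mono) auto
    finally show ?thesis .
  next
    case False
    then show ?thesis
      using Suc.prems by (simp add: death_def abs_mult mult_left_mono F)
  qed
  also have "\<dots> \<le> real N * real n * (2 * ?C)"
    using Suc.prems by (intro mult_right_mono) auto
  finally show ?case by (simp add: mult_ac)
qed simp

lemma surv_has_derivative:
  assumes "n \<ge> 2"
  shows "((\<lambda>t. surv n t N) has_real_derivative death n (surv n t) N) (at t)"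
proof -
  have sm: "summable (\<lambda>k. t ^ k / fact k * death_power n k M)" for M
    using death_power_bound[OF assms, of M M] by (intro exp_series_summable) auto
  have mul: "c * (surv n t a - surv n t b) =
      (\<Sum>k. t ^ k / fact k * (c * (death_power n k a - death_power n k b)))"
    and smul: "summable (\<lambda>k. t ^ k / fact k * (c * (death_power n k a - death_power n k b)))" for c a b
  proof -
    have "(\<lambda>k. c * (t ^ k / fact k * death_power n k a - t ^ k / fact k * death_power n k b)) sums
        (c * (surv n t a - surv n t b))"
      unfolding surv_def by (intro sums_mult sums_diff summable_sums sm)
    then show "c * (surv n t a - surv n t b) =
      (\<Sum>k. t ^ k / fact k * (c * (death_power n k a - death_power n k b)))"
      "summable (\<lambda>k. t ^ k / fact k * (c * (death_power n k a - death_power n k b)))"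
      by (auto simp: sums_iff algebra_simps)
  qed
  have "((\<lambda>t. surv n t N) has_real_derivative (\<Sum>k. t ^ k / fact k * death_power n (Suc k) N)) (at t)"
    unfolding surv_def using death_power_bound[OF assms, of N N]
    by (intro exp_series_has_derivative) auto
  also have "(\<Sum>k. t ^ k / fact k * death_power n (Suc k) N) = death n (surv n t) N"
  proof (cases "paired n N")
    case True
    then show ?thesis
      by (simp only: death_def death_power.simps if_True mul suminf_add[OF smul smul] distrib_left)
  next
    case False
    then show ?thesis
      by (simp add: death_def mul)
  qed
  finally show ?thesis .
qed

lemma surv_0: "surv n 0 N = (if N = 0 then 0 else 1)"
proof -
  have "surv n 0 N = (\<Sum>k. (death_power n k N / fact k) * 0 ^ k)"
    by (simp add: surv_def mult_ac)
  then show ?thesis by (simp only: powser_zero) simp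
qed

lemma surv_no_unmatched: "surv n t 0 = 0"
proof -
  have "death_power n k 0 = 0" for k by (cases k) (simp_all add: death_def)
  then show ?thesis by (simp add: surv_def)
qed

section \<open>Differential equations for the survival probabilities, and monotonicity in the
  level\<close>

lemma surv_deriv_pair:
  assumes "n \<ge> 2" "paired n (m + 2)"
  shows "((\<lambda>t. surv n t (m + 2)) has_real_derivative
     (real m + 2) * (surv n t m - surv n t (m + 2))
     + (real m + 2) * (real n - 2) * (surv n t (m + 1) - surv n t (m + 2))) (at t)"
  using surv_has_derivative[OF assms(1), of "m + 2" t] assms(2) by (simp add: death_def add_ac)

lemma surv_deriv_single:
  assumes "n \<ge> 2" "\<not> paired n (m + 1)"
  shows "((\<lambda>t. surv n t (m + 1)) has_real_derivative
     (real m + 1) * real n * (surv n t m - surv n t (m + 1))) (at t)"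
  using surv_has_derivative[OF assms(1), of "m + 1" t] assms(2) by (simp add: death_def add_ac)

text \<open>Integrating factor: \<open>exp (c * t) * u t\<close> is nondecreasing. In each
  application \<open>c\<close> is the rate at which \<open>u\<close> damps itself, and the source
  \<open>u' + c u\<close> is a combination of quantities whose sign is already known.\<close>

lemma nonneg_of_linear_ode:
  fixes u :: "real \<Rightarrow> real"
  assumes d: "\<And>t. t \<ge> 0 \<Longrightarrow> (u has_real_derivative u' t) (at t)"
    and u': "\<And>t. t \<ge> 0 \<Longrightarrow> u' t + c * u t \<ge> 0"
    and "u 0 \<ge> 0" "t \<ge> 0"
  shows "u t \<ge> 0"
proof -
  have "exp (c * 0) * u 0 \<le> exp (c * t) * u t"
  proof (rule DERIV_nonneg_imp_nondecreasing[OF \<open>t \<ge> 0\<close>])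
    fix s :: real assume s: "0 \<le> s"
    have "((\<lambda>s. exp (c * s) * u s) has_real_derivative exp (c * s) * (u' s + c * u s)) (at s)"
      by (auto intro!: derivative_eq_intros d s simp: algebra_simps)
    then show "\<exists>y. ((\<lambda>s. exp (c * s) * u s) has_real_derivative y) (at s) \<and> y \<ge> 0"
      using u'[OF s] by (intro exI conjI) (assumption, simp)
  qed
  with \<open>u 0 \<ge> 0\<close> have "0 \<le> exp (c * t) * u t" by simp
  then show ?thesis by (simp add: zero_le_mult_iff)
qed

lemma not_paired_1: "n \<ge> 2 \<Longrightarrow> \<not> paired n 1"
  by (cases "n = 2") (auto simp: paired_def not_le divide_simps)

lemma paired_2: "paired 2 N \<longleftrightarrow> even N"
  by (simp add: paired_def)

lemma paired_3: "paired 3 N \<longleftrightarrow> even N \<or> N \<ge> 4"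
  by (auto simp: paired_def)

text \<open>For \<open>n \<ge> 4\<close> the threshold \<open>2 (n - 1) / (n - 2)\<close> is at most
  3, and the levels 0 and 2 below it are even.\<close>

lemma paired_ge_4: "n \<ge> 4 \<Longrightarrow> N \<noteq> 1 \<Longrightarrow> paired n N"
proof (cases "N < 3")
  case False
  assume "n \<ge> 4"
  then have "2 * (real n - 1) / (real n - 2) \<le> 3" by (simp add: divide_simps)
  also have "3 \<le> real N" using False by simp
  finally show ?thesis using \<open>n \<ge> 4\<close> by (auto simp: paired_def)
next
  case True
  assume "N \<noteq> 1"
  with True have "even N" by presburger
  then show ?thesis by (simp add: paired_def)
qed

text \<open>Strong induction: the difference of two consecutive levels damps itself, and its source
  is a nonnegative combination of differences further down. The regimes of \<open>m\<close> and
  \<open>m + 1\<close> determine which equations apply, hence the cases.\<close>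

lemma surv_step:
  assumes n: "n \<ge> 2" and "t \<ge> 0"
  shows "surv n t m \<le> surv n t (m + 1)"
  using \<open>t \<ge> 0\<close>
proof (induction m arbitrary: t rule: less_induct)
  case (less m)
  consider "m = 0" | j where "m = j + 1" "\<not> paired n m" "\<not> paired n (m + 1)"
    | j where "m = j + 1" "\<not> paired n m" "paired n (m + 1)"
    | j where "m = j + 2" "paired n m" "\<not> paired n (m + 1)"
    | j where "m = j + 2" "paired n m" "paired n (m + 1)" "n \<ge> 3"
  proof -
    have "m = 0 \<or> (\<exists>j. m = j + 1)" by presburger
    moreover have "paired n m \<Longrightarrow> m = 0 \<or> (\<exists>j. m = j + 2)"
      using not_paired_1[OF n] by (metis One_nat_def add_2_eq_Suc' not0_implies_Suc)
    \<comment> \<open>The source of the last case has the coefficient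
      \<open>(j + 2) (n - 1) - (j + 3)\<close>, which could be negative for \<open>n = 2\<close>;
      but then neighbouring levels are never both paired.\<close>
    moreover have "paired n m \<Longrightarrow> paired n (m + 1) \<Longrightarrow> n \<ge> 3"
      using n paired_2 by (cases "n = 2") auto
    ultimately show ?thesis using that by metis
  qed
  then show ?case
  proof cases
    case 1
    have "0 \<le> surv n t (0 + 1)"
    proof (rule nonneg_of_linear_ode[OF surv_deriv_single[OF n]])
      show "(real 0 + 1) * real n * (surv n t 0 - surv n t (0 + 1)) + real n * surv n t (0 + 1) \<ge> 0" for t
        by (simp add: surv_no_unmatched algebra_simps)
    qed (use not_paired_1[OF n] less.prems in \<open>auto simp: surv_0\<close>)
    with 1 show ?thesis by (simp add: surv_no_unmatched)
  next
    case 2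
    have "0 \<le> surv n t (j + 1 + 1) - surv n t (j + 1)"
    proof (rule nonneg_of_linear_ode[where c = "(real j + 2) * real n",
          OF DERIV_diff[OF surv_deriv_single[OF n] surv_deriv_single[OF n]]])
      fix t :: real assume "t \<ge> 0"
      then have "(real j + 1) * real n * (surv n t (j + 1) - surv n t j) \<ge> 0"
        using less.IH[of j t] 2 by simp
      then show "(real (j + 1) + 1) * real n * (surv n t (j + 1) - surv n t (j + 1 + 1)) -
          (real j + 1) * real n * (surv n t j - surv n t (j + 1)) +
          (real j + 2) * real n * (surv n t (j + 1 + 1) - surv n t (j + 1)) \<ge> 0"
        by (simp add: algebra_simps)
    qed (use 2 less.prems in \<open>auto simp: surv_0\<close>)
    with 2 show ?thesis by simp
  next
    case 3
    have "0 \<le> surv n t (j + 2) - surv n t (j + 1)"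
    proof (rule nonneg_of_linear_ode[where c = "(real j + 2) * (real n - 1)",
          OF DERIV_diff[OF surv_deriv_pair[OF n] surv_deriv_single[OF n]]])
      fix t :: real assume "t \<ge> 0"
      \<comment> \<open>The lower difference enters the source with the coefficient
        \<open>(j + 1) n - (j + 2)\<close>.\<close>
      have "real j + 2 \<le> (real j + 1) * 2" by simp
      also have "\<dots> \<le> (real j + 1) * real n" using n by (intro mult_left_mono) auto
      finally have "((real j + 1) * real n - (real j + 2)) * (surv n t (j + 1) - surv n t j) \<ge> 0"
        using less.IH[of j t] 3 \<open>t \<ge> 0\<close> by simp
      then show "(real j + 2) * (surv n t j - surv n t (j + 2)) +
          (real j + 2) * (real n - 2) * (surv n t (j + 1) - surv n t (j + 2)) -
          (real j + 1) * real n * (surv n t j - surv n t (j + 1)) +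
          (real j + 2) * (real n - 1) * (surv n t (j + 2) - surv n t (j + 1)) \<ge> 0"
        by (simp add: algebra_simps)
    qed (use 3 less.prems in \<open>auto simp: surv_0\<close>)
    with 3 show ?thesis by simp
  next
    case 4
    have "0 \<le> surv n t (j + 2 + 1) - surv n t (j + 2)"
    proof (rule nonneg_of_linear_ode[where c = "(real j + 3) * real n",
          OF DERIV_diff[OF surv_deriv_single[OF n] surv_deriv_pair[OF n]]])
      fix t :: real assume "t \<ge> 0"
      then have "(real j + 2) * (surv n t (j + 1) - surv n t j) \<ge> 0"
          "(real j + 2) * (real n - 1) * (surv n t (j + 2) - surv n t (j + 1)) \<ge> 0"
        using less.IH[of j t] less.IH[of "j + 1" t] 4 n by (simp_all add: numeral_eq_Suc)
      then have "0 \<le> (real j + 2) * (surv n t (j + 1) - surv n t j)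
          + (real j + 2) * (real n - 1) * (surv n t (j + 2) - surv n t (j + 1))" by linarith
      then show "(real (j + 2) + 1) * real n * (surv n t (j + 2) - surv n t (j + 2 + 1)) -
          ((real j + 2) * (surv n t j - surv n t (j + 2)) +
           (real j + 2) * (real n - 2) * (surv n t (j + 1) - surv n t (j + 2))) +
          (real j + 3) * real n * (surv n t (j + 2 + 1) - surv n t (j + 2)) \<ge> 0"
        by (simp add: algebra_simps)
    qed (use 4 less.prems in \<open>auto simp: surv_0\<close>)
    with 4 show ?thesis by simp
  next
    case 5
    have "0 \<le> surv n t ((j + 1) + 2) - surv n t (j + 2)"
    proof (rule nonneg_of_linear_ode[where c = "(real j + 3) * (real n - 1)",
          OF DERIV_diff[OF surv_deriv_pair[OF n] surv_deriv_pair[OF n]]])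
      fix t :: real assume "t \<ge> 0"
      have "real j + 3 \<le> (real j + 2) * 2" by simp
      also have "\<dots> \<le> (real j + 2) * (real n - 1)" using 5 by (intro mult_left_mono) auto
      finally have "((real j + 2) * (real n - 1) - (real j + 3)) * (surv n t (j + 2) - surv n t (j + 1)) \<ge> 0"
        using less.IH[of "j + 1" t] 5 \<open>t \<ge> 0\<close> by (simp add: numeral_eq_Suc)
      moreover have "(real j + 2) * (surv n t (j + 1) - surv n t j) \<ge> 0"
        using less.IH[of j t] 5 \<open>t \<ge> 0\<close> by simp
      ultimately have "0 \<le> (real j + 2) * (surv n t (j + 1) - surv n t j)
          + ((real j + 2) * (real n - 1) - (real j + 3)) * (surv n t (j + 2) - surv n t (j + 1))"
        by linarith
      then show "(real (j + 1) + 2) * (surv n t (j + 1) - surv n t (j + 1 + 2)) +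
          (real (j + 1) + 2) * (real n - 2) * (surv n t (j + 1 + 1) - surv n t (j + 1 + 2)) -
          ((real j + 2) * (surv n t j - surv n t (j + 2)) +
           (real j + 2) * (real n - 2) * (surv n t (j + 1) - surv n t (j + 2))) +
          (real j + 3) * (real n - 1) * (surv n t (j + 1 + 2) - surv n t (j + 2)) \<ge> 0"
        by (simp add: algebra_simps numeral_eq_Suc)
    qed (use 5 less.prems in \<open>auto simp: surv_0 add_ac\<close>)
    with 5 show ?thesis by (simp add: add_ac)
  qed
qed

section \<open>Signs of the second differences of the survival probabilities\<close>

lemma surv_concave_step:
  assumes n: "n \<ge> 3" and p: "paired n (m + 4)" "paired n (m + 3)" "paired n (m + 2)"
    and le: "real n \<le> (real m + 3) * (real n - 2)"
    and c3: "\<And>t. t \<ge> 0 \<Longrightarrow> surv n t (m + 3) + surv n t (m + 1) \<le> 2 * surv n t (m + 2)"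
    and c2: "\<And>t. t \<ge> 0 \<Longrightarrow> surv n t (m + 2) + surv n t m \<le> 2 * surv n t (m + 1)"
    and "t \<ge> 0"
  shows "surv n t (m + 4) + surv n t (m + 2) \<le> 2 * surv n t (m + 3)"
proof -
  have n2: "n \<ge> 2" using n by simp
  note pair = surv_deriv_pair[OF n2]
  have "0 \<le> 2 * surv n t ((m + 1) + 2) - (surv n t ((m + 2) + 2) + surv n t (m + 2))"
  proof (rule nonneg_of_linear_ode[where c = "(real m + 4) * (real n - 1)",
        OF DERIV_diff[OF DERIV_cmult[OF pair] DERIV_add[OF pair pair]]])
    fix t :: real assume t: "t \<ge> 0"
    let ?s = "surv n t"
    \<comment> \<open>The source consists of the second differences at the two preceding levels. The
      nearer one has the coefficient \<open>(m + 3) (n - 2) - n\<close>, which explains the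
      hypothesis \<open>le\<close>.\<close>
    have "((real m + 3) * (real n - 2) - real n) * (2 * ?s (m + 2) - ?s (m + 3) - ?s (m + 1)) \<ge> 0"
      "(real m + 2) * (2 * ?s (m + 1) - ?s (m + 2) - ?s m) \<ge> 0"
      using le c2[OF t] c3[OF t] by simp_all
    then have "0 \<le> ((real m + 3) * (real n - 2) - real n) * (2 * ?s (m + 2) - ?s (m + 3) - ?s (m + 1))
        + (real m + 2) * (2 * ?s (m + 1) - ?s (m + 2) - ?s m)" by linarith
    then show "2 * ((real (m + 1) + 2) * (?s (m + 1) - ?s (m + 1 + 2)) +
          (real (m + 1) + 2) * (real n - 2) * (?s (m + 1 + 1) - ?s (m + 1 + 2))) -
        ((real (m + 2) + 2) * (?s (m + 2) - ?s (m + 2 + 2)) +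
         (real (m + 2) + 2) * (real n - 2) * (?s (m + 2 + 1) - ?s (m + 2 + 2)) +
         ((real m + 2) * (?s m - ?s (m + 2)) +
          (real m + 2) * (real n - 2) * (?s (m + 1) - ?s (m + 2)))) +
        (real m + 4) * (real n - 1) * (2 * ?s (m + 1 + 2) - (?s (m + 2 + 2) + ?s (m + 2))) \<ge> 0"
      by (simp add: algebra_simps numeral_eq_Suc)
  qed (use p \<open>t \<ge> 0\<close> in \<open>auto simp: surv_0 numeral_eq_Suc\<close>)
  then show ?thesis by (simp add: numeral_eq_Suc)
qed

text \<open>The source vanishes identically here: \<open>2 surv n t 1 - surv n t 2\<close> solves
  \<open>u' = - 2 (n - 1) u\<close> and starts from 1.\<close>

lemma surv_concave_2:
  assumes n: "n \<ge> 2" and "t \<ge> 0"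
  shows "surv n t 2 \<le> 2 * surv n t 1"
proof -
  have "0 \<le> 2 * surv n t (0 + 1) - surv n t (0 + 2)"
    by (rule nonneg_of_linear_ode[where c = "2 * (real n - 1)",
          OF DERIV_diff[OF DERIV_cmult[OF surv_deriv_single[OF n]] surv_deriv_pair[OF n]]])
      (use not_paired_1[OF n] \<open>t \<ge> 0\<close> in \<open>auto simp: surv_no_unmatched surv_0 paired_def algebra_simps\<close>)
  then show ?thesis by (simp add: numeral_2_eq_2)
qed

lemma surv_concave_ge_4:
  assumes n: "n \<ge> 4"
  shows "t \<ge> 0 \<Longrightarrow> surv n t (m + 2) + surv n t m \<le> 2 * surv n t (m + 1)"
proof (induction m arbitrary: t rule: less_induct)
  case (less m)
  have n2: "n \<ge> 2" using n by simp
  consider "m = 0" | "m = 1" | j where "m = j + 2" by (metis One_nat_def add_2_eq_Suc' not0_implies_Suc)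
  then show ?case
  proof cases
    case 1
    then show ?thesis using surv_concave_2[OF n2 less.prems] by (simp add: surv_no_unmatched numeral_2_eq_2)
  next
    case 2
    note pair = surv_deriv_pair[OF n2] and single = surv_deriv_single[OF n2]
    have "0 \<le> 2 * surv n t (0 + 2) - (surv n t (1 + 2) + surv n t (0 + 1))"
    proof (rule nonneg_of_linear_ode[where c = "3 * (real n - 1)",
          OF DERIV_diff[OF DERIV_cmult[OF pair] DERIV_add[OF pair single]]])
      fix t :: real assume t: "t \<ge> 0"
      \<comment> \<open>Level 1 is not paired, so \<open>surv_concave_step\<close> does not reach
        level 3. The source is now \<open>n - 4\<close> times the quantity of
        \<open>surv_concave_2\<close>, which is where \<open>n \<ge> 4\<close> is sharp.\<close>
      have "(2 * (real n - 2) - real n) * (2 * surv n t 1 - surv n t 2) \<ge> 0"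
        using n surv_concave_2[OF n2 t] by simp
      then show "2 * ((real 0 + 2) * (surv n t 0 - surv n t (0 + 2)) +
            (real 0 + 2) * (real n - 2) * (surv n t (0 + 1) - surv n t (0 + 2))) -
          ((real 1 + 2) * (surv n t 1 - surv n t (1 + 2)) +
           (real 1 + 2) * (real n - 2) * (surv n t (1 + 1) - surv n t (1 + 2)) +
           (real 0 + 1) * real n * (surv n t 0 - surv n t (0 + 1))) +
          3 * (real n - 1) * (2 * surv n t (0 + 2) - (surv n t (1 + 2) + surv n t (0 + 1))) \<ge> 0"
        by (simp add: surv_no_unmatched algebra_simps numeral_eq_Suc)
    qed (use n not_paired_1[OF n2] less.prems in \<open>auto simp: surv_0 paired_ge_4\<close>)
    with 2 show ?thesis by (simp add: numeral_eq_Suc)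
  next
    case 3
    have "3 * (real n - 2) \<le> (real j + 3) * (real n - 2)" using n by (intro mult_right_mono) auto
    moreover have "real n \<le> 3 * (real n - 2)" using n by simp
    ultimately have "real n \<le> (real j + 3) * (real n - 2)" by linarith
    moreover have "surv n t (j + 3) + surv n t (j + 1) \<le> 2 * surv n t (j + 2)"
      "surv n t (j + 2) + surv n t j \<le> 2 * surv n t (j + 1)" if "t \<ge> 0" for t
      using 3 that less.IH[of "j + 1" t] less.IH[of j t] by (simp_all add: numeral_eq_Suc)
    ultimately have "surv n t (j + 4) + surv n t (j + 2) \<le> 2 * surv n t (j + 3)"
      using n less.prems by (intro surv_concave_step) (auto simp: paired_ge_4)
    with 3 show ?thesis by (simp add: numeral_eq_Suc)
  qed
qed

text \<open>With levels 1 and 3 unpaired, concavity at levels 4 and 5 has to be established before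
  \<open>surv_concave_step\<close> can take over. The difficulty is level 4: the convex second
  difference at level 3 enters its source with the wrong sign and must be controlled by the one at
  level 2.\<close>

lemma surv_three:
  assumes "t \<ge> 0"
  shows "2 * surv 3 t 2 \<le> surv 3 t 3 + surv 3 t 1"
    and "surv 3 t 4 + surv 3 t 2 \<le> 2 * surv 3 t 3"
    and "surv 3 t 5 + surv 3 t 3 \<le> 2 * surv 3 t 4"
proof -
  have "\<not> paired 3 (0 + 1)" "\<not> paired 3 (2 + 1)" "paired 3 (0 + 2)" "paired 3 (2 + 2)" "paired 3 (3 + 2)"
    by (auto simp: paired_3)
  note D = surv_deriv_single[OF _ this(1)] surv_deriv_single[OF _ this(2)]
    surv_deriv_pair[OF _ this(3)] surv_deriv_pair[OF _ this(4)] surv_deriv_pair[OF _ this(5)]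
  have d: "((\<lambda>t. surv 3 t 1) has_real_derivative - 3 * surv 3 t 1) (at t)"
    "((\<lambda>t. surv 3 t 2) has_real_derivative 2 * surv 3 t 1 - 4 * surv 3 t 2) (at t)"
    "((\<lambda>t. surv 3 t 3) has_real_derivative 9 * (surv 3 t 2 - surv 3 t 3)) (at t)"
    "((\<lambda>t. surv 3 t 4) has_real_derivative 4 * surv 3 t 2 + 4 * surv 3 t 3 - 8 * surv 3 t 4) (at t)"
    "((\<lambda>t. surv 3 t 5) has_real_derivative 5 * surv 3 t 3 + 5 * surv 3 t 4 - 10 * surv 3 t 5) (at t)" for t
    using D[of t] by (simp_all add: surv_no_unmatched algebra_simps eval_nat_numeral)
  have e2: "surv 3 t 2 - 2 * surv 3 t 1 \<le> 0" if "t \<ge> 0" for t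
    using surv_concave_2[OF _ that, of 3] by simp
  have e3: "0 \<le> surv 3 t 3 - 2 * surv 3 t 2 + surv 3 t 1" if "t \<ge> 0" for t
    by (rule nonneg_of_linear_ode[where c = 9,
          OF DERIV_add[OF DERIV_diff[OF d(3) DERIV_cmult[OF d(2)]] d(1)] _ _ that])
      (use e2 in \<open>auto simp: surv_0 algebra_simps\<close>)
  \<comment> \<open>Twice this quantity is the source in \<open>e4\<close>; its own source is a
    multiple of the quantity in \<open>e2\<close>.\<close>
  have w: "0 \<le> 2 * surv 3 t 1 - surv 3 t 2 - 3 * (surv 3 t 3 - 2 * surv 3 t 2 + surv 3 t 1)" if "t \<ge> 0" for t
    by (rule nonneg_of_linear_ode[where c = 9,
          OF DERIV_diff[OF DERIV_diff[OF DERIV_cmult[OF d(1)] d(2)]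
              DERIV_cmult[OF DERIV_add[OF DERIV_diff[OF d(3) DERIV_cmult[OF d(2)]] d(1)]]] _ _ that])
      (use e2 in \<open>auto simp: surv_0 algebra_simps\<close>)
  have e4: "0 \<le> 2 * surv 3 t 3 - (surv 3 t 4 + surv 3 t 2)" if "t \<ge> 0" for t
  proof (rule nonneg_of_linear_ode[where c = 8,
          OF DERIV_diff[OF DERIV_cmult[OF d(3)] DERIV_add[OF d(4) d(2)]] _ _ that], goal_cases)
    case (1 t)
    then show ?case using w[of t] by (simp add: algebra_simps)
  qed (simp add: surv_0)
  \<comment> \<open>With \<open>c = 10\<close> the source is exactly the quantity of
    \<open>e4\<close>.\<close>
  have e5: "0 \<le> 2 * surv 3 t 4 - (surv 3 t 5 + surv 3 t 3)" if "t \<ge> 0" for t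
    by (rule nonneg_of_linear_ode[where c = 10,
          OF DERIV_diff[OF DERIV_cmult[OF d(4)] DERIV_add[OF d(5) d(3)]] _ _ that])
      (use e4 in \<open>auto simp: surv_0 algebra_simps\<close>)
  show "2 * surv 3 t 2 \<le> surv 3 t 3 + surv 3 t 1" using e3[OF assms] by simp
  show "surv 3 t 4 + surv 3 t 2 \<le> 2 * surv 3 t 3" using e4[OF assms] by simp
  show "surv 3 t 5 + surv 3 t 3 \<le> 2 * surv 3 t 4" using e5[OF assms] by simp
qed

lemma surv_concave_3:
  "t \<ge> 0 \<Longrightarrow> surv 3 t (m + 4) + surv 3 t (m + 2) \<le> 2 * surv 3 t (m + 3)"
proof (induction m arbitrary: t rule: less_induct)
  case (less m)
  consider "m = 0" | "m = 1" | j where "m = j + 2" by (metis One_nat_def add_2_eq_Suc' not0_implies_Suc)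
  then show ?case
  proof cases
    case 1
    then show ?thesis using surv_three[OF less.prems] by (simp add: numeral_eq_Suc)
  next
    case 2
    then show ?thesis using surv_three[OF less.prems] by (simp add: numeral_eq_Suc)
  next
    case 3
    moreover have "surv 3 t ((j + 2) + 3) + surv 3 t ((j + 2) + 1) \<le> 2 * surv 3 t ((j + 2) + 2)"
      "surv 3 t ((j + 2) + 2) + surv 3 t (j + 2) \<le> 2 * surv 3 t ((j + 2) + 1)" if "t \<ge> 0" for t
      using 3 that less.IH[of "j + 1" t] less.IH[of j t] by (simp_all add: numeral_eq_Suc)
    ultimately have "surv 3 t ((j + 2) + 4) + surv 3 t ((j + 2) + 2) \<le> 2 * surv 3 t ((j + 2) + 3)"
      using less.prems by (intro surv_concave_step) (auto simp: paired_3)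
    with 3 show ?thesis by simp
  qed
qed

text \<open>
  The bound on the combination of two consecutive second differences is what makes the induction
  go through: it is the source term of the equation for the next even second difference.
\<close>

lemma surv_two:
  "t \<ge> 0 \<Longrightarrow>
    surv 2 t (2 * m + 2) + surv 2 t (2 * m) \<le> 2 * surv 2 t (2 * m + 1) \<and>
    2 * surv 2 t (2 * m + 2) \<le> surv 2 t (2 * m + 3) + surv 2 t (2 * m + 1) \<and>
    2 * (surv 2 t (2 * m + 3) - 2 * surv 2 t (2 * m + 2) + surv 2 t (2 * m + 1))
      + (surv 2 t (2 * m + 2) - 2 * surv 2 t (2 * m + 1) + surv 2 t (2 * m)) \<le> 0"
proof (induction m arbitrary: t)
  case 0
  have n: "(2::nat) \<le> 2" by simp
  have p: "\<not> paired 2 (0 + 1)" "paired 2 (0 + 2)" "\<not> paired 2 (2 + 1)" by (simp_all add: paired_2)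
  have d: "((\<lambda>t. surv 2 t 1) has_real_derivative - 2 * surv 2 t 1) (at t)"
    "((\<lambda>t. surv 2 t 2) has_real_derivative - 2 * surv 2 t 2) (at t)"
    "((\<lambda>t. surv 2 t 3) has_real_derivative 6 * (surv 2 t 2 - surv 2 t 3)) (at t)" for t
    using surv_deriv_single[OF n p(1), of t] surv_deriv_pair[OF n p(2), of t] surv_deriv_single[OF n p(3), of t]
    by (simp_all add: surv_no_unmatched algebra_simps eval_nat_numeral)
  have e2: "surv 2 t 2 - 2 * surv 2 t 1 \<le> 0" if "t \<ge> 0" for t
    using surv_concave_2[OF _ that, of 2] by simp
  have e3: "0 \<le> surv 2 t 3 - 2 * surv 2 t 2 + surv 2 t 1" if "t \<ge> 0" for t
    by (rule nonneg_of_linear_ode[where c = 6,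
          OF DERIV_add[OF DERIV_diff[OF d(3) DERIV_cmult[OF d(2)]] d(1)] _ _ that])
      (use e2 in \<open>auto simp: surv_0 algebra_simps\<close>)
  have w: "0 \<le> 2 * surv 2 t 1 - surv 2 t 2 - 2 * (surv 2 t 3 - 2 * surv 2 t 2 + surv 2 t 1)" if "t \<ge> 0" for t
    by (rule nonneg_of_linear_ode[where c = 6,
          OF DERIV_diff[OF DERIV_diff[OF DERIV_cmult[OF d(1)] d(2)]
              DERIV_cmult[OF DERIV_add[OF DERIV_diff[OF d(3) DERIV_cmult[OF d(2)]] d(1)]]] _ _ that])
      (use e2 in \<open>auto simp: surv_0 algebra_simps\<close>)
  show ?case using e2[OF 0] e3[OF 0] w[OF 0] by (simp add: surv_no_unmatched eval_nat_numeral)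
next
  case (Suc m)
  have n: "(2::nat) \<le> 2" by simp
  define k where "k = 2 * m"
  have p: "paired 2 (k + 2)" "\<not> paired 2 ((k + 2) + 1)" "paired 2 ((k + 2) + 2)" "\<not> paired 2 ((k + 4) + 1)"
    by (simp_all add: k_def paired_2)
  have d: "((\<lambda>t. surv 2 t (k + 2)) has_real_derivative (real k + 2) * (surv 2 t k - surv 2 t (k + 2))) (at t)"
    "((\<lambda>t. surv 2 t (k + 3)) has_real_derivative 2 * (real k + 3) * (surv 2 t (k + 2) - surv 2 t (k + 3))) (at t)"
    "((\<lambda>t. surv 2 t (k + 4)) has_real_derivative (real k + 4) * (surv 2 t (k + 2) - surv 2 t (k + 4))) (at t)"
    "((\<lambda>t. surv 2 t (k + 5)) has_real_derivative 2 * (real k + 5) * (surv 2 t (k + 4) - surv 2 t (k + 5))) (at t)" for t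
    using surv_deriv_pair[OF n p(1), of t] surv_deriv_single[OF n p(2), of t]
      surv_deriv_pair[OF n p(3), of t] surv_deriv_single[OF n p(4), of t]
    by (simp_all add: algebra_simps eval_nat_numeral)
  have IH: "2 * (surv 2 t (k + 3) - 2 * surv 2 t (k + 2) + surv 2 t (k + 1))
      + (surv 2 t (k + 2) - 2 * surv 2 t (k + 1) + surv 2 t k) \<le> 0" if "t \<ge> 0" for t
    using Suc.IH[OF that] by (simp add: k_def)
  have e4: "0 \<le> 2 * surv 2 t (k + 3) - (surv 2 t (k + 4) + surv 2 t (k + 2))" if "t \<ge> 0" for t
  proof (rule nonneg_of_linear_ode[where c = "real k + 4",
          OF DERIV_diff[OF DERIV_cmult[OF d(2)] DERIV_add[OF d(3) d(1)]] _ _ that])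
    fix t :: real assume t: "t \<ge> 0"
    let ?s = "surv 2 t"
    have "(real k + 2) * (2 * (?s (k + 3) - 2 * ?s (k + 2) + ?s (k + 1))
      + (?s (k + 2) - 2 * ?s (k + 1) + ?s k)) \<le> 0"
      using IH[OF t] by (intro mult_nonneg_nonpos) auto
    then show "2 * (2 * (real k + 3) * (?s (k + 2) - ?s (k + 3))) -
      ((real k + 4) * (?s (k + 2) - ?s (k + 4)) + (real k + 2) * (?s k - ?s (k + 2))) +
      (real k + 4) * (2 * ?s (k + 3) - (?s (k + 4) + ?s (k + 2))) \<ge> 0"
      by (simp add: algebra_simps)
  qed (auto simp: surv_0)
  have e5: "0 \<le> surv 2 t (k + 5) - 2 * surv 2 t (k + 4) + surv 2 t (k + 3)" if "t \<ge> 0" for t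
  proof (rule nonneg_of_linear_ode[where c = "2 * (real k + 5)",
          OF DERIV_add[OF DERIV_diff[OF d(4) DERIV_cmult[OF d(3)]] d(2)] _ _ that], goal_cases)
    case (1 t)
    then show ?case using e4[of t] by (simp add: algebra_simps)
  qed (simp add: surv_0)
  \<comment> \<open>The source is \<open>k + 2\<close> times the sum of the quantity of
    \<open>e4\<close> and the negated combination from the induction hypothesis.\<close>
  have w: "0 \<le> (2 * surv 2 t (k + 3) - (surv 2 t (k + 4) + surv 2 t (k + 2)))
     - 2 * (surv 2 t (k + 5) - 2 * surv 2 t (k + 4) + surv 2 t (k + 3))" if "t \<ge> 0" for t
  proof (rule nonneg_of_linear_ode[where c = "2 * (real k + 5)",
          OF DERIV_diff[OF DERIV_diff[OF DERIV_cmult[OF d(2)] DERIV_add[OF d(3) d(1)]]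
            DERIV_cmult[OF DERIV_add[OF DERIV_diff[OF d(4) DERIV_cmult[OF d(3)]] d(2)]]] _ _ that])
    fix t :: real assume t: "t \<ge> 0"
    let ?s = "surv 2 t"
    have "(real k + 2) * (2 * (?s (k + 3) - 2 * ?s (k + 2) + ?s (k + 1))
      + (?s (k + 2) - 2 * ?s (k + 1) + ?s k)) \<le> 0"
      using IH[OF t] by (intro mult_nonneg_nonpos) auto
    moreover have "(real k + 2) * (2 * ?s (k + 3) - (?s (k + 4) + ?s (k + 2))) \<ge> 0"
      using e4[OF t] by simp
    ultimately show "2 * (2 * (real k + 3) * (?s (k + 2) - ?s (k + 3))) -
      ((real k + 4) * (?s (k + 2) - ?s (k + 4)) + (real k + 2) * (?s k - ?s (k + 2))) -
      2 * (2 * (real k + 5) * (?s (k + 4) - ?s (k + 5)) - 2 * ((real k + 4) * (?s (k + 2) - ?s (k + 4)))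
        + 2 * (real k + 3) * (?s (k + 2) - ?s (k + 3))) +
      2 * (real k + 5) * (2 * ?s (k + 3) - (?s (k + 4) + ?s (k + 2)) -
         2 * (?s (k + 5) - 2 * ?s (k + 4) + ?s (k + 3))) \<ge> 0"
      by (simp add: algebra_simps)
  qed (auto simp: surv_0)
  show ?case using e4[OF Suc.prems] e5[OF Suc.prems] w[OF Suc.prems]
    by (simp add: k_def numeral_eq_Suc)
qed

text \<open>In terms of matches: at a paired level half of a double match is worth at least a single
  match. \<open>surv_convex\<close> gives the reverse at the unpaired levels from 2 on, and both
  together decide the maximum in \<open>death_surv_eq\<close>.\<close>

lemma surv_concave:
  assumes "n \<ge> 2" "t \<ge> 0" "paired n (m + 2)"
  shows "surv n t (m + 2) + surv n t m \<le> 2 * surv n t (m + 1)"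
proof -
  consider "n = 2" | "n = 3" | "n \<ge> 4" using assms(1) by linarith
  then show ?thesis
  proof cases
    case 1
    then obtain j where "m = 2 * j" using assms(3) by (auto simp: paired_2 elim: evenE)
    with 1 show ?thesis using surv_two[OF assms(2), of j] by simp
  next
    case 2
    then have "m = 0 \<or> (\<exists>j. m = j + 2)"
      using assms(3) unfolding \<open>n = 3\<close> paired_3 by presburger
    then show ?thesis
    proof
      assume "m = 0"
      then show ?thesis using surv_concave_2[OF assms(1,2)] by (simp add: surv_no_unmatched numeral_2_eq_2)
    next
      assume "\<exists>j. m = j + 2"
      then obtain j where "m = j + 2" ..
      with 2 show ?thesis using surv_concave_3[OF assms(2), of j] by (simp add: numeral_eq_Suc)
    qed
  next
    case 3
    then show ?thesis by (rule surv_concave_ge_4) (rule assms)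
  qed
qed

lemma surv_convex:
  assumes "n \<ge> 2" "t \<ge> 0" "\<not> paired n (m + 2)"
  shows "2 * surv n t (m + 1) \<le> surv n t (m + 2) + surv n t m"
proof -
  consider "n = 2" | "n = 3" | "n \<ge> 4" using assms(1) by linarith
  then show ?thesis
  proof cases
    case 1
    then obtain j where "m = 2 * j + 1" using assms(3) by (auto simp: paired_2 elim: oddE)
    with 1 show ?thesis using surv_two[OF assms(2), of j] by (simp add: numeral_eq_Suc)
  next
    case 2
    then have "odd m" "m < 2" using assms(3) by (auto simp: paired_3)
    then have "m = 1" by presburger
    with 2 show ?thesis using surv_three(1)[OF assms(2)] by (simp add: numeral_eq_Suc)
  next
    case 3
    then show ?thesis using assms(3) paired_ge_4[of n "m + 2"] by simp
  qed
qed

lemma surv_mono: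
  assumes "n \<ge> 2" "t \<ge> 0" "M \<le> N"
  shows "surv n t M \<le> surv n t N"
  using surv_step[OF assms(1,2)] by (intro lift_Suc_mono_le[OF _ assms(3)]) simp

lemma surv_nonneg: "n \<ge> 2 \<Longrightarrow> t \<ge> 0 \<Longrightarrow> surv n t N \<ge> 0"
  using surv_mono[of n t 0 N] by (simp add: surv_no_unmatched)

lemma surv_le_1:
  assumes n: "n \<ge> 2" and t: "t \<ge> 0"
  shows "surv n t N \<le> 1"
proof -
  have "surv n t N \<le> surv n 0 N"
  proof (rule DERIV_nonpos_imp_nonincreasing[OF t])
    fix s :: real assume s: "0 \<le> s"
    have "surv n s (N - 2) \<le> surv n s N" "surv n s (N - 1) \<le> surv n s N"
      using n s by (auto intro!: surv_mono)
    then have "death n (surv n s) N \<le> 0"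
      using n by (auto simp: death_def intro!: add_nonpos_nonpos mult_nonneg_nonpos)
    then show "\<exists>y. ((\<lambda>s. surv n s N) has_real_derivative y) (at s) \<and> y \<le> 0"
      using surv_has_derivative[OF n] by blast
  qed
  also have "\<dots> \<le> 1" by (simp add: surv_0)
  finally show ?thesis .
qed

subsection \<open>Rates of the random walk and of the specific coupling\<close>

text \<open>Each coordinate is resampled from all \<open>n\<close> values, as in
  \<open>q_hat\<close>. The choice \<open>k = a i\<close> only adds to the diagonal, which
  \<open>generator\<close> discards.\<close>

definition walk_rate :: "('d::finite \<Rightarrow> 'n::finite) \<Rightarrow> ('d \<Rightarrow> 'n) \<Rightarrow> real" where
  "walk_rate a a' = (\<Sum>i\<in>UNIV. \<Sum>k\<in>UNIV. if a' = a(i := k) then 1 / (real CARD('n) - 1) else 0)"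

lemma generator_apply:
  "(\<Sum>c\<in>UNIV. generator q a c * f c) = (\<Sum>c\<in>UNIV. q a c * (f c - f a))"
proof -
  have "(\<Sum>c\<in>UNIV. generator q a c * f c)
      = generator q a a * f a + (\<Sum>c\<in>UNIV - {a}. generator q a c * f c)"
    by (rule sum.remove) auto
  also have "(\<Sum>c\<in>UNIV - {a}. generator q a c * f c) = (\<Sum>c\<in>UNIV - {a}. q a c * f c)"
    by (intro sum.cong) (auto simp: generator_def)
  also have "generator q a a * f a + \<dots> = (\<Sum>c\<in>UNIV - {a}. q a c * (f c - f a))"
    by (simp add: generator_def sum_distrib_right right_diff_distrib sum_subtractf)
  also have "\<dots> = (\<Sum>c\<in>UNIV. q a c * (f c - f a))"
    by (subst (2) sum.remove[of _ a]) auto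
  finally show ?thesis .
qed

lemma walk_rate_apply:
  fixes a :: "'d::finite \<Rightarrow> 'n::finite"
  shows "(\<Sum>c\<in>UNIV. walk_rate a c * f c) = (\<Sum>i\<in>UNIV. \<Sum>k\<in>UNIV. f (a(i := k)) / (real CARD('n) - 1))"
proof -
  have "(\<Sum>c\<in>UNIV. walk_rate a c * f c)
     = (\<Sum>c\<in>UNIV. \<Sum>i\<in>UNIV. \<Sum>k\<in>UNIV. if c = a(i := k) then f c / (real CARD('n) - 1) else 0)"
    unfolding walk_rate_def sum_distrib_right by (intro sum.cong refl) auto
  also have "\<dots> = (\<Sum>i\<in>UNIV. \<Sum>k\<in>UNIV. \<Sum>c\<in>UNIV. if c = a(i := k) then f c / (real CARD('n) - 1) else 0)"
    by (subst sum.swap) (intro sum.cong refl sum.swap)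
  finally show ?thesis by simp
qed

lemma hat_rate_apply:
  fixes a b :: "'d::finite \<Rightarrow> 'n::finite"
  shows "(\<Sum>z\<in>UNIV. hat_rate (a, b) z * f z) =
    (\<Sum>(i, k)\<in>UNIV. (\<Sum>(j, l)\<in>UNIV. q_hat a b (i, k) (j, l) * f (a(i := k), b(j := l)))) / (real CARD('n) - 1)"
proof -
  let ?m = "real CARD('n) - 1"
  have "(\<Sum>z\<in>UNIV. hat_rate (a, b) z * f z)
     = (\<Sum>z\<in>UNIV. \<Sum>p\<in>UNIV. \<Sum>r\<in>UNIV.
          if z = (a(fst p := snd p), b(fst r := snd r)) then q_hat a b p r * f z / ?m else 0)"
    unfolding hat_rate_def case_prod_unfold sum_distrib_right
    by (intro sum.cong refl) (auto simp: prod_eq_iff)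
  also have "\<dots> = (\<Sum>p\<in>UNIV. \<Sum>r\<in>UNIV. \<Sum>z\<in>UNIV.
          if z = (a(fst p := snd p), b(fst r := snd r)) then q_hat a b p r * f z / ?m else 0)"
    by (subst sum.swap) (intro sum.cong refl sum.swap)
  finally show ?thesis
    by (simp add: case_prod_unfold sum_divide_distrib)
qed

lemma sum_UNIV_prod:
  "(\<Sum>(i, k)\<in>UNIV. g i k) = (\<Sum>i\<in>UNIV. \<Sum>k\<in>UNIV. g (i::'a::finite) (k::'b::finite))"
  by (simp add: sum.cartesian_product UNIV_Times_UNIV[symmetric] del: UNIV_Times_UNIV)

lemma pairing_regime_iff:
  fixes a b :: "'d::finite \<Rightarrow> 'n::finite"
  shows "pairing_regime a b \<longleftrightarrow> paired CARD('n) (card (unmatched a b))"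
  by (simp add: pairing_regime_def paired_def Let_def)

lemma paired_ge_2:
  assumes "n \<ge> 2" "paired n N" "N \<noteq> 0"
  shows "N \<ge> 2"
  using assms not_paired_1[of n] by (cases "N = 1") auto

lemma unmatched_commute: "unmatched a b = unmatched b a"
  by (auto simp: unmatched_def)

text \<open>Exchanging the two walks transposes the matrix. This reduces column sums, which govern
  the second walk, to row sums.\<close>

lemma q_hat_swap: "q_hat a b p r = q_hat b a r p"
proof -
  have "pairing_regime a b = pairing_regime b a"
    by (simp add: pairing_regime_def unmatched_commute)
  then show ?thesis
    by (cases p; cases r) (auto simp: q_hat_def unmatched_commute[of b a])
qed

text \<open>The test function \<open>h\<close> serves two purposes: a constant gives stochasticity
  of the matrix, and the change in a function of the number of unmatched coordinates gives the rates
  of the death chain.\<close>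

lemma q_hat_row:
  fixes a b :: "'d::finite \<Rightarrow> 'n::finite"
  assumes n: "CARD('n) \<ge> 2"
  shows "(\<Sum>(j, l)\<in>UNIV. q_hat a b (i, k) (j, l) * h j l) =
    (if i \<in> unmatched a b \<and> pairing_regime a b then
       (if k = b i then (\<Sum>j\<in>unmatched a b - {i}. h j (a j)) / (real (card (unmatched a b)) - 1)
        else if k = a i then h i (b i) else h i k)
     else h i k)"
proof (cases "i \<in> unmatched a b \<and> pairing_regime a b")
  case False
  have "(\<Sum>(j, l)\<in>UNIV. q_hat a b (i, k) (j, l) * h j l)
      = (\<Sum>z\<in>UNIV. if z = (i, k) then h i k else 0)"
    using False by (intro sum.cong refl) (auto simp: q_hat_def split: prod.splits if_splits)
  with False show ?thesis by (auto simp: prod.expand)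
next
  case True
  let ?U = "unmatched a b"
  let ?w = "1 / (real (card ?U) - 1)"
  consider "k = b i" | "k = a i" "k \<noteq> b i" | "k \<noteq> a i" "k \<noteq> b i" by blast
  then show ?thesis
  proof cases
    case 1
    have "(\<Sum>(j, l)\<in>UNIV. q_hat a b (i, k) (j, l) * h j l)
        = (\<Sum>j\<in>UNIV. \<Sum>l\<in>UNIV. q_hat a b (i, k) (j, l) * h j l)"
      by (rule sum_UNIV_prod)
    also have "\<dots> = (\<Sum>j\<in>UNIV. \<Sum>l\<in>UNIV. if l = a j then (if j \<in> ?U - {i} then ?w * h j l else 0) else 0)"
      using True 1 by (intro sum.cong refl) (auto simp: q_hat_def unmatched_def)
    also have "\<dots> = (\<Sum>j\<in>UNIV. if j \<in> ?U - {i} then ?w * h j (a j) else 0)"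
      by simp
    also have "\<dots> = (\<Sum>j\<in>?U - {i}. ?w * h j (a j))"
      by (subst sum.inter_restrict[symmetric]) simp_all
    finally show ?thesis using True 1 by (simp add: sum_divide_distrib)
  next
    case 2
    have "(\<Sum>(j, l)\<in>UNIV. q_hat a b (i, k) (j, l) * h j l)
        = (\<Sum>z\<in>UNIV. if z = (i, b i) then h i (b i) else 0)"
      using True 2 by (intro sum.cong refl) (auto simp: q_hat_def split: prod.splits if_splits)
    with True 2 show ?thesis by simp
  next
    case 3
    have "(\<Sum>(j, l)\<in>UNIV. q_hat a b (i, k) (j, l) * h j l)
        = (\<Sum>z\<in>UNIV. if z = (i, k) then h i k else 0)"
      using True 3 by (intro sum.cong refl) (auto simp: q_hat_def split: prod.splits if_splits)
    with True 3 show ?thesis by simp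
  qed
qed

text \<open>Level 1 is never in the pairing regime, so the weight \<open>1 / (N - 1)\<close> is
  meaningful and positive wherever it occurs.\<close>

lemma card_unmatched_ge_2:
  fixes a b :: "'d::finite \<Rightarrow> 'n::finite"
  assumes n: "CARD('n) \<ge> 2" and "i \<in> unmatched a b" "pairing_regime a b"
  shows "card (unmatched a b) \<ge> 2"
  using assms by (intro paired_ge_2[OF n]) (auto simp: pairing_regime_iff)

lemma q_hat_row_sum:
  fixes a b :: "'d::finite \<Rightarrow> 'n::finite"
  assumes n: "CARD('n) \<ge> 2"
  shows "(\<Sum>(j, l)\<in>UNIV. q_hat a b (i, k) (j, l)) = 1"
  using q_hat_row[OF n, of a b i k "\<lambda>_ _. 1"] card_unmatched_ge_2[OF n, of i a b]
  by (auto split: if_splits)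

text \<open>A move of the first walk is a row index and every row sums to 1, so the first walk sets
  coordinate \<open>i\<close> to \<open>k\<close> at rate \<open>1 / (n - 1)\<close> regardless of
  the second.\<close>

lemma hat_rate_fst:
  fixes a b :: "'d::finite \<Rightarrow> 'n::finite"
  assumes n: "CARD('n) \<ge> 2"
  shows "(\<Sum>z\<in>UNIV. generator hat_rate (a, b) z * f (fst z)) = (\<Sum>c\<in>UNIV. generator walk_rate a c * f c)"
proof -
  have "(\<Sum>(j, l)\<in>UNIV. q_hat a b (i, k) (j, l) * (f (a(i := k)) - f a)) = f (a(i := k)) - f a" for i k
    using q_hat_row_sum[OF n, of a b i k] by (simp add: case_prod_unfold flip: sum_distrib_right)
  then show ?thesis
    unfolding generator_apply walk_rate_apply hat_rate_apply
    by (simp add: sum_divide_distrib sum.cartesian_product case_prod_unfold)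
qed

lemma hat_rate_snd:
  fixes a b :: "'d::finite \<Rightarrow> 'n::finite"
  assumes n: "CARD('n) \<ge> 2"
  shows "(\<Sum>z\<in>UNIV. generator hat_rate (a, b) z * f (snd z)) = (\<Sum>c\<in>UNIV. generator walk_rate b c * f c)"
proof -
  have "(\<Sum>p\<in>UNIV. q_hat a b p r * (f (b(fst r := snd r)) - f b)) = f (b(fst r := snd r)) - f b" for r
    using q_hat_row_sum[OF n, of b a "fst r" "snd r"]
    by (simp add: case_prod_unfold q_hat_swap[of a b] flip: sum_distrib_right)
  then have "(\<Sum>p\<in>UNIV. \<Sum>r\<in>UNIV. q_hat a b p r * (f (b(fst r := snd r)) - f b))
      = (\<Sum>r\<in>UNIV. f (b(fst r := snd r)) - f b)"
    by (subst sum.swap) simp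
  then show ?thesis
    unfolding generator_apply walk_rate_apply hat_rate_apply
    by (simp add: sum_divide_distrib sum.cartesian_product case_prod_unfold)
qed

lemma sum_const_except_two:
  fixes u v :: real
  assumes "r \<noteq> s"
  shows "(\<Sum>k\<in>UNIV. if k = (s::'n::finite) then u else if k = r then 0 else v) = u + (real CARD('n) - 2) * v"
proof -
  have "(\<Sum>k\<in>UNIV. if k = s then u else if k = r then 0 else v)
      = u + (\<Sum>k\<in>UNIV - {s}. if k = r then 0 else v)"
    by (subst sum.remove[of _ s]) (auto intro!: sum.cong)
  also have "(\<Sum>k\<in>UNIV - {s}. if k = r then 0 else v) = (\<Sum>k\<in>UNIV - {s} - {r}. v)"
    using assms by (subst sum.remove[of _ r]) (auto intro!: sum.cong)
  also have "\<dots> = (real CARD('n) - 2) * v"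
  proof -
    have "card {r, s} \<le> CARD('n)" by (rule card_mono) auto
    then have "CARD('n) \<ge> 2" using assms by simp
    then show ?thesis using assms by (simp add: card_Diff_singleton)
  qed
  finally show ?thesis .
qed

text \<open>For an unmatched \<open>i\<close> in the pairing regime, \<open>k = b i\<close> matches
  \<open>i\<close> and a partner whichever partner is drawn, \<open>k = a i\<close> changes nothing,
  and each of the \<open>n - 2\<close> other values matches \<open>i\<close> alone. Outside that
  regime all \<open>n\<close> values match \<open>i\<close> alone.\<close>

lemma hat_rate_count:
  fixes a b :: "'d::finite \<Rightarrow> 'n::finite" and F :: "nat \<Rightarrow> real"
  assumes n: "CARD('n) \<ge> 2"
  defines "N \<equiv> \<lambda>z::('d \<Rightarrow> 'n) \<times> ('d \<Rightarrow> 'n). card (unmatched (fst z) (snd z))"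
  shows "(\<Sum>z\<in>UNIV. generator hat_rate (a, b) z * F (N z)) = death CARD('n) F (N (a, b)) / (real CARD('n) - 1)"
proof -
  let ?U = "unmatched a b" and ?N = "N (a, b)"
  have N: "?N = card ?U" by (simp add: N_def)
  define h where "h i k j l = F (N (a(i := k), b(j := l))) - F ?N" for i k j l
  define w where "w i = (\<Sum>k\<in>UNIV. \<Sum>(j, l)\<in>UNIV. q_hat a b (i, k) (j, l) * h i k j l)" for i
  have same: "h i k i k = F (?N - 1) - F ?N" if "i \<in> ?U" for i k
  proof -
    have "unmatched (a(i := k)) (b(i := k)) = ?U - {i}" by (auto simp: unmatched_def)
    then show ?thesis using that by (simp add: h_def N N_def)
  qed
  have same': "h i k i k = 0" if "i \<notin> ?U" for i k
  proof -
    have "unmatched (a(i := k)) (b(i := k)) = ?U" using that by (auto simp: unmatched_def)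
    then show ?thesis by (simp add: h_def N N_def)
  qed
  have swap: "h i (a i) i (b i) = 0" for i by (simp add: h_def)
  have two: "h i (b i) j (a j) = F (?N - 2) - F ?N" if "i \<in> ?U" "j \<in> ?U - {i}" for i j
  proof -
    have "unmatched (a(i := b i)) (b(j := a j)) = ?U - {i, j}"
      using that by (auto simp: unmatched_def)
    moreover have "card (?U - {i, j}) = ?N - 2"
      using that by (subst card_Diff_subset) (auto simp: N numeral_2_eq_2)
    ultimately show ?thesis by (simp add: h_def N_def)
  qed
  have w: "w i = (if i \<in> ?U then
       (if pairing_regime a b then F (?N - 2) - F ?N + (real CARD('n) - 2) * (F (?N - 1) - F ?N)
        else real CARD('n) * (F (?N - 1) - F ?N)) else 0)" for i
  proof (cases "i \<in> ?U \<and> pairing_regime a b")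
    case True
    then have iU: "i \<in> ?U" and ne: "a i \<noteq> b i" by (auto simp: unmatched_def)
    have N2: "card ?U \<ge> 2" using True card_unmatched_ge_2[OF n] by blast
    have "(\<Sum>j\<in>?U - {i}. h i (b i) j (a j)) / (real (card ?U) - 1) = F (?N - 2) - F ?N"
      using two[OF iU] N2 iU by simp
    then have "w i = (\<Sum>k\<in>UNIV. if k = b i then F (?N - 2) - F ?N else if k = a i then 0
        else F (?N - 1) - F ?N)"
      unfolding w_def q_hat_row[OF n] using True same[OF iU] swap[of i]
      by (intro sum.cong refl) auto
    then show ?thesis using True sum_const_except_two[OF ne] by simp
  next
    case False
    then show ?thesis
      unfolding w_def q_hat_row[OF n] using same[of i] same'[of i] by auto
  qed
  have "(\<Sum>z\<in>UNIV. generator hat_rate (a, b) z * F (N z)) = (\<Sum>i\<in>UNIV. w i) / (real CARD('n) - 1)"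
    unfolding generator_apply hat_rate_apply w_def h_def
    by (simp only: sum_UNIV_prod prod.case)
  also have "(\<Sum>i\<in>UNIV. w i) = death CARD('n) F ?N"
    unfolding w
    by (subst sum.inter_restrict[symmetric])
      (auto simp: death_def pairing_regime_iff N algebra_simps)
  finally show ?thesis .
qed

text \<open>By \<open>hat_rate_count\<close> the left-hand side solves the backward equation of the
  specific coupling in \<open>t\<close>. The case \<open>s = 0\<close> identifies
  \<open>surv\<close> with its probability of disagreement; general \<open>s\<close> describes one
  step taken before a remaining time \<open>s\<close>.\<close>

lemma hat_transition_surv:
  fixes z :: "('d::finite \<Rightarrow> 'n::finite) \<times> ('d \<Rightarrow> 'n)"
  assumes n: "CARD('n) \<ge> 2"
  defines "N \<equiv> \<lambda>z::('d \<Rightarrow> 'n) \<times> ('d \<Rightarrow> 'n). card (unmatched (fst z) (snd z))"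
    and "m \<equiv> real CARD('n) - 1"
  shows "surv CARD('n) ((s + t) / m) (N z)
      = (\<Sum>z'\<in>UNIV. transition hat_rate t z z' * surv CARD('n) (s / m) (N z'))"
proof -
  have "((\<lambda>t. surv CARD('n) ((s + t) / m) (N z)) has_real_derivative
       (\<Sum>c\<in>UNIV. generator hat_rate z c * surv CARD('n) ((s + t) / m) (N c))) (at t)" for t z
  proof -
    have "((\<lambda>t. surv CARD('n) ((s + t) / m) (N z)) has_real_derivative
       death CARD('n) (surv CARD('n) ((s + t) / m)) (N z) * (1 / m)) (at t)"
      by (rule DERIV_chain2[where f = "\<lambda>r. surv CARD('n) r (N z)", OF surv_has_derivative[OF n]])
        (use n in \<open>auto intro!: derivative_eq_intros simp: m_def\<close>)
    then show ?thesis
      using hat_rate_count[OF n, of "fst z" "snd z" "surv CARD('n) ((s + t) / m)"]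
      by (simp add: N_def m_def)
  qed
  from mexp_unique[of "\<lambda>t z. surv CARD('n) ((s + t) / m) (N z)" "generator hat_rate", OF this, of t z]
  show ?thesis by (simp add: transition_eq_mexp)
qed

subsection \<open>One step of an arbitrary coupling\<close>

text \<open>
  Weak duality for the transport problem of one infinitesimal step: the cost functions
  \<open>step_cost\<close> of the two marginal moves dominate the decrease of the value function, and they are
  tight for the specific coupling.
\<close>

definition step_cost ::
  "(nat \<Rightarrow> real) \<Rightarrow> ('d::finite \<Rightarrow> 'n) \<Rightarrow> ('d \<Rightarrow> 'n) \<Rightarrow> ('d \<Rightarrow> 'n) \<Rightarrow> real" where
  "step_cost S a b a' =
     (let N = card (unmatched a b) in
       (if card {i. a' i \<noteq> a i} \<ge> 2 then 1 else 0) +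
       (\<Sum>i\<in>unmatched a b. if a' i = a i then 0
          else if a' i = b i then max (S N - S (N - 1)) ((S N - S (N - 2)) / 2)
          else (S N - S (N - 1)) / 2))"

lemma step_cost_bounds:
  assumes "mono S" "\<And>N. 0 \<le> S N" "\<And>N. S N \<le> 1"
  shows "0 \<le> step_cost S a b a'" "step_cost S a b (a' :: 'd::finite \<Rightarrow> 'n) \<le> 1 + real CARD('d)"
proof -
  let ?N = "card (unmatched a b)"
  have D: "S (?N - 1) \<le> S ?N" "S (?N - 2) \<le> S ?N" using \<open>mono S\<close> by (auto intro: monoD)
  then show "0 \<le> step_cost S a b a'"
    unfolding step_cost_def Let_def by (intro add_nonneg_nonneg sum_nonneg) auto
  have "S ?N - S (?N - 1) \<le> 1" "S ?N - S (?N - 2) \<le> 1"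
    using assms(2,3) by (smt (verit))+
  then have "(\<Sum>i\<in>unmatched a b. if a' i = a i then 0
          else if a' i = b i then max (S ?N - S (?N - 1)) ((S ?N - S (?N - 2)) / 2)
          else (S ?N - S (?N - 1)) / 2) \<le> (\<Sum>i\<in>unmatched a b. 1)"
    by (intro sum_mono) auto
  also have "\<dots> \<le> real CARD('d)" by (simp add: card_mono)
  finally show "step_cost S a b a' \<le> 1 + real CARD('d)"
    unfolding step_cost_def Let_def by auto
qed

text \<open>If some walk changes two coordinates, its unit penalty covers any decrease, as
  \<open>S\<close> has values between 0 and 1. Otherwise there are at most two jumps in all, and
  each newly matched coordinate, collected in \<open>R\<close>, can be charged separately.\<close>

lemma step_cost_dominates:
  fixes a b a' b' :: "'d::finite \<Rightarrow> 'n"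
  assumes S: "mono S" "\<And>N. 0 \<le> S N" "\<And>N. S N \<le> 1"
  shows "S (card (unmatched a b)) - S (card (unmatched a' b')) \<le> step_cost S a b a' + step_cost S b a b'"
proof -
  let ?U = "unmatched a b" and ?A = "{i. a' i \<noteq> a i}" and ?B = "{i. b' i \<noteq> b i}"
  let ?N = "card ?U"
  define R where "R = ?U - unmatched a' b'"
  show ?thesis
  proof (cases "card ?A \<ge> 2 \<or> card ?B \<ge> 2")
    case True
    have "S ?N - S (card (unmatched a' b')) \<le> 1" using S(2,3) by (smt (verit))
    moreover have D: "S (?N - 1) \<le> S ?N" "S (?N - 2) \<le> S ?N" using S(1) by (auto intro: monoD)
    then have "card ?A \<ge> 2 \<Longrightarrow> 1 \<le> step_cost S a b a'"
      unfolding step_cost_def Let_def by (auto intro!: sum_nonneg)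
    moreover have "card ?B \<ge> 2 \<Longrightarrow> 1 \<le> step_cost S b a b'"
      unfolding step_cost_def Let_def unmatched_commute[of b a] using D by (auto intro!: sum_nonneg)
    ultimately show ?thesis
      using True step_cost_bounds(1)[OF S, of a b a'] step_cost_bounds(1)[OF S, of b a b'] by linarith
  next
    case False
    define D1 where "D1 = S ?N - S (?N - 1)"
    define D2 where "D2 = S ?N - S (?N - 2)"
    define g where "g = max D1 (D2 / 2)"
    have D: "0 \<le> D1" "0 \<le> D2" using S(1) by (auto simp: D1_def D2_def intro: monoD)
    define c where "c i = (if a' i = a i then 0 else if a' i = b i then g else D1 / 2)
        + (if b' i = b i then 0 else if b' i = a i then g else D1 / 2)" for i
    have c0: "c i \<ge> 0" for i using D by (auto simp: c_def g_def)
    have "step_cost S a b a' + step_cost S b a b' = (\<Sum>i\<in>?U. c i)"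
      using False unfolding step_cost_def Let_def unmatched_commute[of b a] c_def g_def D1_def D2_def
      by (simp add: sum.distrib)
    also have "\<dots> \<ge> (\<Sum>i\<in>R. c i)" using c0 by (intro sum_mono2) (auto simp: R_def)
    finally have cost: "(\<Sum>i\<in>R. c i) \<le> step_cost S a b a' + step_cost S b a b'" .
    have R: "a i \<noteq> b i" "a' i = b' i" "i \<in> ?A \<or> i \<in> ?B" if "i \<in> R" for i
      using that by (auto simp: R_def unmatched_def)
    \<comment> \<open>Either exactly one walk moves, to the value of the other, and pays
      \<open>g\<close>; or both move to a common third value and pay \<open>D1 / 2\<close>
      each.\<close>
    have c1: "c i \<ge> D1" if "i \<in> R" for i
      using R[OF that] D by (auto simp: c_def g_def)
    have c2: "c i \<ge> g" if "i \<in> R" "i \<notin> ?A \<or> i \<notin> ?B" for i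
      using R[OF that(1)] that(2) D by (auto simp: c_def)
    have RAB: "R \<subseteq> ?A \<union> ?B" using R(3) by blast
    have card_AB: "card ?A + card ?B \<le> 2" using False by auto
    have "card R \<le> card (?A \<union> ?B)" using RAB by (intro card_mono) auto
    also have "card (?A \<union> ?B) = card ?A + card ?B - card (?A \<inter> ?B)"
      using card_Un_Int[of ?A ?B] by simp
    finally have cR: "card R \<le> card ?A + card ?B - card (?A \<inter> ?B)" .
    have "card ?U \<le> card (unmatched a' b' \<union> R)" by (intro card_mono) (auto simp: R_def)
    also have "\<dots> \<le> card (unmatched a' b') + card R" by (rule card_Un_le)
    finally have "?N - card R \<le> card (unmatched a' b')" by simp
    then have "S (?N - card R) \<le> S (card (unmatched a' b'))" using S(1) by (auto intro: monoD)
    then have *: "S ?N - S (card (unmatched a' b')) \<le> S ?N - S (?N - card R)" by simp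
    consider "card R = 0" | "card R = 1" | "card R = 2" using cR card_AB by linarith
    then have "S ?N - S (?N - card R) \<le> (\<Sum>i\<in>R. c i)"
    proof cases
      case 1
      then show ?thesis using c0 by (simp add: sum_nonneg)
    next
      case 2
      then obtain r where "R = {r}" by (auto simp: card_1_singleton_iff)
      with 2 c1[of r] show ?thesis by (simp add: D1_def)
    next
      case 3
      \<comment> \<open>Two new matches from at most two jumps: no coordinate moved in both walks,
        so each match pays the full \<open>g\<close>, and \<open>2 * g\<close> covers
        \<open>D2\<close>.\<close>
      then have "card (?A \<inter> ?B) = 0" using cR card_AB by linarith
      then have "?A \<inter> ?B = {}" by simp
      then have "(\<Sum>i\<in>R. g) \<le> (\<Sum>i\<in>R. c i)" by (intro sum_mono c2) auto
      moreover have "(\<Sum>i\<in>R. g) = 2 * g" using 3 by simp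
      moreover have "D2 / 2 \<le> g" by (simp add: g_def)
      ultimately show ?thesis using 3 by (simp add: D2_def)
    qed
    with * cost show ?thesis by linarith
  qed
qed

text \<open>The walk moves one coordinate at a time, so the penalty for two changes has rate 0. An
  unmatched coordinate has one jump to the value of the other walk and \<open>n - 2\<close> jumps to
  third values.\<close>

lemma step_cost_rate:
  fixes a b :: "'d::finite \<Rightarrow> 'n::finite"
  defines "N \<equiv> card (unmatched a b)"
  shows "(\<Sum>c\<in>UNIV. generator walk_rate a c * step_cost S a b c) =
    real N * (max (S N - S (N - 1)) ((S N - S (N - 2)) / 2) + (real CARD('n) - 2) * ((S N - S (N - 1)) / 2))
      / (real CARD('n) - 1)"
proof -
  let ?U = "unmatched a b"
  let ?g = "max (S N - S (N - 1)) ((S N - S (N - 2)) / 2)" and ?v = "(S N - S (N - 1)) / 2"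
  define c where "c i k = (if k = b i then ?g else if k = a i then 0 else ?v)" for i k
  have z: "step_cost S a b a = 0" by (simp add: step_cost_def)
  have one: "step_cost S a b (a(i := k)) = (if i \<in> ?U then c i k else 0)" for i k
  proof -
    have "card {j. (a(i := k)) j \<noteq> a j} \<le> card {i}" by (intro card_mono) auto
    then have "\<not> card {j. (a(i := k)) j \<noteq> a j} \<ge> 2" by simp
    then have "step_cost S a b (a(i := k)) = (\<Sum>j\<in>?U. if (a(i := k)) j = a j then 0
          else if (a(i := k)) j = b j then ?g else ?v)"
      by (simp only: step_cost_def Let_def N_def) simp
    also have "\<dots> = (\<Sum>j\<in>?U. if j = i then c i k else 0)"
      by (intro sum.cong refl) (auto simp: c_def unmatched_def)
    finally show ?thesis by simp
  qed
  have "(\<Sum>c\<in>UNIV. generator walk_rate a c * step_cost S a b c)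
      = (\<Sum>i\<in>UNIV. \<Sum>k\<in>UNIV. step_cost S a b (a(i := k)) / (real CARD('n) - 1))"
    unfolding generator_apply z by (simp add: walk_rate_apply)
  also have "\<dots> = (\<Sum>i\<in>UNIV. if i \<in> ?U then (\<Sum>k\<in>UNIV. c i k) else 0) / (real CARD('n) - 1)"
    unfolding one sum_divide_distrib by (intro sum.cong) (auto simp: sum_divide_distrib)
  also have "\<dots> = (\<Sum>i\<in>?U. \<Sum>k\<in>UNIV. c i k) / (real CARD('n) - 1)"
    by (subst sum.inter_restrict[symmetric]) simp_all
  also have "(\<Sum>i\<in>?U. \<Sum>k\<in>UNIV. c i k) = (\<Sum>i\<in>?U. ?g + (real CARD('n) - 2) * ?v)"
    unfolding c_def by (intro sum.cong refl sum_const_except_two) (auto simp: unmatched_def)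
  finally show ?thesis by (simp add: N_def)
qed

text \<open>Tightness of the dual bound: the factor 2 accounts for the two walks, and the sign of
  the second difference selects the branch of the maximum that fits the regime. At level 1 the
  truncated \<open>N - 2\<close> is 0, and the single match wins.\<close>

lemma death_surv_eq:
  assumes n: "n \<ge> 2" and t: "t \<ge> 0"
  defines "S \<equiv> surv n t"
  shows "- death n S N = 2 * (real N *
     (max (S N - S (N - 1)) ((S N - S (N - 2)) / 2) + (real n - 2) * ((S N - S (N - 1)) / 2)))"
proof -
  consider "N = 0" | "N = 1" | m where "N = m + 2" by (metis One_nat_def add_2_eq_Suc' not0_implies_Suc)
  then show ?thesis
  proof cases
    case 1
    then show ?thesis by (simp add: death_def)
  next
    case 2
    have "0 \<le> S 1" "S 0 = 0" using surv_nonneg[OF n t] by (auto simp: S_def surv_no_unmatched)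
    then have "max (S 1 - S 0) ((S 1 - S 0) / 2) = S 1" by simp
    with 2 \<open>S 0 = 0\<close> show ?thesis using not_paired_1[OF n] by (simp add: death_def field_simps)
  next
    case 3
    show ?thesis
    proof (cases "paired n N")
      case True
      then have "S (m + 2) + S m \<le> 2 * S (m + 1)"
        using surv_concave[OF n t] 3 by (simp add: S_def)
      then have "max (S N - S (N - 1)) ((S N - S (N - 2)) / 2) = (S N - S (N - 2)) / 2" (is "?M = _")
        using 3 by (simp add: max_def)
      then show ?thesis unfolding \<open>?M = _\<close> using True by (simp add: death_def field_simps)
    next
      case False
      then have "2 * S (m + 1) \<le> S (m + 2) + S m"
        using surv_convex[OF n t] 3 by (simp add: S_def)
      then have "max (S N - S (N - 1)) ((S N - S (N - 2)) / 2) = S N - S (N - 1)" (is "?M = _")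
        using 3 by (simp add: max_def)
      then show ?thesis unfolding \<open>?M = _\<close> using False by (simp add: death_def field_simps)
    qed
  qed
qed

lemma mexp_first_order_le:
  fixes G :: "'s::finite \<Rightarrow> 's \<Rightarrow> real"
  assumes bounds: "\<And>c. \<bar>mexp G h a c - (if a = c then 1 else 0) - h * G a c\<bar> \<le> C * h\<^sup>2"
    "\<And>c. 0 \<le> f c" "\<And>c. f c \<le> K" "C \<ge> 0"
  shows "(\<Sum>c\<in>UNIV. mexp G h a c * f c) \<le> f a + h * (\<Sum>c\<in>UNIV. G a c * f c) + real CARD('s) * (C * K) * h\<^sup>2"
proof -
  have "(\<Sum>c\<in>UNIV. mexp G h a c * f c)
      \<le> (\<Sum>c\<in>UNIV. (if c = a then f c else 0) + h * (G a c * f c) + C * K * h\<^sup>2)"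
  proof (rule sum_mono)
    fix c
    have "(mexp G h a c - (if a = c then 1 else 0) - h * G a c) * f c \<le> C * h\<^sup>2 * f c"
      using bounds(1)[of c] bounds(2)[of c] by (intro mult_right_mono) auto
    also have "\<dots> \<le> C * h\<^sup>2 * K" using bounds(3)[of c] bounds(4) by (intro mult_left_mono) auto
    finally show "mexp G h a c * f c \<le> (if c = a then f c else 0) + h * (G a c * f c) + C * K * h\<^sup>2"
      by (auto simp: algebra_simps split: if_splits)
  qed
  also have "\<dots> = f a + h * (\<Sum>c\<in>UNIV. G a c * f c) + real CARD('s) * (C * K) * h\<^sup>2"
    by (simp add: sum.distrib sum_distrib_left)
  finally show ?thesis .
qed

text \<open>The expected decrease under \<open>\<pi>\<close> is at most the sum of two expected
  costs, whose first-order part equals that of the decrease under the specific coupling by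
  \<open>death_surv_eq\<close>; only second-order errors remain. \<open>C\<close> is built from the
  two generators and the bounds on \<open>step_cost\<close> and \<open>S\<close>, so it does not
  depend on \<open>s\<close>, \<open>a\<close>, \<open>b\<close> or \<open>\<pi>\<close>.\<close>

lemma coupling_step:
  assumes n: "CARD('n::finite) \<ge> 2"
  defines "N \<equiv> \<lambda>z::('d::finite \<Rightarrow> 'n) \<times> ('d \<Rightarrow> 'n). card (unmatched (fst z) (snd z))"
    and "m \<equiv> real CARD('n) - 1"
  obtains C where "C \<ge> 0"
    "\<And>a b h s (\<pi> :: ('d \<Rightarrow> 'n) \<times> ('d \<Rightarrow> 'n) \<Rightarrow> real).
       0 \<le> h \<Longrightarrow> h \<le> 1 \<Longrightarrow> 0 \<le> s \<Longrightarrow> (\<And>z. 0 \<le> \<pi> z) \<Longrightarrow>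
       (\<And>a'. (\<Sum>b'\<in>UNIV. \<pi> (a', b')) = transition walk_rate h a a') \<Longrightarrow>
       (\<And>b'. (\<Sum>a'\<in>UNIV. \<pi> (a', b')) = transition walk_rate h b b') \<Longrightarrow>
       surv CARD('n) ((s + h) / m) (N (a, b)) - C * h\<^sup>2 \<le> (\<Sum>z\<in>UNIV. \<pi> z * surv CARD('n) (s / m) (N z))"
proof -
  let ?Gw = "generator (walk_rate :: ('d \<Rightarrow> 'n) \<Rightarrow> _)" and ?Gh = "generator (hat_rate :: ('d \<Rightarrow> 'n) \<times> _ \<Rightarrow> _)"
  obtain C1 where C1: "C1 \<ge> 0" "\<And>h a b. 0 \<le> h \<Longrightarrow> h \<le> 1 \<Longrightarrow>
      \<bar>mexp ?Gw h a b - (if a = b then 1 else 0) - h * ?Gw a b\<bar> \<le> C1 * h\<^sup>2"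
    by (rule mexp_first_order[of ?Gw]) blast
  obtain C2 where C2: "C2 \<ge> 0" "\<And>h a b. 0 \<le> h \<Longrightarrow> h \<le> 1 \<Longrightarrow>
      \<bar>mexp ?Gh h a b - (if a = b then 1 else 0) - h * ?Gh a b\<bar> \<le> C2 * h\<^sup>2"
    by (rule mexp_first_order[of ?Gh]) blast
  define Ew where "Ew = real CARD('d \<Rightarrow> 'n) * (C1 * (1 + real CARD('d)))"
  define Eh where "Eh = real CARD(('d \<Rightarrow> 'n) \<times> ('d \<Rightarrow> 'n)) * (C2 * 1)"
  define C where "C = Ew + Ew + Eh"
  have "C \<ge> 0" using C1(1) C2(1) by (simp add: C_def Ew_def Eh_def)
  moreover have "surv CARD('n) ((s + h) / m) (N (a, b)) - C * h\<^sup>2 \<le> (\<Sum>z\<in>UNIV. \<pi> z * surv CARD('n) (s / m) (N z))"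
    if h: "0 \<le> h" "h \<le> 1" and s: "0 \<le> s" and \<pi>: "\<And>z. 0 \<le> \<pi> z"
      and \<pi>1: "\<And>a'. (\<Sum>b'\<in>UNIV. \<pi> (a', b')) = transition walk_rate h a a'"
      and \<pi>2: "\<And>b'. (\<Sum>a'\<in>UNIV. \<pi> (a', b')) = transition walk_rate h b b'"
    for a b :: "'d \<Rightarrow> 'n" and h s and \<pi> :: "('d \<Rightarrow> 'n) \<times> ('d \<Rightarrow> 'n) \<Rightarrow> real"
  proof -
    define S where "S = surv CARD('n) (s / m)"
    have m: "m > 0" using n by (simp add: m_def)
    have sm: "s / m \<ge> 0" using s m by simp
    have S: "mono S" "\<And>N. 0 \<le> S N" "\<And>N. S N \<le> 1"
      using surv_mono[OF n sm] surv_nonneg[OF n sm] surv_le_1[OF n sm] by (auto simp: S_def mono_def)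
    have row: "(\<Sum>c\<in>UNIV. ?Gw c' c) = 0" for c'
      using generator_apply[of walk_rate c' "\<lambda>_. 1"] by simp
    have mass: "(\<Sum>z\<in>UNIV. \<pi> z) = 1"
      using sum_UNIV_prod[of "\<lambda>a b. \<pi> (a, b)"] mexp_const[of ?Gw h a] row
      by (simp add: \<pi>1 transition_eq_mexp)
    have fst: "(\<Sum>z\<in>UNIV. \<pi> z * f (fst z)) = (\<Sum>a'\<in>UNIV. mexp ?Gw h a a' * f a')" for f
      using sum_UNIV_prod[of "\<lambda>a b. \<pi> (a, b) * f a"]
      by (simp add: \<pi>1 transition_eq_mexp case_prod_unfold flip: sum_distrib_right)
    have snd: "(\<Sum>z\<in>UNIV. \<pi> z * f (snd z)) = (\<Sum>b'\<in>UNIV. mexp ?Gw h b b' * f b')" for f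
    proof -
      have "(\<Sum>z\<in>UNIV. \<pi> z * f (snd z)) = (\<Sum>a'\<in>UNIV. \<Sum>b'\<in>UNIV. \<pi> (a', b') * f b')"
        using sum_UNIV_prod[of "\<lambda>a b. \<pi> (a, b) * f b"] by (simp add: case_prod_unfold)
      also have "\<dots> = (\<Sum>b'\<in>UNIV. \<Sum>a'\<in>UNIV. \<pi> (a', b') * f b')" by (rule sum.swap)
      finally show ?thesis by (simp add: \<pi>2 transition_eq_mexp flip: sum_distrib_right)
    qed
    let ?X = "\<lambda>N. max (S N - S (N - 1)) ((S N - S (N - 2)) / 2) + (real CARD('n) - 2) * ((S N - S (N - 1)) / 2)"
    have cost: "(\<Sum>c\<in>UNIV. mexp ?Gw h a c * step_cost S a b c)
        \<le> h * (real (N (a, b)) * ?X (N (a, b)) / m) + Ew * h\<^sup>2" for a b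
    proof -
      have "step_cost S a b a = 0" by (simp add: step_cost_def)
      moreover have "0 \<le> step_cost S a b c" "step_cost S a b c \<le> 1 + real CARD('d)" for c
        using step_cost_bounds[OF S] by auto
      ultimately show ?thesis
        using mexp_first_order_le[where G = ?Gw and h = h and a = a and C = C1 and f = "step_cost S a b" and K = "1 + real CARD('d)"] C1 h
          step_cost_rate[where a = a and b = b and S = S]
        by (simp add: Ew_def N_def m_def)
    qed
    have Nba: "N (b, a) = N (a, b)" by (simp add: N_def unmatched_commute)
    have "S (N (a, b)) - (\<Sum>z\<in>UNIV. \<pi> z * S (N z)) = (\<Sum>z\<in>UNIV. \<pi> z * (S (N (a, b)) - S (N z)))"
      by (simp add: right_diff_distrib sum_subtractf mass flip: sum_distrib_right)
    also have "\<dots> \<le> (\<Sum>z\<in>UNIV. \<pi> z * (step_cost S a b (fst z) + step_cost S b a (snd z)))"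
      unfolding N_def fst_conv snd_conv
      by (intro sum_mono mult_left_mono step_cost_dominates \<pi> S)
    also have "\<dots> = (\<Sum>c\<in>UNIV. mexp ?Gw h a c * step_cost S a b c) + (\<Sum>c\<in>UNIV. mexp ?Gw h b c * step_cost S b a c)"
      by (simp add: distrib_left sum.distrib fst snd)
    also have "\<dots> \<le> h * (2 * (real (N (a, b)) * ?X (N (a, b)))) / m + (Ew + Ew) * h\<^sup>2"
    proof -
      have "h * (y / m) + h * (y / m) = h * (2 * y) / m" for y by (simp add: field_simps)
      from this[of "real (N (a, b)) * ?X (N (a, b))"] show ?thesis
        using add_mono[OF cost[of a b] cost[of b a]] unfolding Nba distrib_right by linarith
    qed
    also have "2 * (real (N (a, b)) * ?X (N (a, b))) = - death CARD('n) S (N (a, b))"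
      unfolding S_def by (rule death_surv_eq[OF n sm, symmetric])
    finally have 1: "S (N (a, b)) - (\<Sum>z\<in>UNIV. \<pi> z * S (N z))
        \<le> - (h * (death CARD('n) S (N (a, b)) / m)) + (Ew + Ew) * h\<^sup>2" by simp
    have "surv CARD('n) ((s + h) / m) (N (a, b)) = (\<Sum>z\<in>UNIV. mexp ?Gh h (a, b) z * S (N z))"
      unfolding S_def m_def N_def hat_transition_surv[OF n] by (simp add: transition_eq_mexp)
    also have "\<dots> \<le> S (N (a, b)) + h * (\<Sum>z\<in>UNIV. ?Gh (a, b) z * S (N z)) + Eh * h\<^sup>2"
      unfolding Eh_def using C2 h S by (intro mexp_first_order_le) auto
    also have "(\<Sum>z\<in>UNIV. ?Gh (a, b) z * S (N z)) = death CARD('n) S (N (a, b)) / m"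
      unfolding N_def m_def by (rule hat_rate_count[OF n])
    finally have 2: "surv CARD('n) ((s + h) / m) (N (a, b))
        \<le> S (N (a, b)) + h * (death CARD('n) S (N (a, b)) / m) + Eh * h\<^sup>2" .
    have "C * h\<^sup>2 = (Ew + Ew) * h\<^sup>2 + Eh * h\<^sup>2" by (simp add: C_def algebra_simps)
    with 1 2 show ?thesis unfolding S_def by linarith
  qed
  ultimately show ?thesis by (rule that)
qed

subsection \<open>Uniformised Markov chains\<close>

text \<open>A general law \<open>\<phi>\<close> lets one construction serve twice: uniform
  fixed-point-free maps give a coordinate of \<open>walk_space\<close>, and the maps of
  \<open>uniformisation_exists\<close> give the specific coupling.\<close>

definition clock_step :: "('s::finite \<Rightarrow> 's) pmf \<Rightarrow> (real \<times> ('s \<Rightarrow> 's)) measure" where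
  "clock_step \<phi> = density lborel (\<lambda>u. ennreal (exponential_density 1 u)) \<Otimes>\<^sub>M measure_pmf \<phi>"

definition clock_space :: "('s::finite \<Rightarrow> 's) pmf \<Rightarrow> (nat \<Rightarrow> real \<times> ('s \<Rightarrow> 's)) measure" where
  "clock_space \<phi> = PiM UNIV (\<lambda>_. clock_step \<phi>)"

text \<open>Implies \<open>clock \<eta> s = k\<close> for nonnegative waiting times, but involves
  finitely many of them and shifts well when the first is removed. \<open>clock\<close> is a
  cardinality, and hence 0 if infinitely many rings occur by time \<open>s\<close>.\<close>

definition hit :: "nat \<Rightarrow> real \<Rightarrow> (nat \<Rightarrow> real \<times> 'b) \<Rightarrow> bool" where
  "hit k s \<eta> \<longleftrightarrow> (\<Sum>j<k. fst (\<eta> j)) \<le> s \<and> s < (\<Sum>j<Suc k. fst (\<eta> j))"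

text \<open>
  If the clock has rung \<open>k\<close> times by time \<open>s\<close>, the waiting times and maps seen from time \<open>s\<close> on are
  \<open>after k s \<eta>\<close>: the residual waiting time first. By lack of memory they have the law of \<open>\<eta>\<close>.
\<close>

definition after :: "nat \<Rightarrow> real \<Rightarrow> (nat \<Rightarrow> real \<times> 'b) \<Rightarrow> nat \<Rightarrow> real \<times> 'b" where
  "after k s \<eta> = case_nat ((\<Sum>j<Suc k. fst (\<eta> j)) - s, snd (\<eta> k)) (\<lambda>j. \<eta> (Suc (k + j)))"

definition chain :: "'s \<Rightarrow> real \<Rightarrow> (nat \<Rightarrow> real \<times> ('s \<Rightarrow> 's)) \<Rightarrow> 's" where
  "chain z t \<eta> = jump_chain z \<eta> (clock \<eta> t)"

definition step_prob :: "('s::finite \<Rightarrow> 's) pmf \<Rightarrow> 's \<Rightarrow> 's \<Rightarrow> real" where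
  "step_prob \<phi> a b = measure_pmf.prob \<phi> {g. g a = b}"

text \<open>The value 0 at negative \<open>s\<close> covers a first waiting time beyond
  \<open>s\<close> when that waiting time is integrated out.\<close>

definition poisson :: "real \<Rightarrow> nat \<Rightarrow> real" where
  "poisson s k = (if s < 0 then 0 else exp (- s) * s ^ k / fact k)"

text \<open>Integer times keep the number of conditions countable; they control all real times,
  since a partial sum that exceeds \<open>T\<close> exceeds every earlier time as well.\<close>

definition regular :: "(nat \<Rightarrow> real \<times> 'b) \<Rightarrow> bool" where
  "regular \<eta> \<longleftrightarrow> (\<forall>j. 0 \<le> fst (\<eta> j)) \<and> (\<forall>T::nat. \<exists>k. hit k (real T) \<eta>)"

lemma poisson_nonneg: "0 \<le> poisson s k"
  by (simp add: poisson_def)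

lemma step_prob_nonneg: "0 \<le> step_prob \<phi> a b"
  by (simp add: step_prob_def)

lemma matrix_power_nonneg: "(\<And>a b. 0 \<le> G a b) \<Longrightarrow> 0 \<le> matrix_power G k a b"
  by (induction k arbitrary: a) (auto intro!: sum_nonneg)

subsubsection \<open>Deterministic facts about clocks\<close>

lemma hit_case_nat: "hit (Suc k) s (case_nat e \<omega>) \<longleftrightarrow> hit k (s - fst e) \<omega>"
  unfolding hit_def by (subst (1 2) sum.lessThan_Suc_shift) (auto simp: algebra_simps)

lemma after_case_nat: "after (Suc k) s (case_nat e \<omega>) = after k (s - fst e) \<omega>"
  unfolding after_def by (subst sum.lessThan_Suc_shift) (auto simp: algebra_simps split: nat.split)

lemma after_0: "after 0 s (case_nat (u, g) \<omega>) = case_nat (u - s, g) \<omega>"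
  by (simp add: after_def)

lemma jump_chain_case_nat: "jump_chain z (case_nat e \<omega>) (Suc k) = jump_chain (snd e z) \<omega> k"
  by (induction k) auto

lemma partial_sums_mono:
  fixes \<eta> :: "nat \<Rightarrow> real \<times> 'b"
  assumes "\<And>j. 0 \<le> fst (\<eta> j)" "k \<le> l"
  shows "(\<Sum>j<k. fst (\<eta> j)) \<le> (\<Sum>j<l. fst (\<eta> j))"
  using assms by (intro sum_mono2) auto

lemma clock_eqI:
  assumes nn: "\<And>j. 0 \<le> fst (\<eta> j)" and "hit k t \<eta>"
  shows "clock \<eta> t = k"
proof -
  have "{i. (\<Sum>j\<le>i. fst (\<eta> j)) \<le> t} = {..<k}"
  proof (intro set_eqI iffI)
    fix i assume "i \<in> {i. (\<Sum>j\<le>i. fst (\<eta> j)) \<le> t}"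
    then have "(\<Sum>j<Suc i. fst (\<eta> j)) < (\<Sum>j<Suc k. fst (\<eta> j))"
      using assms(2) unfolding hit_def lessThan_Suc_atMost by auto
    then show "i \<in> {..<k}"
      using partial_sums_mono[of \<eta> "Suc k" "Suc i"] nn by (cases "i < k") auto
  next
    fix i assume "i \<in> {..<k}"
    then have "(\<Sum>j<Suc i. fst (\<eta> j)) \<le> (\<Sum>j<k. fst (\<eta> j))"
      by (intro partial_sums_mono[OF nn]) auto
    then show "i \<in> {i. (\<Sum>j\<le>i. fst (\<eta> j)) \<le> t}"
      using assms(2) unfolding hit_def lessThan_Suc_atMost by auto
  qed
  then show ?thesis by (simp add: clock_def)
qed

lemma regular_hit:
  assumes r: "regular \<eta>" and "0 \<le> t"
  shows "hit (clock \<eta> t) t \<eta>"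
proof -
  have nn: "\<And>j. 0 \<le> fst (\<eta> j)" using r by (auto simp: regular_def)
  obtain T :: nat where T: "t \<le> real T" using real_arch_simple by blast
  obtain K where "hit K (real T) \<eta>" using r by (auto simp: regular_def)
  then have "t < (\<Sum>j<Suc K. fst (\<eta> j))" using T by (simp add: hit_def)
  then have ex: "\<exists>m. t < (\<Sum>j<Suc m. fst (\<eta> j))" ..
  define m where "m = (LEAST m. t < (\<Sum>j<Suc m. fst (\<eta> j)))"
  have "t < (\<Sum>j<Suc m. fst (\<eta> j))" using LeastI_ex[OF ex] by (simp add: m_def)
  moreover have "(\<Sum>j<m. fst (\<eta> j)) \<le> t"
  proof (cases m)
    case (Suc m')
    then have "\<not> t < (\<Sum>j<Suc m'. fst (\<eta> j))"
      using not_less_Least[of m' "\<lambda>m. t < (\<Sum>j<Suc m. fst (\<eta> j))"] by (auto simp: m_def)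
    then show ?thesis using Suc by (simp del: sum.lessThan_Suc)
  qed (use \<open>0 \<le> t\<close> in simp)
  ultimately have "hit m t \<eta>" by (simp add: hit_def)
  then show ?thesis using clock_eqI[OF nn] by simp
qed

lemma after_sum: "(\<Sum>i<Suc l. fst (after k s \<eta> i)) = (\<Sum>j<Suc (k + l). fst (\<eta> j)) - s"
  by (induction l) (simp_all add: after_def)

lemma jump_chain_after: "jump_chain z \<eta> (k + l) = jump_chain (jump_chain z \<eta> k) (after k s \<eta>) l"
proof -
  have "snd (after k s \<eta> l) = snd (\<eta> (k + l))" for l by (cases l) (simp_all add: after_def)
  then show ?thesis by (induction l) simp_all
qed

lemma chain_after:
  assumes r: "regular \<eta>" and s: "0 \<le> s" and t: "0 \<le> t"
  shows "chain z (s + t) \<eta> = chain (chain z s \<eta>) t (after (clock \<eta> s) s \<eta>)"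
proof -
  have nn: "\<And>j. 0 \<le> fst (\<eta> j)" using r by (auto simp: regular_def)
  define k where "k = clock \<eta> s"
  have k: "hit k s \<eta>" unfolding k_def by (rule regular_hit[OF r s])
  define K where "K = clock \<eta> (s + t)"
  have K: "hit K (s + t) \<eta>" unfolding K_def using s t by (intro regular_hit[OF r]) simp
  have "k \<le> K"
  proof (rule ccontr)
    assume "\<not> k \<le> K"
    then have "(\<Sum>j<Suc K. fst (\<eta> j)) \<le> (\<Sum>j<k. fst (\<eta> j))" by (intro partial_sums_mono[OF nn]) auto
    then show False using k K t by (simp add: hit_def)
  qed
  then obtain l where l: "K = k + l" by (auto simp: le_iff_add)
  have nn': "0 \<le> fst (after k s \<eta> j)" for j
    using nn k by (cases j) (auto simp: after_def hit_def)
  have "hit l t (after k s \<eta>)"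
  proof (cases l)
    case 0
    then show ?thesis using K t l unfolding hit_def after_sum by simp
  next
    case (Suc l')
    then show ?thesis using K l unfolding hit_def Suc after_sum by (simp del: sum.lessThan_Suc)
  qed
  then have "clock (after k s \<eta>) t = l" by (rule clock_eqI[OF nn'])
  then show ?thesis
    using jump_chain_after[of z \<eta> k l s] l by (simp add: chain_def k_def K_def)
qed

subsubsection \<open>The Markov property\<close>

lemma prob_space_clock_step: "prob_space (clock_step \<phi>)"
proof -
  have "prob_space (density lborel (\<lambda>u. ennreal (exponential_density 1 u)))"
    using prob_space_exponential_density[of 1] by simp
  then show ?thesis
    unfolding clock_step_def
    by (intro pair_prob_space.axioms(1)[THEN pair_sigma_finite.axioms(1)] prob_space_pair)
       (auto intro: measure_pmf.prob_space_axioms)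
qed

lemma prob_space_clock_space: "prob_space (clock_space \<phi>)"
  unfolding clock_space_def by (intro prob_space_PiM prob_space_clock_step)

lemma space_clock_step: "space (clock_step \<phi>) = UNIV"
  by (simp add: clock_step_def space_pair_measure)

lemma space_clock_space: "space (clock_space \<phi>) = UNIV"
  by (simp add: clock_space_def space_clock_step space_PiM PiE_UNIV_domain)

lemma fst_measurable_clock_step [measurable]: "fst \<in> borel_measurable (clock_step \<phi>)"
proof -
  have "fst \<in> measurable (clock_step \<phi>) (density lborel (\<lambda>u. ennreal (exponential_density 1 u)))"
    unfolding clock_step_def by (rule measurable_fst)
  then show ?thesis by (simp add: measurable_def)
qed

lemma snd_measurable_clock_step [measurable]: "snd \<in> measurable (clock_step \<phi>) (count_space UNIV)"
proof -
  have "snd \<in> measurable (clock_step \<phi>) (measure_pmf \<phi>)"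
    unfolding clock_step_def by (rule measurable_snd)
  then show ?thesis by (simp add: measurable_def)
qed

lemma component_measurable [measurable]: "(\<lambda>\<eta>. \<eta> j) \<in> measurable (clock_space \<phi>) (clock_step \<phi>)"
  unfolding clock_space_def by (rule measurable_component_singleton) simp

lemma Pair_measurable_clock_step:
  assumes "f \<in> borel_measurable M" "g \<in> measurable M (count_space UNIV)"
  shows "(\<lambda>x. (f x, g x)) \<in> measurable M (clock_step \<phi>)"
  unfolding clock_step_def
  by (rule measurable_Pair) (use assms in \<open>simp_all add: measurable_def\<close>)

lemma jump_chain_measurable [measurable]:
  "(\<lambda>\<eta>. jump_chain z \<eta> k) \<in> measurable (clock_space \<phi>) (count_space UNIV)"
proof (induction k)
  case (Suc k)
  have "(\<lambda>\<eta>. snd (\<eta> k) i) \<in> measurable (clock_space \<phi>) (count_space UNIV)" for i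
    by (rule measurable_compose[of "\<lambda>\<eta>. snd (\<eta> k)" _ "count_space UNIV"]) measurable
  from measurable_compose_countable[OF this Suc] show ?case by simp
qed simp

lemma clock_measurable [measurable]:
  "(\<lambda>\<eta>. clock \<eta> t) \<in> measurable (clock_space \<phi>) (count_space UNIV)"
  unfolding clock_def by measurable

lemma chain_measurable [measurable]:
  "chain z t \<in> measurable (clock_space \<phi>) (count_space UNIV)"
  unfolding chain_def[abs_def]
  by (rule measurable_compose_countable[OF jump_chain_measurable clock_measurable])

lemma hit_measurable [measurable]: "Measurable.pred (clock_space \<phi>) (hit k s)"
  unfolding hit_def[abs_def] by measurable

lemma after_measurable [measurable]: "after k s \<in> measurable (clock_space \<phi>) (clock_space \<phi>)"
proof -
  have "(\<lambda>\<eta>. (\<Sum>j<Suc k. fst (\<eta> j)) - s) \<in> borel_measurable (clock_space \<phi>)"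
    by measurable
  moreover have "(\<lambda>\<eta>. snd (\<eta> k)) \<in> measurable (clock_space \<phi>) (count_space UNIV)"
    by measurable
  ultimately have 1: "(\<lambda>\<eta>. ((\<Sum>j<Suc k. fst (\<eta> j)) - s, snd (\<eta> k))) \<in> measurable (clock_space \<phi>) (clock_step \<phi>)"
    by (rule Pair_measurable_clock_step)
  have 2: "(\<lambda>\<eta> j. \<eta> (Suc (k + j))) \<in> measurable (clock_space \<phi>) (PiM UNIV (\<lambda>_. clock_step \<phi>))"
    by (rule measurable_PiM_single') (simp_all add: space_clock_step)
  from measurable_case_nat'[OF 1 2] show ?thesis
    unfolding after_def[abs_def] by (subst (2) clock_space_def)
qed

text \<open>An i.i.d. sequence is its first entry followed by an independent copy of the sequence;
  the entry is then split into waiting time and map.\<close>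

lemma nn_integral_clock_space:
  assumes [measurable]: "f \<in> borel_measurable (clock_space \<phi>)"
  shows "(\<integral>\<^sup>+\<eta>. f \<eta> \<partial>clock_space \<phi>) =
    (\<integral>\<^sup>+u. ennreal (exponential_density 1 u) *
       (\<integral>\<^sup>+g. (\<integral>\<^sup>+\<omega>. f (case_nat (u, g) \<omega>) \<partial>clock_space \<phi>) \<partial>measure_pmf \<phi>) \<partial>lborel)"
    and "(\<lambda>e. \<integral>\<^sup>+\<omega>. f (case_nat e \<omega>) \<partial>clock_space \<phi>) \<in> borel_measurable (clock_step \<phi>)"
proof -
  interpret sequence_space "clock_step \<phi>"
    by (simp add: sequence_space_def product_prob_space_def product_prob_space_axioms_def
        product_sigma_finite_def prob_space_clock_step prob_space_imp_sigma_finite)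
  interpret C: prob_space "clock_space \<phi>" by (rule prob_space_clock_space)
  have S: "S = clock_space \<phi>" by (simp add: clock_space_def)
  note iter = PiM_iter[unfolded S]
  have [measurable]: "(\<lambda>(e, \<omega>). case_nat e \<omega>) \<in> measurable (clock_step \<phi> \<Otimes>\<^sub>M clock_space \<phi>) (clock_space \<phi>)"
    unfolding clock_space_def case_prod_unfold by measurable
  have m2: "(\<lambda>x. f (case x of (e, \<omega>) \<Rightarrow> case_nat e \<omega>)) \<in> borel_measurable (clock_step \<phi> \<Otimes>\<^sub>M clock_space \<phi>)"
    by measurable
  show meas: "(\<lambda>e. \<integral>\<^sup>+\<omega>. f (case_nat e \<omega>) \<partial>clock_space \<phi>) \<in> borel_measurable (clock_step \<phi>)"
    using C.borel_measurable_nn_integral_fst[OF m2] by simp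
  let ?F = "\<lambda>e. \<integral>\<^sup>+\<omega>. f (case_nat e \<omega>) \<partial>clock_space \<phi>"
  let ?E = "density lborel (\<lambda>u. ennreal (exponential_density 1 u))"
  have meas': "?F \<in> borel_measurable (?E \<Otimes>\<^sub>M measure_pmf \<phi>)"
    using meas by (simp add: clock_step_def)
  have "(\<lambda>u. \<integral>\<^sup>+g. ?F (u, g) \<partial>measure_pmf \<phi>) \<in> borel_measurable ?E"
    by (rule measure_pmf.borel_measurable_nn_integral_fst[OF meas'])
  then have meas2: "(\<lambda>u. \<integral>\<^sup>+g. ?F (u, g) \<partial>measure_pmf \<phi>) \<in> borel_measurable lborel"
    by simp
  have "(\<integral>\<^sup>+\<eta>. f \<eta> \<partial>clock_space \<phi>) = (\<integral>\<^sup>+x. f (case x of (e, \<omega>) \<Rightarrow> case_nat e \<omega>) \<partial>(clock_step \<phi> \<Otimes>\<^sub>M clock_space \<phi>))"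
    by (subst iter[symmetric], subst nn_integral_distr) simp_all
  also have "\<dots> = (\<integral>\<^sup>+e. ?F e \<partial>clock_step \<phi>)"
    using C.nn_integral_fst[OF m2] by simp
  also have "\<dots> = (\<integral>\<^sup>+u. \<integral>\<^sup>+g. ?F (u, g) \<partial>measure_pmf \<phi> \<partial>?E)"
    using measure_pmf.nn_integral_fst[OF meas'] by (simp add: clock_step_def)
  also have "\<dots> = (\<integral>\<^sup>+u. ennreal (exponential_density 1 u) * (\<integral>\<^sup>+g. ?F (u, g) \<partial>measure_pmf \<phi>) \<partial>lborel)"
    by (rule nn_integral_density[OF _ meas2]) measurable
  finally show "(\<integral>\<^sup>+\<eta>. f \<eta> \<partial>clock_space \<phi>) =
    (\<integral>\<^sup>+u. ennreal (exponential_density 1 u) *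
       (\<integral>\<^sup>+g. (\<integral>\<^sup>+\<omega>. f (case_nat (u, g) \<omega>) \<partial>clock_space \<phi>) \<partial>measure_pmf \<phi>) \<partial>lborel)" .
qed

lemma nn_integral_step:
  fixes F :: "'s::finite \<Rightarrow> real"
  assumes "\<And>a. 0 \<le> F a"
  shows "(\<integral>\<^sup>+g. ennreal (F (g z)) \<partial>measure_pmf \<phi>) = ennreal (\<Sum>v\<in>UNIV. step_prob \<phi> z v * F v)"
proof -
  have "(\<integral>\<^sup>+g. ennreal (F (g z)) \<partial>measure_pmf \<phi>)
      = (\<integral>\<^sup>+g. (\<Sum>v\<in>UNIV. ennreal (F v) * indicator {g. g z = v} g) \<partial>measure_pmf \<phi>)"
    by (intro nn_integral_cong) (simp add: indicator_def if_distrib cong: if_cong)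
  also have "\<dots> = (\<Sum>v\<in>UNIV. ennreal (F v) * emeasure (measure_pmf \<phi>) {g. g z = v})"
    by (subst nn_integral_sum) (simp_all add: nn_integral_cmult)
  also have "\<dots> = (\<Sum>v\<in>UNIV. ennreal (step_prob \<phi> z v * F v))"
    by (intro sum.cong refl)
      (simp add: step_prob_def measure_pmf.emeasure_eq_measure ennreal_mult' assms mult.commute)
  finally show ?thesis
    by (simp add: sum_ennreal assms step_prob_nonneg)
qed

lemma poisson_convolution:
  "(\<integral>\<^sup>+u. ennreal (exponential_density 1 u) * ennreal (poisson (s - u) k) \<partial>lborel) = ennreal (poisson s (Suc k))"
proof (cases "s < 0")
  case True
  then have z: "ennreal (exponential_density 1 u) * ennreal (poisson (s - u) k) = 0" for u
    by (auto simp: exponential_density_def poisson_def)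
  show ?thesis unfolding z using True by (simp add: poisson_def)
next
  case False
  let ?F = "\<lambda>u. - exp (- s) * (s - u) ^ Suc k / fact (Suc k)"
  let ?f = "\<lambda>u. exp (- s) * (s - u) ^ k / fact k"
  have "(\<integral>\<^sup>+u. ennreal (exponential_density 1 u) * ennreal (poisson (s - u) k) \<partial>lborel)
      = (\<integral>\<^sup>+u. ennreal (?f u) * indicator {0..s} u \<partial>lborel)"
    by (intro nn_integral_cong)
      (auto simp: exponential_density_def poisson_def indicator_def ennreal_mult'[symmetric] simp flip: exp_add)
  also have "\<dots> = ennreal (?F s - ?F 0)"
  proof (rule nn_integral_FTC_Icc)
    fix u assume u: "u \<in> {0..s}"
    have "(?F has_real_derivative - exp (- s) * (real (Suc k) * (s - u) ^ k * (- 1)) / fact (Suc k)) (at u)"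
      by (auto intro!: derivative_eq_intros simp del: power_Suc fact_Suc of_nat_Suc)
    also have "- exp (- s) * (real (Suc k) * (s - u) ^ k * (- 1)) / fact (Suc k) = ?f u"
      by (simp add: fact_Suc divide_simps del: of_nat_Suc)
    finally show "(?F has_real_derivative ?f u) (at u)" .
    show "0 \<le> ?f u" using u by simp
  qed (use False in auto)
  also have "?F s - ?F 0 = poisson s (Suc k)"
    using False by (simp add: poisson_def)
  finally show ?thesis .
qed

text \<open>Induction on \<open>k\<close> by integrating out the first waiting time and map. The
  base case is lack of memory; the step is \<open>poisson_convolution\<close> with one more factor
  \<open>step_prob \<phi>\<close>. The test function \<open>f\<close> expresses that the future seen
  from \<open>s\<close> is a fresh copy, independent of the number of rings and of the
  state.\<close>

lemma markov_hit:
  assumes f [measurable]: "f \<in> borel_measurable (clock_space \<phi>)"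
  shows "(\<integral>\<^sup>+\<eta>. (if hit k s \<eta> \<and> jump_chain z \<eta> k = w then f (after k s \<eta>) else 0) \<partial>clock_space \<phi>)
     = ennreal (poisson s k * matrix_power (step_prob \<phi>) k z w) * (\<integral>\<^sup>+\<eta>. f \<eta> \<partial>clock_space \<phi>)"
proof (induction k arbitrary: s z)
  case 0
  define H where "H u = (\<integral>\<^sup>+g. (\<integral>\<^sup>+\<omega>. f (case_nat (u, g) \<omega>) \<partial>clock_space \<phi>) \<partial>measure_pmf \<phi>)" for u
  have H [measurable]: "H \<in> borel_measurable borel"
  proof -
    let ?E = "density lborel (\<lambda>u. ennreal (exponential_density 1 u))"
    have "(\<lambda>e. \<integral>\<^sup>+\<omega>. f (case_nat e \<omega>) \<partial>clock_space \<phi>) \<in> borel_measurable (?E \<Otimes>\<^sub>M measure_pmf \<phi>)"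
      using nn_integral_clock_space(2)[OF f] by (simp add: clock_step_def)
    from measure_pmf.borel_measurable_nn_integral_fst[OF this] show ?thesis
      by (simp add: H_def[abs_def])
  qed
  show ?case
  proof (cases "0 \<le> s \<and> z = w")
    case False
    then have "(if hit 0 s \<eta> \<and> jump_chain z \<eta> 0 = w then f (after 0 s \<eta>) else 0) = 0" for \<eta>
      by (auto simp: hit_def)
    then show ?thesis using False by (auto simp: poisson_def)
  next
    case True
    have "(\<integral>\<^sup>+\<eta>. (if hit 0 s \<eta> \<and> jump_chain z \<eta> 0 = w then f (after 0 s \<eta>) else 0) \<partial>clock_space \<phi>)
       = (\<integral>\<^sup>+u. ennreal (exponential_density 1 u) *
           (\<integral>\<^sup>+g. (\<integral>\<^sup>+\<omega>. (if s < u then f (case_nat (u - s, g) \<omega>) else 0) \<partial>clock_space \<phi>) \<partial>measure_pmf \<phi>) \<partial>lborel)"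
      using True by (subst nn_integral_clock_space(1)) (simp_all add: hit_def after_0 cong: if_cong)
    also have "\<dots> = (\<integral>\<^sup>+u. ennreal (exponential_density 1 u) * (if s < u then H (u - s) else 0) \<partial>lborel)"
      unfolding H_def by (intro nn_integral_cong) auto
    \<comment> \<open>The substitution \<open>u = s + v\<close> makes the overshoot the new first
      waiting time. The density splits off \<open>exp (- s)\<close>, and \<open>v = 0\<close> is a
      null set.\<close>
    also have "\<dots> = (\<integral>\<^sup>+v. ennreal (exponential_density 1 (s + 1 * v)) * (if s < s + 1 * v then H (s + 1 * v - s) else 0) \<partial>lborel)"
      by (subst nn_integral_real_affine[where c = 1 and t = s]) simp_all
    also have "\<dots> = (\<integral>\<^sup>+v. ennreal (exp (- s)) * (ennreal (exponential_density 1 v) * H v) \<partial>lborel)"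
    proof (rule nn_integral_cong_AE)
      have "ennreal (exp (- (s + v))) = ennreal (exp (- s)) * ennreal (exp (- v))" for v
        by (simp add: ennreal_mult'[symmetric] flip: exp_add)
      then show "AE v in lborel. ennreal (exponential_density 1 (s + 1 * v)) * (if s < s + 1 * v then H (s + 1 * v - s) else 0)
          = ennreal (exp (- s)) * (ennreal (exponential_density 1 v) * H v)"
        using AE_lborel_singleton[of 0] True
        by (auto simp: exponential_density_def mult_ac elim!: eventually_mono)
    qed
    also have "\<dots> = ennreal (exp (- s)) * (\<integral>\<^sup>+\<eta>. f \<eta> \<partial>clock_space \<phi>)"
      unfolding nn_integral_clock_space(1)[OF f] H_def[symmetric] by (rule nn_integral_cmult) measurable
    finally show ?thesis using True by (simp add: poisson_def)
  qed
next
  case (Suc k)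
  let ?I = "\<integral>\<^sup>+\<eta>. f \<eta> \<partial>clock_space \<phi>"
  let ?P = "matrix_power (step_prob \<phi>)"
  have nn: "0 \<le> ?P j a b" for j a b by (intro matrix_power_nonneg step_prob_nonneg)
  have "(\<integral>\<^sup>+\<eta>. (if hit (Suc k) s \<eta> \<and> jump_chain z \<eta> (Suc k) = w then f (after (Suc k) s \<eta>) else 0) \<partial>clock_space \<phi>)
     = (\<integral>\<^sup>+u. ennreal (exponential_density 1 u) *
         (\<integral>\<^sup>+g. (\<integral>\<^sup>+\<omega>. (if hit k (s - u) \<omega> \<and> jump_chain (g z) \<omega> k = w then f (after k (s - u) \<omega>) else 0)
            \<partial>clock_space \<phi>) \<partial>measure_pmf \<phi>) \<partial>lborel)"
  proof -
    have "(\<lambda>\<eta>. if hit (Suc k) s \<eta> \<and> jump_chain z \<eta> (Suc k) = w then f (after (Suc k) s \<eta>) else 0)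
        \<in> borel_measurable (clock_space \<phi>)"
      by measurable
    from nn_integral_clock_space(1)[OF this] show ?thesis
      by (simp only: hit_case_nat after_case_nat jump_chain_case_nat fst_conv snd_conv)
  qed
  also have "\<dots> = (\<integral>\<^sup>+u. ennreal (exponential_density 1 u) *
         (\<integral>\<^sup>+g. ennreal (poisson (s - u) k) * ?I * ennreal (?P k (g z) w) \<partial>measure_pmf \<phi>) \<partial>lborel)"
    unfolding Suc.IH by (simp only: ennreal_mult[OF poisson_nonneg nn] mult_ac)
  also have "\<dots> = (\<integral>\<^sup>+u. ennreal (exponential_density 1 u) * ennreal (poisson (s - u) k) *
         (?I * ennreal (?P (Suc k) z w)) \<partial>lborel)"
  proof (intro nn_integral_cong)
    fix u
    have "(\<integral>\<^sup>+g. ennreal (poisson (s - u) k) * ?I * ennreal (?P k (g z) w) \<partial>measure_pmf \<phi>)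
        = ennreal (poisson (s - u) k) * ?I * (\<integral>\<^sup>+g. ennreal (?P k (g z) w) \<partial>measure_pmf \<phi>)"
      by (rule nn_integral_cmult) simp
    also have "(\<integral>\<^sup>+g. ennreal (?P k (g z) w) \<partial>measure_pmf \<phi>) = ennreal (?P (Suc k) z w)"
      using nn_integral_step[where F = "\<lambda>v. ?P k v w" and z = z and \<phi> = \<phi>] nn by simp
    finally show "ennreal (exponential_density 1 u) *
         (\<integral>\<^sup>+g. ennreal (poisson (s - u) k) * ?I * ennreal (?P k (g z) w) \<partial>measure_pmf \<phi>)
      = ennreal (exponential_density 1 u) * ennreal (poisson (s - u) k) * (?I * ennreal (?P (Suc k) z w))"
      by (simp only: mult_ac)
  qed
  also have "\<dots> = ennreal (poisson s (Suc k)) * (?I * ennreal (?P (Suc k) z w))"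
  proof -
    have "(\<lambda>u. ennreal (exponential_density 1 u) * ennreal (poisson (s - u) k)) \<in> borel_measurable lborel"
      unfolding poisson_def by measurable
    from nn_integral_multc[OF this, of "?I * ennreal (?P (Suc k) z w)"] show ?thesis
      by (simp only: poisson_convolution)
  qed
  finally show ?case unfolding ennreal_mult[OF poisson_nonneg nn] by (simp only: mult_ac)
qed

lemma mexp_uniformisation:
  "mexp (\<lambda>a b. P a b - (if a = b then 1 else 0)) t a b = exp (- t) * mexp P t a b"
proof -
  let ?G = "\<lambda>a b. P a b - (if a = b then 1 else 0)"
  have "((\<lambda>t. exp (- t) * mexp P t a b) has_real_derivative
      (\<Sum>c\<in>UNIV. ?G a c * (exp (- t) * mexp P t c b))) (at t)" for t a
  proof -
    have "((\<lambda>t. exp (- t) * mexp P t a b) has_real_derivative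
      exp (- t) * (\<Sum>c\<in>UNIV. P a c * mexp P t c b) + - exp (- t) * mexp P t a b) (at t)"
      by (rule DERIV_mult'[OF _ mexp_has_derivative]) (auto intro!: derivative_eq_intros)
    also have "exp (- t) * (\<Sum>c\<in>UNIV. P a c * mexp P t c b) + - exp (- t) * mexp P t a b
        = (\<Sum>c\<in>UNIV. ?G a c * (exp (- t) * mexp P t c b))"
    proof -
      have "(\<Sum>c\<in>UNIV. ?G a c * (exp (- t) * mexp P t c b))
          = (\<Sum>c\<in>UNIV. P a c * (exp (- t) * mexp P t c b)) - (\<Sum>c\<in>UNIV. if a = c then exp (- t) * mexp P t c b else 0)"
        by (subst sum_subtractf[symmetric]) (auto intro!: sum.cong simp: algebra_simps)
      then show ?thesis by (simp add: sum_distrib_left mult_ac)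
    qed
    finally show ?thesis .
  qed
  from mexp_unique[of "\<lambda>t a. exp (- t) * mexp P t a b" ?G, OF this, of t a]
  show ?thesis by (simp add: mexp_0 if_distrib if_distribR cong: if_cong)
qed

definition chain_rate :: "('s::finite \<Rightarrow> 's) pmf \<Rightarrow> 's \<Rightarrow> 's \<Rightarrow> real" where
  "chain_rate \<phi> a b = step_prob \<phi> a b - (if a = b then 1 else 0)"

lemma step_prob_sum: "(\<Sum>b\<in>UNIV. step_prob \<phi> a b) = 1"
proof -
  have "step_prob \<phi> a b = pmf (map_pmf (\<lambda>g. g a) \<phi>) b" for b
    by (simp add: step_prob_def pmf_map vimage_def)
  then show ?thesis by (simp add: sum_pmf_eq_1)
qed

lemma poisson_mexp_sums:
  assumes "0 \<le> s"
  shows "(\<lambda>k. poisson s k * matrix_power (step_prob \<phi>) k z w) sums mexp (chain_rate \<phi>) s z w"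
proof -
  have "(\<lambda>k. exp (- s) * (s ^ k / fact k * matrix_power (step_prob \<phi>) k z w)) sums
      (exp (- s) * mexp (step_prob \<phi>) s z w)"
    unfolding mexp_def by (intro sums_mult summable_sums mexp_summable)
  then show ?thesis
    using assms by (simp add: poisson_def chain_rate_def[abs_def] mexp_uniformisation mult_ac)
qed

lemma mexp_chain_rate_nonneg: "0 \<le> s \<Longrightarrow> 0 \<le> mexp (chain_rate \<phi>) s z w"
  using sums_le[OF _ sums_zero poisson_mexp_sums[of s \<phi> z w]]
  by (simp add: poisson_nonneg matrix_power_nonneg step_prob_nonneg)

lemma suminf_poisson_ennreal:
  assumes "0 \<le> s"
  shows "(\<Sum>k. ennreal (poisson s k * matrix_power (step_prob \<phi>) k z w) * c) = ennreal (mexp (chain_rate \<phi>) s z w) * c"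
  unfolding ennreal_suminf_multc
  by (subst suminf_ennreal_eq[OF _ poisson_mexp_sums[OF assms]])
    (auto intro!: mult_nonneg_nonneg poisson_nonneg matrix_power_nonneg step_prob_nonneg)

section \<open>Almost sure regularity of the clock, and the Markov property at a fixed time\<close>

lemma AE_nonneg: "AE \<eta> in clock_space \<phi>. \<forall>j. 0 \<le> fst (\<eta> j)"
proof -
  let ?E = "density lborel (\<lambda>u. ennreal (exponential_density 1 u))"
  interpret E: prob_space ?E using prob_space_exponential_density[of 1] by simp
  interpret pair_sigma_finite ?E "measure_pmf \<phi>" ..
  have "{x\<in>space (clock_step \<phi>). 0 \<le> fst x} \<in> sets (clock_step \<phi>)" by measurable
  then have "AE e in clock_step \<phi>. 0 \<le> fst e"
    unfolding clock_step_def
    by (rule AE_pair_measure) (simp add: AE_density exponential_density_def)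
  then have "AE \<eta> in clock_space \<phi>. 0 \<le> fst (\<eta> j)" for j
    unfolding clock_space_def by (intro AE_PiM_component) (auto intro: prob_space_clock_step)
  then show ?thesis by (simp add: AE_all_countable)
qed

text \<open>Non-explosion: the probabilities of \<open>k\<close> rings ending in state
  \<open>w\<close> sum over \<open>k\<close> and \<open>w\<close> to a row sum of
  \<open>mexp (chain_rate \<phi>)\<close>, which is 1, while the corresponding events are almost
  surely disjoint parts of the event in question. The starting state \<open>z\<close> is
  arbitrary.\<close>

lemma AE_hit:
  assumes "0 \<le> s"
  shows "AE \<eta> in clock_space (\<phi> :: ('s::finite \<Rightarrow> 's) pmf). \<exists>k. hit k s \<eta>"
proof -
  interpret prob_space "clock_space \<phi>" by (rule prob_space_clock_space)
  fix z :: 's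
  let ?h = "\<lambda>k w \<eta>. if hit k s \<eta> \<and> jump_chain z \<eta> k = w then 1 else 0 :: ennreal"
  have "(\<integral>\<^sup>+\<eta>. (\<Sum>w\<in>UNIV. \<Sum>k. ?h k w \<eta>) \<partial>clock_space \<phi>)
      = (\<Sum>w\<in>UNIV. \<integral>\<^sup>+\<eta>. (\<Sum>k. ?h k w \<eta>) \<partial>clock_space \<phi>)"
    by (rule nn_integral_sum) measurable
  also have "\<dots> = (\<Sum>w\<in>UNIV. \<Sum>k. \<integral>\<^sup>+\<eta>. ?h k w \<eta> \<partial>clock_space \<phi>)"
    by (intro sum.cong refl nn_integral_suminf) measurable
  also have "\<dots> = (\<Sum>w\<in>UNIV. ennreal (mexp (chain_rate \<phi>) s z w))"
    using markov_hit[of "\<lambda>_. 1" \<phi> _ s z] suminf_poisson_ennreal[OF assms, of \<phi> z _ 1]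
    by (simp add: emeasure_space_1)
  also have "\<dots> = ennreal (\<Sum>w\<in>UNIV. mexp (chain_rate \<phi>) s z w)"
    by (rule sum_ennreal) (simp add: mexp_chain_rate_nonneg assms)
  also have "(\<Sum>w\<in>UNIV. mexp (chain_rate \<phi>) s z w) = 1"
    by (rule mexp_const) (simp add: chain_rate_def sum_subtractf step_prob_sum)
  finally have 1: "(\<integral>\<^sup>+\<eta>. (\<Sum>w\<in>UNIV. \<Sum>k. ?h k w \<eta>) \<partial>clock_space \<phi>) = 1" by simp
  have "AE \<eta> in clock_space \<phi>. (\<Sum>w\<in>UNIV. \<Sum>k. ?h k w \<eta>) \<le> indicator {\<eta>. \<exists>k. hit k s \<eta>} \<eta>"
    using AE_nonneg
  proof eventually_elim
    fix \<eta> :: "nat \<Rightarrow> real \<times> ('s \<Rightarrow> 's)"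
    assume nn: "\<forall>j. 0 \<le> fst (\<eta> j)"
    show "(\<Sum>w\<in>UNIV. \<Sum>k. ?h k w \<eta>) \<le> indicator {\<eta>. \<exists>k. hit k s \<eta>} \<eta>"
    proof (cases "\<exists>k. hit k s \<eta>")
      case True
      then obtain k where k: "hit k s \<eta>" ..
      have "hit l s \<eta> \<longleftrightarrow> l = k" for l
        using clock_eqI[of \<eta>, OF _ k] clock_eqI[of \<eta> l s] nn k by auto
      then have "(\<Sum>l. ?h l w \<eta>) = (if jump_chain z \<eta> k = w then 1 else 0)" for w
        by (subst suminf_finite[of "{k}"]) auto
      then show ?thesis using True by simp
    qed simp
  qed
  from nn_integral_mono_AE[OF this]
  have "1 \<le> (\<integral>\<^sup>+\<eta>. indicator {\<eta>. \<exists>k. hit k s \<eta>} \<eta> \<partial>clock_space \<phi>)"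
    unfolding 1 .
  also have "\<dots> = emeasure (clock_space \<phi>) {\<eta>. \<exists>k. hit k s \<eta>}"
  proof (rule nn_integral_indicator)
    have "{\<eta> \<in> space (clock_space \<phi>). \<exists>k. hit k s \<eta>} \<in> sets (clock_space \<phi>)" by measurable
    then show "{\<eta>. \<exists>k. hit k s \<eta>} \<in> sets (clock_space \<phi>)" by (simp add: space_clock_space)
  qed
  finally have "emeasure (clock_space \<phi>) {\<eta>. \<exists>k. hit k s \<eta>} = 1"
    using emeasure_le_1 by (intro antisym)
  moreover have "{\<eta> \<in> space (clock_space \<phi>). \<exists>k. hit k s \<eta>} \<in> sets (clock_space \<phi>)" by measurable
  ultimately show ?thesis
    by (subst AE_iff_emeasure_eq_1) (simp_all add: space_clock_space)
qed

lemma AE_regular: "AE \<eta> in clock_space \<phi>. regular \<eta>"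
  using AE_nonneg[of \<phi>] AE_hit[of "real T" \<phi> for T]
  by (simp add: regular_def AE_all_countable)

text \<open>\<open>markov_hit\<close> summed over the number of rings by time
  \<open>s\<close>.\<close>

lemma chain_markov:
  assumes [measurable]: "f \<in> borel_measurable (clock_space \<phi>)" and s: "0 \<le> s"
  shows "(\<integral>\<^sup>+\<eta>. (if chain z s \<eta> = w then f (after (clock \<eta> s) s \<eta>) else 0) \<partial>clock_space \<phi>)
      = ennreal (mexp (chain_rate \<phi>) s z w) * (\<integral>\<^sup>+\<eta>. f \<eta> \<partial>clock_space \<phi>)"
proof -
  let ?h = "\<lambda>k \<eta>. if hit k s \<eta> \<and> jump_chain z \<eta> k = w then f (after k s \<eta>) else 0"
  have "(\<integral>\<^sup>+\<eta>. (if chain z s \<eta> = w then f (after (clock \<eta> s) s \<eta>) else 0) \<partial>clock_space \<phi>)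
      = (\<integral>\<^sup>+\<eta>. (\<Sum>k. ?h k \<eta>) \<partial>clock_space \<phi>)"
  proof (rule nn_integral_cong_AE)
    show "AE \<eta> in clock_space \<phi>. (if chain z s \<eta> = w then f (after (clock \<eta> s) s \<eta>) else 0) = (\<Sum>k. ?h k \<eta>)"
      using AE_regular
    proof eventually_elim
      fix \<eta> :: "nat \<Rightarrow> real \<times> ('a \<Rightarrow> 'a)"
      assume r: "regular \<eta>"
      have "hit k s \<eta> \<longleftrightarrow> k = clock \<eta> s" for k
        using clock_eqI[of \<eta> k s] regular_hit[OF r s] r by (auto simp: regular_def)
      then show "(if chain z s \<eta> = w then f (after (clock \<eta> s) s \<eta>) else 0) = (\<Sum>k. ?h k \<eta>)"
        by (subst suminf_finite[of "{clock \<eta> s}"]) (auto simp: chain_def)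
    qed
  qed
  also have "\<dots> = (\<Sum>k. \<integral>\<^sup>+\<eta>. ?h k \<eta> \<partial>clock_space \<phi>)"
    by (rule nn_integral_suminf) measurable
  finally show ?thesis
    by (simp only: markov_hit[OF assms(1)] suminf_poisson_ennreal[OF s])
qed

text \<open>Induction on the number of times, applying \<open>chain_markov\<close> at the first one:
  the chain restarts from \<open>zs 0\<close> and the other times are shifted by
  \<open>ts 0\<close>.\<close>

lemma chain_fdd:
  fixes ts :: "nat \<Rightarrow> real" and m :: nat
  assumes "0 \<le> ts 0" "mono ts"
  shows "emeasure (clock_space \<phi>) {\<eta>. \<forall>k\<le>m. chain z (ts k) \<eta> = zs k} =
    ennreal (mexp (chain_rate \<phi>) (ts 0) z (zs 0) *
      (\<Prod>k<m. mexp (chain_rate \<phi>) (ts (Suc k) - ts k) (zs k) (zs (Suc k))))"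
  using assms
proof (induction m arbitrary: z ts zs)
  interpret prob_space "clock_space \<phi>" by (rule prob_space_clock_space)
  have sets: "{\<eta>. \<forall>k\<le>m. chain z (ts k) \<eta> = zs k} \<in> sets (clock_space \<phi>)" for z ts zs and m :: nat
  proof -
    have "{\<eta> \<in> space (clock_space \<phi>). \<forall>k\<le>m. chain z (ts k) \<eta> = zs k} \<in> sets (clock_space \<phi>)" by measurable
    then show ?thesis by (simp add: space_clock_space)
  qed
  {
    case 0
    have "emeasure (clock_space \<phi>) {\<eta>. \<forall>k\<le>0. chain z (ts k) \<eta> = zs k}
        = (\<integral>\<^sup>+\<eta>. (if chain z (ts 0) \<eta> = zs 0 then 1 else 0) \<partial>clock_space \<phi>)"
      unfolding nn_integral_indicator[OF sets, symmetric]
      by (intro nn_integral_cong) (auto simp: indicator_def)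
    then show ?case
      using chain_markov[of "\<lambda>_. 1" \<phi> "ts 0" z "zs 0"] 0 by (simp add: emeasure_space_1)
  next
    case (Suc m)
    let ?ts = "\<lambda>k. ts (Suc k) - ts 0" and ?zs = "\<lambda>k. zs (Suc k)"
    let ?A = "{\<eta>. \<forall>k\<le>m. chain (zs 0) (?ts k) \<eta> = ?zs k}"
    have ts: "0 \<le> ?ts k" for k using Suc.prems by (auto simp: mono_def)
    have "emeasure (clock_space \<phi>) {\<eta>. \<forall>k\<le>Suc m. chain z (ts k) \<eta> = zs k}
        = (\<integral>\<^sup>+\<eta>. (if chain z (ts 0) \<eta> = zs 0 then indicator ?A (after (clock \<eta> (ts 0)) (ts 0) \<eta>) else 0) \<partial>clock_space \<phi>)"
      unfolding nn_integral_indicator[OF sets, symmetric]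
    proof (rule nn_integral_cong_AE)
      show "AE \<eta> in clock_space \<phi>. indicator {\<eta>. \<forall>k\<le>Suc m. chain z (ts k) \<eta> = zs k} \<eta> =
          (if chain z (ts 0) \<eta> = zs 0 then indicator ?A (after (clock \<eta> (ts 0)) (ts 0) \<eta>) else 0)"
        using AE_regular
      proof eventually_elim
        fix \<eta> :: "nat \<Rightarrow> real \<times> ('a \<Rightarrow> 'a)"
        assume r: "regular \<eta>"
        have "chain z (ts (Suc k)) \<eta> = chain (chain z (ts 0) \<eta>) (?ts k) (after (clock \<eta> (ts 0)) (ts 0) \<eta>)" for k
          using chain_after[OF r Suc.prems(1) ts, of z k] by simp
        moreover have "(\<forall>k\<le>Suc m. chain z (ts k) \<eta> = zs k) \<longleftrightarrow>
            chain z (ts 0) \<eta> = zs 0 \<and> (\<forall>k\<le>m. chain z (ts (Suc k)) \<eta> = zs (Suc k))"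
          using All_less_Suc2[of "Suc m" "\<lambda>k. chain z (ts k) \<eta> = zs k"] by (simp add: less_Suc_eq_le)
        ultimately show "indicator {\<eta>. \<forall>k\<le>Suc m. chain z (ts k) \<eta> = zs k} \<eta> =
          (if chain z (ts 0) \<eta> = zs 0 then indicator ?A (after (clock \<eta> (ts 0)) (ts 0) \<eta>) else 0)"
          by (auto simp: indicator_def)
      qed
    qed
    also have "\<dots> = ennreal (mexp (chain_rate \<phi>) (ts 0) z (zs 0)) * (\<integral>\<^sup>+\<eta>. indicator ?A \<eta> \<partial>clock_space \<phi>)"
      using Suc.prems by (intro chain_markov borel_measurable_indicator sets)
    also have "(\<integral>\<^sup>+\<eta>. indicator ?A \<eta> \<partial>clock_space \<phi>) = emeasure (clock_space \<phi>) ?A"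
      by (rule nn_integral_indicator[OF sets])
    also have "\<dots> = ennreal (mexp (chain_rate \<phi>) (?ts 0) (zs 0) (?zs 0) *
      (\<Prod>k<m. mexp (chain_rate \<phi>) (?ts (Suc k) - ?ts k) (?zs k) (?zs (Suc k))))"
      using Suc.prems by (intro Suc.IH) (auto simp: mono_def)
    finally show ?case
      using Suc.prems mexp_chain_rate_nonneg[of "ts 0" \<phi>]
      by (simp add: ennreal_mult' prod.lessThan_Suc_shift del: prod.lessThan_Suc)
  }
qed

subsection \<open>Finite-dimensional distributions\<close>

definition has_fdd :: "('s::finite \<Rightarrow> 's \<Rightarrow> real) \<Rightarrow> 's \<Rightarrow> 'w measure \<Rightarrow> (real \<Rightarrow> 'w \<Rightarrow> 's) \<Rightarrow> bool" where
  "has_fdd q z M Z \<longleftrightarrow>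
     (\<forall>(m::nat) (ts::nat \<Rightarrow> real) (zs::nat \<Rightarrow> 's). 0 \<le> ts 0 \<and> mono ts \<longrightarrow>
        measure M {\<omega>\<in>space M. \<forall>k\<le>m. Z (ts k) \<omega> = zs k} =
          transition q (ts 0) z (zs 0) *
          (\<Prod>k<m. transition q (ts (Suc k) - ts k) (zs k) (zs (Suc k))))"

section \<open>Finite-dimensional distributions of the walk\<close>

lemma step_prob_derangement:
  fixes r k :: "'n::finite"
  assumes n: "CARD('n) \<ge> 2"
  shows "step_prob (pmf_of_set {f. \<forall>r. f r \<noteq> r}) r k = (if k = r then 0 else 1 / (real CARD('n) - 1))"
proof -
  let ?S = "{f :: 'n \<Rightarrow> 'n. \<forall>r. f r \<noteq> r}"
  have S: "?S = PiE UNIV (\<lambda>r. UNIV - {r})" by (auto simp: PiE_UNIV_domain)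
  have card: "card ?S = (\<Prod>r\<in>(UNIV :: 'n set). CARD('n) - 1)"
    unfolding S by (subst card_PiE) (simp_all add: card_Diff_singleton)
  then have "card ?S \<noteq> 0" using n by simp
  then have ne: "?S \<noteq> {}" by (metis card.empty)
  have prob: "step_prob (pmf_of_set ?S) r k = real (card (?S \<inter> {g. g r = k})) / real (card ?S)"
    unfolding step_prob_def by (rule measure_pmf_of_set[OF ne]) simp
  show ?thesis
  proof (cases "k = r")
    case True
    then have "?S \<inter> {g. g r = k} = {}" by auto
    with True prob show ?thesis by simp
  next
    case False
    \<comment> \<open>Once the value at \<open>r\<close> is prescribed, \<open>n - 1\<close> choices
      remain at each of the \<open>n - 1\<close> other points.\<close>
    have "?S \<inter> {g. g r = k} = PiE UNIV (\<lambda>s. if s = r then {k} else UNIV - {s})"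
      using False by (auto simp: PiE_UNIV_domain split: if_splits)
    then have "card (?S \<inter> {g. g r = k}) = (\<Prod>s\<in>(UNIV :: 'n set). if s = r then 1 else CARD('n) - 1)"
      by (simp add: card_PiE if_distrib card_Diff_singleton cong: if_cong)
    also have "\<dots> = (\<Prod>s\<in>UNIV - {r}. CARD('n) - 1)"
      by (subst prod.remove[of _ r]) (auto intro!: prod.cong)
    finally have 1: "card (?S \<inter> {g. g r = k}) = (CARD('n) - 1) ^ (CARD('n) - 1)"
      by (simp add: card_Diff_singleton)
    have 2: "card ?S = (CARD('n) - 1) * (CARD('n) - 1) ^ (CARD('n) - 1)"
      unfolding card using n by (cases "CARD('n)") simp_all
    show ?thesis using False n unfolding prob 1 2 by simp
  qed
qed

text \<open>The two descriptions of a jump agree: \<open>walk_rate\<close> without the choice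
  \<open>k = a i\<close> has total rate 1 per coordinate, the rate at which the unit clock applies a
  fixed-point-free map. The coordinates then separate by \<open>mexp_prod\<close>.\<close>

lemma walk_rate_factor:
  fixes a :: "'d::finite \<Rightarrow> 'n::finite"
  assumes n: "CARD('n) \<ge> 2"
  defines "G \<equiv> chain_rate (pmf_of_set {f :: 'n \<Rightarrow> 'n. \<forall>r. f r \<noteq> r})"
  shows "transition walk_rate t a b = (\<Prod>i\<in>UNIV. mexp G t (a i) (b i))"
  unfolding transition_eq_mexp
proof (rule mexp_prod)
  fix a :: "'d \<Rightarrow> 'n" and f :: "('d \<Rightarrow> 'n) \<Rightarrow> real"
  let ?m = "real CARD('n) - 1"
  have "(\<Sum>k\<in>UNIV. (f (a(i := k)) - f a) / ?m) = (\<Sum>k\<in>UNIV. G (a i) k * f (a(i := k)))" for i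
  proof -
    have "(\<Sum>k\<in>UNIV. (f (a(i := k)) - f a) / ?m) = (\<Sum>k\<in>UNIV - {a i}. (f (a(i := k)) - f a) / ?m)"
      by (subst sum.remove[of _ "a i"]) simp_all
    also have "\<dots> = (\<Sum>k\<in>UNIV - {a i}. f (a(i := k)) / ?m) - f a"
      using n by (simp add: diff_divide_distrib sum_subtractf card_Diff_singleton)
    also have "\<dots> = (\<Sum>k\<in>UNIV. G (a i) k * f (a(i := k)))"
      by (subst (2) sum.remove[of _ "a i"])
        (auto simp: G_def chain_rate_def step_prob_derangement[OF n] intro!: sum.cong)
    finally show ?thesis .
  qed
  then show "(\<Sum>c\<in>UNIV. generator walk_rate a c * f c) = (\<Sum>i\<in>UNIV. \<Sum>k\<in>UNIV. G (a i) k * f (a(i := k)))"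
    by (simp add: generator_apply walk_rate_apply)
qed

lemma walk_space_eq: "walk_space = PiM UNIV (\<lambda>_. clock_space (pmf_of_set {f. \<forall>r. f r \<noteq> r}))"
  by (simp add: walk_space_def clock_space_def clock_step_def)

lemma prob_space_walk_space: "prob_space walk_space"
  unfolding walk_space_eq by (intro prob_space_PiM prob_space_clock_space)

lemma space_walk_space: "space walk_space = UNIV"
  by (simp add: walk_space_eq space_PiM space_clock_space PiE_UNIV_domain)

lemma walk_eq_chain: "walk x t \<omega> i = chain (x i) t (\<omega> i)"
  by (simp add: walk_def chain_def)

lemma walk_measurable:
  fixes x :: "'d::finite \<Rightarrow> 'n::finite"
  shows "walk x t \<in> measurable walk_space (count_space UNIV)"
proof -
  have "{\<omega> \<in> space walk_space. \<forall>i. chain (x i) t (\<omega> i) = z i} \<in> sets walk_space" for z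
    unfolding walk_space_eq by measurable
  then have "walk x t -` {z} \<inter> space walk_space \<in> sets walk_space" for z
    by (rule back_subst[of "\<lambda>A. A \<in> _"]) (auto simp: fun_eq_iff walk_eq_chain)
  then show ?thesis
    by (subst measurable_count_space_eq2) auto
qed

lemma walk_has_fdd:
  fixes x :: "'d::finite \<Rightarrow> 'n::finite"
  assumes n: "CARD('n) \<ge> 2"
  shows "has_fdd walk_rate x walk_space (walk x)"
  unfolding has_fdd_def
proof (intro allI impI)
  fix m :: nat and ts :: "nat \<Rightarrow> real" and zs :: "nat \<Rightarrow> 'd \<Rightarrow> 'n"
  assume ts: "0 \<le> ts 0 \<and> mono ts"
  let ?\<phi> = "pmf_of_set {f :: 'n \<Rightarrow> 'n. \<forall>r. f r \<noteq> r}"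
  let ?T = "mexp (chain_rate ?\<phi>)"
  let ?A = "\<lambda>i. {\<eta>. \<forall>k\<le>m. chain (x i) (ts k) \<eta> = zs k i}"
  interpret product_sigma_finite "\<lambda>_::'d. clock_space ?\<phi>"
    by (simp add: product_sigma_finite_def prob_space_clock_space prob_space_imp_sigma_finite)
  interpret W: prob_space walk_space by (rule prob_space_walk_space)
  have A: "?A i \<in> sets (clock_space ?\<phi>)" for i
  proof -
    have "{\<eta> \<in> space (clock_space ?\<phi>). \<forall>k\<le>m. chain (x i) (ts k) \<eta> = zs k i} \<in> sets (clock_space ?\<phi>)"
      by measurable
    then show ?thesis by (simp add: space_clock_space)
  qed
  have nn: "0 \<le> ?T (ts 0) a b" "0 \<le> ?T (ts (Suc k) - ts k) a b" for a b k
    using ts by (auto intro!: mexp_chain_rate_nonneg simp: mono_def)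
  have "{\<omega>\<in>space walk_space. \<forall>k\<le>m. walk x (ts k) \<omega> = zs k} = PiE UNIV ?A"
    by (auto simp: space_walk_space PiE_UNIV_domain fun_eq_iff walk_eq_chain)
  then have "emeasure walk_space {\<omega>\<in>space walk_space. \<forall>k\<le>m. walk x (ts k) \<omega> = zs k}
      = (\<Prod>i\<in>UNIV. emeasure (clock_space ?\<phi>) (?A i))"
    unfolding walk_space_eq by (simp add: emeasure_PiM[OF _ A])
  also have "\<dots> = ennreal (\<Prod>i\<in>UNIV. ?T (ts 0) (x i) (zs 0 i) * (\<Prod>k<m. ?T (ts (Suc k) - ts k) (zs k i) (zs (Suc k) i)))"
    using ts nn by (simp add: chain_fdd prod_ennreal prod_nonneg)
  also have "(\<Prod>i\<in>UNIV. ?T (ts 0) (x i) (zs 0 i) * (\<Prod>k<m. ?T (ts (Suc k) - ts k) (zs k i) (zs (Suc k) i)))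
      = transition walk_rate (ts 0) x (zs 0) * (\<Prod>k<m. transition walk_rate (ts (Suc k) - ts k) (zs k) (zs (Suc k)))"
    unfolding walk_rate_factor[OF n] prod.distrib by (subst (2) prod.swap) simp
  finally show "measure walk_space {\<omega>\<in>space walk_space. \<forall>k\<le>m. walk x (ts k) \<omega> = zs k}
      = transition walk_rate (ts 0) x (zs 0) * (\<Prod>k<m. transition walk_rate (ts (Suc k) - ts k) (zs k) (zs (Suc k)))"
    unfolding walk_rate_factor[OF n] using nn
    by (simp add: W.emeasure_eq_measure prod_nonneg)
qed

subsection \<open>Path laws\<close>

lemma finite_real_enum:
  assumes "finite (J :: real set)" "J \<noteq> {}"
  shows "\<exists>(m::nat) ts. mono ts \<and> ts ` {..m} = J \<and> (\<forall>k. ts k \<in> J)"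
proof -
  define xs where "xs = sorted_list_of_set J"
  have xs: "set xs = J" "sorted xs" "xs \<noteq> []"
    using assms by (auto simp: xs_def)
  define m where "m = length xs - 1"
  \<comment> \<open>The sequence stays at its last value beyond \<open>m\<close>, since
    \<open>has_fdd\<close> asks for monotonicity along all of \<open>nat\<close>.\<close>
  define ts where "ts k = xs ! min k m" for k
  have len: "min k m < length xs" for k
    using xs(3) by (cases xs) (auto simp: m_def)
  have "mono ts"
    unfolding mono_def ts_def using len by (intro allI impI sorted_nth_mono[OF xs(2)]) auto
  moreover have J: "ts k \<in> J" for k
    using nth_mem[OF len[of k]] xs(1) by (simp add: ts_def)
  moreover have "J \<subseteq> ts ` {..m}"
  proof
    fix x assume "x \<in> J"
    then obtain k where k: "k < length xs" "xs ! k = x" using xs(1) by (metis in_set_conv_nth)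
    then have "k \<le> m" by (simp add: m_def)
    then show "x \<in> ts ` {..m}" using k by (auto simp: ts_def intro!: image_eqI[of _ _ k])
  qed
  ultimately show ?thesis by (intro exI[of _ m] exI[of _ ts]) auto
qed

lemma path_measurable:
  assumes "\<And>t. 0 \<le> t \<Longrightarrow> Z t \<in> measurable M (count_space UNIV)"
  shows "(\<lambda>\<omega>. \<lambda>t\<in>{0..}. Z t \<omega>) \<in> measurable M (PiM {0..} (\<lambda>_. count_space UNIV))"
  by (rule measurable_restrict) (use assms in auto)

lemma event_in_sets:
  assumes "\<And>t. 0 \<le> t \<Longrightarrow> Z t \<in> measurable M (count_space UNIV)" "finite J" "J \<subseteq> {0..}"
  shows "{\<omega>\<in>space M. \<forall>u\<in>J. Z u \<omega> \<in> E u} \<in> sets M"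
proof (rule sets.sets_Collect_finite_All[OF _ assms(2)])
  fix u assume "u \<in> J"
  then have "Z u -` E u \<inter> space M \<in> sets M" using assms by (intro measurable_sets) auto
  then show "{\<omega>\<in>space M. Z u \<omega> \<in> E u} \<in> sets M" by (simp add: vimage_def Int_def conj_commute)
qed

lemma fdd_event_sets:
  fixes m :: nat
  assumes Z: "\<And>t. 0 \<le> t \<Longrightarrow> Z t \<in> measurable M (count_space UNIV)" and "\<And>k. 0 \<le> ts k"
  shows "{\<omega>\<in>space M. \<forall>k\<le>m. Z (ts k) \<omega> = zs k} \<in> sets M"
proof -
  have "{\<omega>\<in>space M. \<forall>k\<in>{..m}. Z (ts k) \<omega> = zs k} \<in> sets M"
  proof (rule sets.sets_Collect_finite_All)
    fix k
    have [measurable]: "Z (ts k) \<in> measurable M (count_space UNIV)" using assms by auto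
    show "{\<omega>\<in>space M. Z (ts k) \<omega> = zs k} \<in> sets M" by measurable
  qed simp
  then show ?thesis by (simp only: Ball_def atMost_iff)
qed

lemma path_law_fdd:
  fixes m :: nat
  assumes Z: "\<And>t. 0 \<le> t \<Longrightarrow> Z t \<in> measurable M (count_space UNIV)" and ts: "\<And>k. 0 \<le> ts k"
  shows "measure M {\<omega>\<in>space M. \<forall>k\<le>m. Z (ts k) \<omega> = zs k}
    = measure (path_law M Z) {p\<in>space (PiM {0..} (\<lambda>_. count_space UNIV)). \<forall>k\<le>m. p (ts k) = zs k}"
proof -
  let ?P = "PiM {0..} (\<lambda>_::real. count_space UNIV)"
  have "(\<lambda>p. p t) \<in> measurable ?P (count_space UNIV)" if "0 \<le> t" for t
    using that by (intro measurable_component_singleton) auto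
  then have "{p\<in>space ?P. \<forall>k\<le>m. p (ts k) = zs k} \<in> sets ?P"
    using ts by (intro fdd_event_sets[of "\<lambda>t p. p t"])
  then have "measure (path_law M Z) {p\<in>space ?P. \<forall>k\<le>m. p (ts k) = zs k}
    = measure M ((\<lambda>\<omega>. \<lambda>t\<in>{0..}. Z t \<omega>) -` {p\<in>space ?P. \<forall>k\<le>m. p (ts k) = zs k} \<inter> space M)"
    unfolding path_law_def by (intro measure_distr path_measurable Z)
  also have "(\<lambda>\<omega>. \<lambda>t\<in>{0..}. Z t \<omega>) -` {p\<in>space ?P. \<forall>k\<le>m. p (ts k) = zs k} \<inter> space M
      = {\<omega>\<in>space M. \<forall>k\<le>m. Z (ts k) \<omega> = zs k}"
    using ts by (auto simp: space_PiM)
  finally show ?thesis by simp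
qed

lemma has_fdd_path_law_cong:
  assumes Z1: "\<And>t. 0 \<le> t \<Longrightarrow> Z1 t \<in> measurable M1 (count_space UNIV)"
    and Z2: "\<And>t. 0 \<le> t \<Longrightarrow> Z2 t \<in> measurable M2 (count_space UNIV)"
    and eq: "path_law M1 Z1 = path_law M2 Z2" and fdd: "has_fdd q z M2 Z2"
  shows "has_fdd q z M1 Z1"
  unfolding has_fdd_def
proof (intro allI impI)
  fix m :: nat and ts :: "nat \<Rightarrow> real" and zs
  assume ts: "0 \<le> ts 0 \<and> mono ts"
  then have nn: "0 \<le> ts k" for k using monoD[of ts 0 k] by auto
  show "measure M1 {\<omega>\<in>space M1. \<forall>k\<le>m. Z1 (ts k) \<omega> = zs k} =
      transition q (ts 0) z (zs 0) * (\<Prod>k<m. transition q (ts (Suc k) - ts k) (zs k) (zs (Suc k)))"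
    using path_law_fdd[where Z = Z1 and M = M1 and ts = ts and m = m and zs = zs, OF Z1 nn]
      path_law_fdd[where Z = Z2 and M = M2 and ts = ts and m = m and zs = zs, OF Z2 nn] eq
      fdd[unfolded has_fdd_def, rule_format, OF ts, of m zs] by simp
qed

lemma measure_split:
  fixes Z :: "'w \<Rightarrow> 's::finite"
  assumes "finite_measure M" "Z \<in> measurable M (count_space UNIV)" "A \<in> sets M"
  shows "measure M A = (\<Sum>c\<in>UNIV. measure M (A \<inter> {\<omega>\<in>space M. Z \<omega> = c}))"
proof -
  interpret finite_measure M by fact
  note [measurable] = assms(2,3)
  have "A = (\<Union>c\<in>UNIV. A \<inter> {\<omega>\<in>space M. Z \<omega> = c})"
    using sets.sets_into_space[OF assms(3)] by auto
  also have "measure M \<dots> = (\<Sum>c\<in>UNIV. measure M (A \<inter> {\<omega>\<in>space M. Z \<omega> = c}))"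
    by (rule finite_measure_finite_Union) (auto simp: disjoint_family_on_def)
  finally show ?thesis .
qed

lemma has_fdd_finite_set:
  assumes "has_fdd q z M1 Z1" "has_fdd q z M2 Z2" "prob_space M1" "prob_space M2"
    "finite J" "J \<subseteq> {0..}"
  shows "measure M1 {\<omega>\<in>space M1. \<forall>u\<in>J. Z1 u \<omega> = f u} = measure M2 {\<omega>\<in>space M2. \<forall>u\<in>J. Z2 u \<omega> = f u}"
proof (cases "J = {}")
  case True
  then show ?thesis using assms(3,4) by (simp add: prob_space.prob_space)
next
  case False
  from finite_real_enum[OF assms(5) this] obtain m :: nat and ts
    where ts: "mono ts" "ts ` {..m} = J" "\<forall>k. ts k \<in> J" by (elim exE conjE)
  have "0 \<le> ts 0 \<and> mono ts" using ts assms(6) by auto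
  note val = assms(1,2)[unfolded has_fdd_def, rule_format, OF this, of m "\<lambda>k. f (ts k)"]
  have "{\<omega>\<in>space M1. \<forall>u\<in>J. Z1 u \<omega> = f u} = {\<omega>\<in>space M1. \<forall>k\<le>m. Z1 (ts k) \<omega> = f (ts k)}"
    "{\<omega>\<in>space M2. \<forall>u\<in>J. Z2 u \<omega> = f u} = {\<omega>\<in>space M2. \<forall>k\<le>m. Z2 (ts k) \<omega> = f (ts k)}"
    unfolding ts(2)[symmetric] by auto
  then show ?thesis by (simp only: val)
qed

lemma path_law_emb:
  fixes Z :: "real \<Rightarrow> 'w \<Rightarrow> 's::finite"
  assumes "prob_space M" and Z: "\<And>t. 0 \<le> t \<Longrightarrow> Z t \<in> measurable M (count_space UNIV)"
    and J: "finite J" "J \<subseteq> {0..}"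
  shows "emeasure (path_law M Z) (prod_emb {0..} (\<lambda>_. count_space UNIV) J (Pi\<^sub>E J A))
      = ennreal (\<Sum>f\<in>Pi\<^sub>E J A. measure M {\<omega>\<in>space M. \<forall>u\<in>J. Z u \<omega> = f u})"
proof -
  interpret prob_space M by fact
  have J': "\<And>u. u \<in> J \<Longrightarrow> 0 \<le> u" using J by auto
  have "emeasure (path_law M Z) (prod_emb {0..} (\<lambda>_. count_space UNIV) J (Pi\<^sub>E J A))
      = emeasure M ((\<lambda>\<omega>. \<lambda>t\<in>{0..}. Z t \<omega>) -` prod_emb {0..} (\<lambda>_. count_space UNIV) J (Pi\<^sub>E J A) \<inter> space M)"
    unfolding path_law_def using J by (intro emeasure_distr path_measurable Z sets_PiM_I) auto
  also have "(\<lambda>\<omega>. \<lambda>t\<in>{0..}. Z t \<omega>) -` prod_emb {0..} (\<lambda>_. count_space UNIV) J (Pi\<^sub>E J A) \<inter> space M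
      = (\<Union>f\<in>Pi\<^sub>E J A. {\<omega>\<in>space M. \<forall>u\<in>J. Z u \<omega> = f u})" (is "?L = ?R")
  proof (intro set_eqI iffI)
    fix \<omega> assume "\<omega> \<in> ?L"
    then have "\<omega> \<in> space M" "(\<lambda>u\<in>J. Z u \<omega>) \<in> Pi\<^sub>E J A"
      using J' by (auto simp: prod_emb_iff PiE_iff)
    then show "\<omega> \<in> ?R" by (intro UN_I[of "\<lambda>u\<in>J. Z u \<omega>"]) auto
  next
    fix \<omega> assume "\<omega> \<in> ?R"
    then show "\<omega> \<in> ?L" using J by (force simp: prod_emb_iff PiE_iff)
  qed
  also have "emeasure M \<dots> = ennreal (\<Sum>f\<in>Pi\<^sub>E J A. measure M {\<omega>\<in>space M. \<forall>u\<in>J. Z u \<omega> = f u})"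
    unfolding emeasure_eq_measure
  proof (subst finite_measure_finite_Union)
    show "finite (Pi\<^sub>E J A)" using J by (intro finite_PiE) auto
    show "(\<lambda>f. {\<omega>\<in>space M. \<forall>u\<in>J. Z u \<omega> = f u}) ` Pi\<^sub>E J A \<subseteq> sets M"
      using event_in_sets[where Z = Z and M = M and E = "\<lambda>u. {f u}" for f, OF Z J] by auto
    show "disjoint_family_on (\<lambda>f. {\<omega>\<in>space M. \<forall>u\<in>J. Z u \<omega> = f u}) (Pi\<^sub>E J A)"
      unfolding disjoint_family_on_def
    proof (intro ballI impI)
      fix f g assume "f \<in> Pi\<^sub>E J A" "g \<in> Pi\<^sub>E J A" "f \<noteq> g"
      then obtain u where "u \<in> J" "f u \<noteq> g u" by (metis PiE_ext)
      then show "{\<omega>\<in>space M. \<forall>u\<in>J. Z u \<omega> = f u} \<inter> {\<omega>\<in>space M. \<forall>u\<in>J. Z u \<omega> = g u} = {}" by auto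
    qed
  qed simp
  finally show ?thesis .
qed

text \<open>Cylinders over finite sets of times determine a law on path space. After splitting a
  cylinder into single states, its probability is given by the formula in
  \<open>has_fdd\<close>.\<close>

lemma path_law_eqI:
  fixes Z1 :: "real \<Rightarrow> 'w \<Rightarrow> 's::finite" and Z2 :: "real \<Rightarrow> 'v \<Rightarrow> 's"
  assumes Z1: "\<And>t. 0 \<le> t \<Longrightarrow> Z1 t \<in> measurable M1 (count_space UNIV)"
    and Z2: "\<And>t. 0 \<le> t \<Longrightarrow> Z2 t \<in> measurable M2 (count_space UNIV)"
    and fdd: "has_fdd q z M1 Z1" "has_fdd q z M2 Z2" and p: "prob_space M1" "prob_space M2"
  shows "path_law M1 Z1 = path_law M2 Z2"
proof (rule measure_eqI_PiM_infinite)
  let ?P = "PiM {0..} (\<lambda>_::real. count_space (UNIV :: 's set))"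
  show "sets (path_law M1 Z1) = sets ?P" "sets (path_law M2 Z2) = sets ?P"
    by (simp_all add: path_law_def)
  show "finite_measure (path_law M1 Z1)"
    unfolding path_law_def
    by (intro prob_space.finite_measure prob_space.prob_space_distr p path_measurable Z1)
  fix A and J :: "real set" assume J: "finite J" "J \<subseteq> {0..}"
  show "emeasure (path_law M1 Z1) (prod_emb {0..} (\<lambda>_. count_space UNIV) J (Pi\<^sub>E J A))
      = emeasure (path_law M2 Z2) (prod_emb {0..} (\<lambda>_. count_space UNIV) J (Pi\<^sub>E J A))"
    using path_law_emb[where Z = Z1 and M = M1 and A = A, OF p(1) Z1 J]
      path_law_emb[where Z = Z2 and M = M2 and A = A, OF p(2) Z2 J]
    by (simp only: has_fdd_finite_set[OF fdd p J])
qed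

text \<open>Trades the law on path space for finite-dimensional distributions, in which the
  transition function is visible.\<close>

lemma copy_of_walk_iff:
  fixes x :: "'d::finite \<Rightarrow> 'n::finite"
  assumes n: "CARD('n) \<ge> 2" and p: "prob_space M"
  shows "copy_of_walk x M X \<longleftrightarrow>
    (\<forall>t\<ge>0. X t \<in> measurable M (count_space UNIV)) \<and> cadlag_paths M X \<and> has_fdd walk_rate x M X"
  unfolding copy_of_walk_def
  using path_law_eqI[of X M "walk x" walk_space walk_rate x] has_fdd_path_law_cong[of X M "walk x" walk_space walk_rate x]
    walk_measurable[of x] walk_has_fdd[OF n, of x] p prob_space_walk_space
  by blast

subsection \<open>The Markov property of jump processes\<close>

definition natural_filtration :: "'w measure \<Rightarrow> (real \<Rightarrow> 'w \<Rightarrow> 's) \<Rightarrow> real \<Rightarrow> 'w measure" where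
  "natural_filtration M Z s = sigma (space M) {{\<omega>\<in>space M. Z u \<omega> = z} | u z. 0 \<le> u \<and> u \<le> s}"

lemma space_natural_filtration: "space (natural_filtration M Z s) = space M"
  unfolding natural_filtration_def by (rule space_measure_of) auto

lemma sets_natural_filtration:
  "sets (natural_filtration M Z s) = sigma_sets (space M) {{\<omega>\<in>space M. Z u \<omega> = z} | u z. 0 \<le> u \<and> u \<le> s}"
  unfolding natural_filtration_def by (rule sets_measure_of) auto

lemma natural_filtration_basic:
  "0 \<le> u \<Longrightarrow> u \<le> s \<Longrightarrow> {\<omega>\<in>space M. Z u \<omega> = z} \<in> sets (natural_filtration M Z s)"
  unfolding sets_natural_filtration by (rule sigma_sets.Basic) blast

lemma natural_filtration_mono:
  "s \<le> t \<Longrightarrow> sets (natural_filtration M Z s) \<subseteq> sets (natural_filtration M Z t)"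
  unfolding sets_natural_filtration by (rule sigma_sets_mono') force

lemma natural_filtration_subalgebra:
  assumes Z: "\<And>t. 0 \<le> t \<Longrightarrow> Z t \<in> measurable M (count_space UNIV)"
  shows "subalgebra M (natural_filtration M Z s)"
proof -
  have "{\<omega>\<in>space M. Z u \<omega> = z} \<in> sets M" if "0 \<le> u" for u z
    using event_in_sets[where Z = Z and M = M and J = "{u}" and E = "\<lambda>_. {z}", OF Z] that by simp
  then have "sigma_sets (space M) {{\<omega>\<in>space M. Z u \<omega> = z} | u z. 0 \<le> u \<and> u \<le> s} \<subseteq> sets M"
    by (intro sets.sigma_sets_subset) auto
  then show ?thesis
    by (simp add: subalgebra_def space_natural_filtration sets_natural_filtration)
qed

lemma natural_filtration_measurable:
  fixes Z :: "real \<Rightarrow> 'w \<Rightarrow> 's::finite"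
  assumes "0 \<le> u" "u \<le> s"
  shows "Z u \<in> measurable (natural_filtration M Z s) (count_space UNIV)"
proof -
  have "Z u -` {z} \<inter> space (natural_filtration M Z s) \<in> sets (natural_filtration M Z s)" for z
    using natural_filtration_basic[OF assms, of M Z z]
    by (simp add: space_natural_filtration vimage_def Int_def conj_commute)
  then show ?thesis by (subst measurable_count_space_eq2) auto
qed

lemma all_le_Suc: "(\<forall>k\<le>Suc m. P k) \<longleftrightarrow> (\<forall>k\<le>m. P k) \<and> P (Suc m)"
  by (auto simp: le_Suc_eq)

lemma markov_cylinder:
  fixes Z :: "real \<Rightarrow> 'w \<Rightarrow> 's::finite"
  assumes fdd: "has_fdd q z0 M Z" and J: "finite J" "J \<subseteq> {0..s}" and st: "0 \<le> s" "s \<le> t"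
  shows "measure M ({\<omega>\<in>space M. \<forall>u\<in>J. Z u \<omega> = f u} \<inter> {\<omega>\<in>space M. Z s \<omega> = z} \<inter> {\<omega>\<in>space M. Z t \<omega> = z'})
      = measure M ({\<omega>\<in>space M. \<forall>u\<in>J. Z u \<omega> = f u} \<inter> {\<omega>\<in>space M. Z s \<omega> = z}) * transition q (t - s) z z'"
proof (cases "s \<in> J \<and> f s \<noteq> z")
  case True
  then have "{\<omega>\<in>space M. \<forall>u\<in>J. Z u \<omega> = f u} \<inter> {\<omega>\<in>space M. Z s \<omega> = z} = {}" by auto
  then show ?thesis by simp
next
  case False
  \<comment> \<open>Overriding \<open>f\<close> at \<open>s\<close> is harmless: either
    \<open>s\<close> is not in \<open>J\<close>, or \<open>f s = z\<close> already.\<close>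
  let ?g = "f(s := z)"
  have "finite (insert s J)" "insert s J \<noteq> {}" using J by auto
  from finite_real_enum[OF this] obtain m :: nat and ts
    where ts: "mono ts" "ts ` {..m} = insert s J" "\<forall>k. ts k \<in> insert s J" by (elim exE conjE)
  have le: "0 \<le> ts k" "ts k \<le> s" for k using ts(3)[rule_format, of k] J st by auto
  have "s \<in> ts ` {..m}" using ts(2) by simp
  then obtain k where "k \<le> m" "ts k = s" by auto
  then have tm: "ts m = s" using monoD[OF ts(1), of k m] le(2)[of m] by simp
  define ts' where "ts' k = (if k \<le> m then ts k else t)" for k
  define zs' where "zs' k = (if k \<le> m then ?g (ts k) else z')" for k
  have A: "{\<omega>\<in>space M. \<forall>u\<in>J. Z u \<omega> = f u} \<inter> {\<omega>\<in>space M. Z s \<omega> = z}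
      = {\<omega>\<in>space M. \<forall>k\<le>m. Z (ts k) \<omega> = ?g (ts k)}"
  proof -
    have "{\<omega>\<in>space M. \<forall>k\<le>m. Z (ts k) \<omega> = ?g (ts k)} = {\<omega>\<in>space M. \<forall>u\<in>ts ` {..m}. Z u \<omega> = ?g u}" by auto
    then show ?thesis unfolding ts(2) using False by auto
  qed
  have B: "{\<omega>\<in>space M. \<forall>u\<in>J. Z u \<omega> = f u} \<inter> {\<omega>\<in>space M. Z s \<omega> = z} \<inter> {\<omega>\<in>space M. Z t \<omega> = z'}
      = {\<omega>\<in>space M. \<forall>k\<le>Suc m. Z (ts' k) \<omega> = zs' k}"
  proof -
    have "(\<forall>k\<le>Suc m. Z (ts' k) \<omega> = zs' k) \<longleftrightarrow> (\<forall>k\<le>m. Z (ts k) \<omega> = ?g (ts k)) \<and> Z t \<omega> = z'" for \<omega>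
      unfolding all_le_Suc by (simp add: ts'_def zs'_def del: fun_upd_apply)
    then show ?thesis unfolding A by blast
  qed
  have "mono ts'" using ts(1) le(2) st by (auto simp: mono_def ts'_def intro: order_trans)
  moreover have "0 \<le> ts' 0" using le st by (simp add: ts'_def)
  ultimately have "0 \<le> ts' 0 \<and> mono ts'" by blast
  from fdd[unfolded has_fdd_def, rule_format, OF this]
  have "measure M {\<omega>\<in>space M. \<forall>k\<le>Suc m. Z (ts' k) \<omega> = zs' k}
      = transition q (ts' 0) z0 (zs' 0) * (\<Prod>k<Suc m. transition q (ts' (Suc k) - ts' k) (zs' k) (zs' (Suc k)))"
    by blast
  also have "\<dots> = transition q (ts 0) z0 (?g (ts 0)) *
      (\<Prod>k<m. transition q (ts (Suc k) - ts k) (?g (ts k)) (?g (ts (Suc k)))) * transition q (t - s) z z'"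
    using tm by (simp add: ts'_def zs'_def)
  also have "transition q (ts 0) z0 (?g (ts 0)) *
      (\<Prod>k<m. transition q (ts (Suc k) - ts k) (?g (ts k)) (?g (ts (Suc k))))
      = measure M {\<omega>\<in>space M. \<forall>k\<le>m. Z (ts k) \<omega> = ?g (ts k)}"
    by (rule fdd[unfolded has_fdd_def, rule_format, symmetric]) (use ts(1) le in blast)
  finally show ?thesis unfolding B unfolding A .
qed

text \<open>The equality extends from cylinders to the generated sigma-algebra by a Dynkin argument.
  In this multiplied-out form the Markov property involves neither conditional expectations nor
  division by a probability that may vanish.\<close>

lemma markov_joint:
  fixes Z :: "real \<Rightarrow> 'w \<Rightarrow> 's::finite"
  assumes p: "prob_space M" and Z: "\<And>t. 0 \<le> t \<Longrightarrow> Z t \<in> measurable M (count_space UNIV)"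
    and fdd: "has_fdd q z0 M Z" and st: "0 \<le> s" "s \<le> t"
    and A: "A \<in> sets (natural_filtration M Z s)"
  shows "measure M (A \<inter> {\<omega>\<in>space M. Z s \<omega> = z} \<inter> {\<omega>\<in>space M. Z t \<omega> = z'})
      = measure M (A \<inter> {\<omega>\<in>space M. Z s \<omega> = z}) * transition q (t - s) z z'"
proof -
  interpret prob_space M by fact
  define cyl where "cyl J f = {\<omega>\<in>space M. \<forall>u\<in>J. Z u \<omega> = f u}" for J f
  \<comment> \<open>The empty set is adjoined for stability under intersection: cylinders that
    disagree at a common time are disjoint.\<close>
  define G where "G = {cyl J f | J f. finite J \<and> J \<subseteq> {0..s}} \<union> {{}}"
  have cylG: "cyl J f \<in> G" if "finite J" "J \<subseteq> {0..s}" for J f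
    using that by (auto simp: G_def)
  have "A \<in> sigma_sets (space M) G"
    using A unfolding sets_natural_filtration
  proof (rule subsetD[OF sigma_sets_mono', rotated])
    show "{{\<omega>\<in>space M. Z u \<omega> = z} | u z. 0 \<le> u \<and> u \<le> s} \<subseteq> G"
    proof clarify
      fix u z assume "0 \<le> u" "u \<le> s"
      then have "cyl {u} (\<lambda>_. z) \<in> G" by (intro cylG) auto
      then show "{\<omega>\<in>space M. Z u \<omega> = z} \<in> G" by (simp add: cyl_def)
    qed
  qed
  have cyl_sets: "cyl J f \<in> sets M" if "finite J" "J \<subseteq> {0..s}" for J f
  proof -
    have "J \<subseteq> {0..}" using that(2) by auto
    from event_in_sets[where Z = Z and M = M and E = "\<lambda>u. {f u}", OF Z that(1) this]
    show ?thesis by (simp add: cyl_def)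
  qed
  have Gsets: "sigma_sets (space M) G \<subseteq> sets M"
    by (intro sets.sigma_sets_subset) (auto simp: G_def cyl_sets)
  have Int: "Int_stable G"
  proof (rule Int_stableI)
    fix a b assume "a \<in> G" "b \<in> G"
    show "a \<inter> b \<in> G"
    proof (cases "a = {} \<or> b = {}")
      case True then show ?thesis by (auto simp: G_def)
    next
      case False
      with \<open>a \<in> G\<close> \<open>b \<in> G\<close> obtain J f J' f' where
        ab: "a = cyl J f" "finite J" "J \<subseteq> {0..s}" "b = cyl J' f'" "finite J'" "J' \<subseteq> {0..s}"
        by (auto simp: G_def)
      show ?thesis
      proof (cases "\<forall>u\<in>J \<inter> J'. f u = f' u")
        case True
        then have "a \<inter> b = cyl (J \<union> J') (\<lambda>u. if u \<in> J then f u else f' u)"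
          unfolding ab cyl_def by auto
        then show ?thesis using cylG ab by auto
      next
        case False
        then have "a \<inter> b = {}" unfolding ab cyl_def by auto
        then show ?thesis by (simp add: G_def)
      qed
    qed
  qed
  let ?B = "{\<omega>\<in>space M. Z s \<omega> = z}" and ?C = "{\<omega>\<in>space M. Z t \<omega> = z'}"
  let ?c = "transition q (t - s) z z'"
  have [measurable]: "?B \<in> sets M" "?C \<in> sets M"
    using event_in_sets[where Z = Z and M = M and J = "{s}" and E = "\<lambda>_. {z}", OF Z]
      event_in_sets[where Z = Z and M = M and J = "{t}" and E = "\<lambda>_. {z'}", OF Z] st by auto
  have cyl_eq: "measure M (cyl J f \<inter> ?B \<inter> ?C) = measure M (cyl J f \<inter> ?B) * ?c" if "finite J" "J \<subseteq> {0..s}" for J f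
    unfolding cyl_def by (rule markov_cylinder[OF fdd that st])
  have "cyl {} f = space M" for f by (simp add: cyl_def)
  then have whole: "measure M (?B \<inter> ?C) = measure M ?B * ?c"
    using cyl_eq[of "{}"] by (simp add: Int_absorb1 Int_assoc[symmetric])
  have "G \<subseteq> Pow (space M)" by (auto simp: G_def cyl_def)
  from Int this \<open>A \<in> sigma_sets (space M) G\<close> show ?thesis
  proof (induction rule: sigma_sets_induct_disjoint)
    case (basic A)
    then show ?case using cyl_eq by (auto simp: G_def)
  next
    case empty
    then show ?case by simp
  next
    case (compl A)
    then have [measurable]: "A \<in> sets M" using Gsets by blast
    have "(space M - A) \<inter> ?B = ?B - (A \<inter> ?B)" "(space M - A) \<inter> ?B \<inter> ?C = (?B \<inter> ?C) - (A \<inter> ?B \<inter> ?C)" by auto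
    moreover have "measure M (?B - (A \<inter> ?B)) = measure M ?B - measure M (A \<inter> ?B)"
      by (rule finite_measure_Diff) auto
    moreover have "measure M ((?B \<inter> ?C) - (A \<inter> ?B \<inter> ?C)) = measure M (?B \<inter> ?C) - measure M (A \<inter> ?B \<inter> ?C)"
      by (rule finite_measure_Diff) auto
    ultimately show ?case by (simp only: compl(2) whole left_diff_distrib)
  next
    case (union A)
    then have [measurable]: "A i \<in> sets M" for i using Gsets by blast
    have "(\<lambda>i. measure M (A i \<inter> ?B)) sums measure M (\<Union>i. A i \<inter> ?B)"
      using union(1) by (intro finite_measure_UNION) (auto simp: disjoint_family_on_def)
    from sums_mult2[OF this, of ?c]
    have 1: "(\<lambda>i. measure M (A i \<inter> ?B \<inter> ?C)) sums (measure M (\<Union>i. A i \<inter> ?B) * ?c)"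
      by (simp add: union(3))
    have 2: "(\<lambda>i. measure M (A i \<inter> ?B \<inter> ?C)) sums measure M (\<Union>i. A i \<inter> ?B \<inter> ?C)"
      using union(1) by (intro finite_measure_UNION) (auto simp: disjoint_family_on_def)
    have "(\<Union>i. A i) \<inter> ?B = (\<Union>i. A i \<inter> ?B)" "(\<Union>i. A i) \<inter> ?B \<inter> ?C = (\<Union>i. A i \<inter> ?B \<inter> ?C)" by auto
    then show ?case using sums_unique2[OF 1 2] by simp
  qed
qed

lemma cond_exp_transition:
  fixes X :: "real \<Rightarrow> 'w \<Rightarrow> 's::finite"
  assumes p: "prob_space M" and sub: "subalgebra M H"
    and Xs: "X s \<in> measurable H (count_space UNIV)" and Xt: "X t \<in> measurable M (count_space UNIV)"
    and eq: "\<And>A a. A \<in> sets H \<Longrightarrow>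
      measure M (A \<inter> {\<omega>\<in>space M. X s \<omega> = a} \<inter> {\<omega>\<in>space M. X t \<omega> = z})
        = measure M (A \<inter> {\<omega>\<in>space M. X s \<omega> = a}) * g a"
  shows "AE \<omega> in M. real_cond_exp M H (indicator {\<omega>'\<in>space M. X t \<omega>' = z}) \<omega> = g (X s \<omega>)"
proof -
  interpret prob_space M by fact
  interpret sigma_finite_subalgebra M H
    by (rule finite_measure_subalgebra_is_sigma_finite)
      (simp add: finite_measure_subalgebra_def finite_measure_subalgebra_axioms_def sub finite_measure_axioms)
  let ?C = "{\<omega>\<in>space M. X t \<omega> = z}"
  have XsM [measurable]: "X s \<in> measurable M (count_space UNIV)"
    by (rule measurable_from_subalg[OF sub Xs])
  note [measurable] = Xt
  have gm: "(\<lambda>\<omega>. g (X s \<omega>)) \<in> borel_measurable H"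
    by (rule measurable_compose[OF Xs]) simp
  have gi: "integrable M (\<lambda>\<omega>. g (X s \<omega>))"
  proof (rule integrable_const_bound)
    show "AE \<omega> in M. norm (g (X s \<omega>)) \<le> (\<Sum>a\<in>UNIV. \<bar>g a\<bar>)"
      by (intro AE_I2) (auto intro!: member_le_sum)
    show "(\<lambda>\<omega>. g (X s \<omega>)) \<in> borel_measurable M" by (rule measurable_from_subalg[OF sub gm])
  qed
  show ?thesis
  proof (rule real_cond_exp_charact[OF _ _ gi gm])
    fix A assume A: "A \<in> sets H"
    then have AM [measurable]: "A \<in> sets M" using sub by (auto simp: subalgebra_def)
    have "(LINT \<omega>:A|M. indicator ?C \<omega>) = measure M (A \<inter> ?C)"
      by (simp add: set_lebesgue_integral_def indicator_inter_arith[symmetric])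
    also have "\<dots> = (\<Sum>a\<in>UNIV. measure M (A \<inter> ?C \<inter> {\<omega>\<in>space M. X s \<omega> = a}))"
      by (rule measure_split) (auto intro: finite_measure_axioms)
    also have "\<dots> = (\<Sum>a\<in>UNIV. measure M (A \<inter> {\<omega>\<in>space M. X s \<omega> = a}) * g a)"
      by (intro sum.cong refl) (simp add: eq[OF A, symmetric] Int_ac)
    also have "\<dots> = (\<Sum>a\<in>UNIV. (LINT \<omega>|M. indicator (A \<inter> {\<omega>\<in>space M. X s \<omega> = a}) \<omega> * g a))"
      by (simp add: sets.Int_space_eq2)
    also have "\<dots> = (LINT \<omega>|M. (\<Sum>a\<in>UNIV. indicator (A \<inter> {\<omega>\<in>space M. X s \<omega> = a}) \<omega> * g a))"
      by (rule Bochner_Integration.integral_sum[symmetric]) (intro integrable_mult_left integrable_real_indicator, auto simp: emeasure_eq_measure)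
    also have "\<dots> = (LINT \<omega>:A|M. g (X s \<omega>))"
      unfolding set_lebesgue_integral_def
      by (intro Bochner_Integration.integral_cong refl)
        (simp add: indicator_def if_distrib if_distribR cong: if_cong)
    finally show "(LINT \<omega>:A|M. indicator ?C \<omega>) = (LINT \<omega>:A|M. g (X s \<omega>))" .
  next
    show "integrable M (indicator ?C :: _ \<Rightarrow> real)"
      by (rule integrable_real_indicator) (auto simp: emeasure_eq_measure)
  qed
qed

text \<open>Evaluates the right-hand side of \<open>markov_wrt\<close>, so that the condition on the
  filtration becomes a statement about the transition function.\<close>

lemma cond_exp_state:
  fixes X :: "real \<Rightarrow> 'w \<Rightarrow> 's::finite"
  assumes p: "prob_space M" and X: "\<And>t. 0 \<le> t \<Longrightarrow> X t \<in> measurable M (count_space UNIV)"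
    and fdd: "has_fdd q z0 M X" and st: "0 \<le> s" "s \<le> t"
  shows "AE \<omega> in M. real_cond_exp M (vimage_algebra (space M) (X s) (count_space UNIV))
      (indicator {\<omega>'\<in>space M. X t \<omega>' = z}) \<omega> = transition q (t - s) (X s \<omega>) z"
proof (rule cond_exp_transition[where g = "\<lambda>a. transition q (t - s) a z", OF p])
  let ?H = "vimage_algebra (space M) (X s) (count_space UNIV)"
  have H: "sets ?H = {X s -` S \<inter> space M | S. S \<in> UNIV}"
    by (subst sets_vimage_algebra2) auto
  show "subalgebra M ?H"
    using measurable_sets[OF X[OF st(1)]] unfolding subalgebra_def H by auto
  show "X s \<in> measurable ?H (count_space UNIV)" by (rule measurable_vimage_algebra1) simp
  show "X t \<in> measurable M (count_space UNIV)" using st by (intro X) simp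
  fix A a assume "A \<in> sets ?H"
  then obtain S where A: "A = X s -` S \<inter> space M" unfolding H by auto
  show "measure M (A \<inter> {\<omega>\<in>space M. X s \<omega> = a} \<inter> {\<omega>\<in>space M. X t \<omega> = z})
      = measure M (A \<inter> {\<omega>\<in>space M. X s \<omega> = a}) * transition q (t - s) a z"
  proof (cases "a \<in> S")
    case True
    then have "A \<inter> {\<omega>\<in>space M. X s \<omega> = a} = {\<omega>\<in>space M. \<forall>u\<in>{}. X u \<omega> = a} \<inter> {\<omega>\<in>space M. X s \<omega> = a}"
      unfolding A by auto
    then show ?thesis using markov_cylinder[OF fdd _ _ st, of "{}" "\<lambda>_. a" a z] by simp
  next
    case False
    then have "A \<inter> {\<omega>\<in>space M. X s \<omega> = a} = {}" unfolding A by auto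
    then show ?thesis by simp
  qed
qed

subsection \<open>Lumping\<close>

lemma transition_lump:
  assumes lump: "\<And>c f. (\<Sum>e\<in>UNIV. generator q c e * f (\<phi> e)) = (\<Sum>r\<in>UNIV. generator q' (\<phi> c) r * f r)"
  shows "(\<Sum>e | \<phi> e = r. transition q t c e) = transition q' t (\<phi> c) r"
proof -
  have "(\<Sum>e | \<phi> e = r. transition q t c e) = (\<Sum>e\<in>UNIV. transition q t c e * (if \<phi> e = r then 1 else 0))"
    by (simp add: sum.If_cases if_distrib cong: if_cong)
  also have "\<dots> = (\<Sum>s\<in>UNIV. transition q' t (\<phi> c) s * (if s = r then 1 else 0))"
    unfolding transition_eq_mexp by (rule mexp_lump) (rule lump)
  finally show ?thesis by (simp add: if_distrib cong: if_cong)
qed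

lemma measure_lump:
  fixes Z :: "'w \<Rightarrow> 's::finite"
  assumes "finite_measure M" "Z \<in> measurable M (count_space UNIV)" "A \<in> sets M"
  shows "measure M (A \<inter> {\<omega>\<in>space M. \<phi> (Z \<omega>) = r}) = (\<Sum>c | \<phi> c = r. measure M (A \<inter> {\<omega>\<in>space M. Z \<omega> = c}))"
proof -
  note [measurable] = assms(2,3)
  have "measure M (A \<inter> {\<omega>\<in>space M. \<phi> (Z \<omega>) = r})
      = (\<Sum>c\<in>UNIV. measure M (A \<inter> {\<omega>\<in>space M. \<phi> (Z \<omega>) = r} \<inter> {\<omega>\<in>space M. Z \<omega> = c}))"
    by (rule measure_split[OF assms(1,2)]) measurable
  also have "\<dots> = (\<Sum>c\<in>UNIV. if \<phi> c = r then measure M (A \<inter> {\<omega>\<in>space M. Z \<omega> = c}) else 0)"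
  proof (intro sum.cong refl)
    fix c
    have "A \<inter> {\<omega>\<in>space M. \<phi> (Z \<omega>) = r} \<inter> {\<omega>\<in>space M. Z \<omega> = c}
        = (if \<phi> c = r then A \<inter> {\<omega>\<in>space M. Z \<omega> = c} else {})" by auto
    then show "measure M (A \<inter> {\<omega>\<in>space M. \<phi> (Z \<omega>) = r} \<inter> {\<omega>\<in>space M. Z \<omega> = c})
        = (if \<phi> c = r then measure M (A \<inter> {\<omega>\<in>space M. Z \<omega> = c}) else 0)" by simp
  qed
  finally show ?thesis by (simp add: sum.If_cases)
qed

text \<open>The event \<open>A\<close> may depend on the whole past of \<open>Z\<close>, not only on
  that of its image under \<open>\<phi>\<close>. This makes each walk of the specific coupling
  Markov with respect to the past of the pair.\<close>

lemma lumped_markov: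
  fixes Z :: "real \<Rightarrow> 'w \<Rightarrow> 's::finite" and \<phi> :: "'s \<Rightarrow> 'r::finite"
  assumes p: "prob_space M" and Z: "\<And>t. 0 \<le> t \<Longrightarrow> Z t \<in> measurable M (count_space UNIV)"
    and fdd: "has_fdd q z0 M Z" and st: "0 \<le> s" "s \<le> t"
    and lump: "\<And>c f. (\<Sum>e\<in>UNIV. generator q c e * f (\<phi> e)) = (\<Sum>r\<in>UNIV. generator q' (\<phi> c) r * f r)"
    and A: "A \<in> sets (natural_filtration M Z s)"
  shows "measure M (A \<inter> {\<omega>\<in>space M. \<phi> (Z s \<omega>) = r} \<inter> {\<omega>\<in>space M. \<phi> (Z t \<omega>) = r'})
      = measure M (A \<inter> {\<omega>\<in>space M. \<phi> (Z s \<omega>) = r}) * transition q' (t - s) r r'"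
proof -
  have fm: "finite_measure M" using p by (rule prob_space.finite_measure)
  have Zs [measurable]: "Z s \<in> measurable M (count_space UNIV)" and Zt [measurable]: "Z t \<in> measurable M (count_space UNIV)"
    using st by (auto intro: Z)
  have AM [measurable]: "A \<in> sets M"
    using A natural_filtration_subalgebra[where Z = Z and M = M and s = s, OF Z] by (auto simp: subalgebra_def)
  have "measure M (A \<inter> {\<omega>\<in>space M. \<phi> (Z s \<omega>) = r} \<inter> {\<omega>\<in>space M. \<phi> (Z t \<omega>) = r'})
      = (\<Sum>e | \<phi> e = r'. measure M (A \<inter> {\<omega>\<in>space M. Z t \<omega> = e} \<inter> {\<omega>\<in>space M. \<phi> (Z s \<omega>) = r}))"
    by (subst measure_lump[OF fm Zt]) (auto simp: Int_ac)
  also have "\<dots> = (\<Sum>e | \<phi> e = r'. \<Sum>c | \<phi> c = r. measure M (A \<inter> {\<omega>\<in>space M. Z s \<omega> = c}) * transition q (t - s) c e)"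
    by (intro sum.cong refl, subst measure_lump[OF fm Zs])
      (auto simp: markov_joint[OF p Z fdd st A, symmetric] Int_ac)
  also have "\<dots> = (\<Sum>c | \<phi> c = r. measure M (A \<inter> {\<omega>\<in>space M. Z s \<omega> = c}) * (\<Sum>e | \<phi> e = r'. transition q (t - s) c e))"
    by (subst sum.swap) (simp add: sum_distrib_left)
  also have "\<dots> = (\<Sum>c | \<phi> c = r. measure M (A \<inter> {\<omega>\<in>space M. Z s \<omega> = c})) * transition q' (t - s) r r'"
    unfolding transition_lump[where q' = q', OF lump] sum_distrib_right by (intro sum.cong) auto
  also have "(\<Sum>c | \<phi> c = r. measure M (A \<inter> {\<omega>\<in>space M. Z s \<omega> = c})) = measure M (A \<inter> {\<omega>\<in>space M. \<phi> (Z s \<omega>) = r})"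
    by (rule measure_lump[OF fm Zs AM, symmetric])
  finally show ?thesis .
qed

text \<open>Induction on the number of times; \<open>lumped_markov\<close> supplies the last
  factor.\<close>

lemma has_fdd_lump:
  fixes Z :: "real \<Rightarrow> 'w \<Rightarrow> 's::finite" and \<phi> :: "'s \<Rightarrow> 'r::finite"
  assumes p: "prob_space M" and Z: "\<And>t. 0 \<le> t \<Longrightarrow> Z t \<in> measurable M (count_space UNIV)"
    and fdd: "has_fdd q z0 M Z"
    and lump: "\<And>c f. (\<Sum>e\<in>UNIV. generator q c e * f (\<phi> e)) = (\<Sum>r\<in>UNIV. generator q' (\<phi> c) r * f r)"
  shows "has_fdd q' (\<phi> z0) M (\<lambda>t \<omega>. \<phi> (Z t \<omega>))"
  unfolding has_fdd_def
proof (intro allI impI)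
  fix m :: nat and ts :: "nat \<Rightarrow> real" and zs :: "nat \<Rightarrow> 'r"
  assume ts: "0 \<le> ts 0 \<and> mono ts"
  then have nn: "0 \<le> ts k" for k using monoD[of ts 0 k] by auto
  have fm: "finite_measure M" using p by (rule prob_space.finite_measure)
  show "measure M {\<omega>\<in>space M. \<forall>k\<le>m. \<phi> (Z (ts k) \<omega>) = zs k} =
    transition q' (ts 0) (\<phi> z0) (zs 0) * (\<Prod>k<m. transition q' (ts (Suc k) - ts k) (zs k) (zs (Suc k)))"
  proof (induction m)
    case 0
    have "measure M {\<omega>\<in>space M. Z (ts 0) \<omega> = c} = transition q (ts 0) z0 c" for c
      using fdd[unfolded has_fdd_def, rule_format, OF ts, of 0 "\<lambda>_. c"] by simp
    moreover have "space M \<inter> {\<omega>\<in>space M. P \<omega>} = {\<omega>\<in>space M. P \<omega>}" for P by auto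
    ultimately show ?case
      using measure_lump[OF fm Z[OF nn[of 0]] sets.top, of \<phi> "zs 0"]
      by (simp add: transition_lump[where q' = q', OF lump])
  next
    case (Suc m)
    let ?A = "{\<omega>\<in>space M. \<forall>k\<le>m. \<phi> (Z (ts k) \<omega>) = zs k}"
    have "{\<omega>\<in>space M. \<forall>k\<in>{..m}. \<phi> (Z (ts k) \<omega>) = zs k} \<in> sets (natural_filtration M Z (ts m))"
      unfolding space_natural_filtration[of M Z "ts m", symmetric]
    proof (rule sets.sets_Collect_finite_All)
      fix k assume "k \<in> {..m}"
      then have "ts k \<le> ts m" using ts by (simp add: mono_def)
      then have [measurable]: "Z (ts k) \<in> measurable (natural_filtration M Z (ts m)) (count_space UNIV)"
        by (rule natural_filtration_measurable[OF nn])
      show "{\<omega>\<in>space (natural_filtration M Z (ts m)). \<phi> (Z (ts k) \<omega>) = zs k} \<in> sets (natural_filtration M Z (ts m))"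
        by measurable
    qed simp
    then have A: "?A \<in> sets (natural_filtration M Z (ts m))" by (simp only: Ball_def atMost_iff)
    have "ts m \<le> ts (Suc m)" using ts by (simp add: mono_def)
    from lumped_markov[where q' = q', OF p Z fdd nn this lump A, of "zs m" "zs (Suc m)"]
    have "measure M (?A \<inter> {\<omega>\<in>space M. \<phi> (Z (ts m) \<omega>) = zs m} \<inter> {\<omega>\<in>space M. \<phi> (Z (ts (Suc m)) \<omega>) = zs (Suc m)})
        = measure M (?A \<inter> {\<omega>\<in>space M. \<phi> (Z (ts m) \<omega>) = zs m}) * transition q' (ts (Suc m) - ts m) (zs m) (zs (Suc m))" .
    moreover have "?A \<inter> {\<omega>\<in>space M. \<phi> (Z (ts m) \<omega>) = zs m} = ?A" by auto
    moreover have "?A \<inter> {\<omega>\<in>space M. \<phi> (Z (ts (Suc m)) \<omega>) = zs (Suc m)} = {\<omega>\<in>space M. \<forall>k\<le>Suc m. \<phi> (Z (ts k) \<omega>) = zs k}"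
      unfolding all_le_Suc by blast
    ultimately show ?case using Suc.IH by simp
  qed
qed

subsection \<open>The specific coupling is co-adapted\<close>

lemma measurable_pair_count_space:
  fixes X :: "'w \<Rightarrow> 'a::finite" and Y :: "'w \<Rightarrow> 'b::finite"
  assumes "X \<in> measurable M (count_space UNIV)" "Y \<in> measurable M (count_space UNIV)"
  shows "(\<lambda>\<omega>. (X \<omega>, Y \<omega>)) \<in> measurable M (count_space UNIV)"
proof -
  have "(\<lambda>\<omega>. (X \<omega>, Y \<omega>)) -` {z} \<inter> space M = (X -` {fst z} \<inter> space M) \<inter> (Y -` {snd z} \<inter> space M)" for z
    by auto
  moreover have "(X -` {fst z} \<inter> space M) \<inter> (Y -` {snd z} \<inter> space M) \<in> sets M" for z
    using assms by (intro sets.Int measurable_sets) auto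
  ultimately show ?thesis by (subst measurable_count_space_eq2) auto
qed

lemma hat_couplingD:
  assumes "hat_coupling x y M X Y"
  shows "prob_space M" "\<And>t. 0 \<le> t \<Longrightarrow> (\<lambda>\<omega>. (X t \<omega>, Y t \<omega>)) \<in> measurable M (count_space UNIV)"
    "cadlag_paths M (\<lambda>t \<omega>. (X t \<omega>, Y t \<omega>))" "has_fdd hat_rate (x, y) M (\<lambda>t \<omega>. (X t \<omega>, Y t \<omega>))"
  using assms unfolding hat_coupling_def jump_process_def has_fdd_def by blast+

lemma cadlag_paths_comp:
  assumes "cadlag_paths M Z"
  shows "cadlag_paths M (\<lambda>t \<omega>. \<phi> (Z t \<omega>))"
  unfolding cadlag_paths_def
proof (intro ballI conjI allI impI)
  fix \<omega> t assume \<omega>: "\<omega> \<in> space M"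
  show "\<forall>\<^sub>F s in at_right t. \<phi> (Z s \<omega>) = \<phi> (Z t \<omega>)" if "0 \<le> t"
  proof -
    have "\<forall>\<^sub>F s in at_right t. Z s \<omega> = Z t \<omega>"
      using assms \<omega> that unfolding cadlag_paths_def by blast
    then show ?thesis by (rule eventually_mono) simp
  qed
  show "\<exists>z. \<forall>\<^sub>F s in at_left t. \<phi> (Z s \<omega>) = z" if "0 < t"
  proof -
    have "\<exists>z. \<forall>\<^sub>F s in at_left t. Z s \<omega> = z"
      using assms \<omega> that unfolding cadlag_paths_def by simp
    then obtain z where "\<forall>\<^sub>F s in at_left t. Z s \<omega> = z" ..
    then have "\<forall>\<^sub>F s in at_left t. \<phi> (Z s \<omega>) = \<phi> z" by (rule eventually_mono) simp
    then show ?thesis ..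
  qed
qed

lemma markov_wrt_lump:
  fixes Z :: "real \<Rightarrow> 'w \<Rightarrow> 's::finite" and \<phi> :: "'s \<Rightarrow> 'r::finite"
  assumes p: "prob_space M" and Z: "\<And>t. 0 \<le> t \<Longrightarrow> Z t \<in> measurable M (count_space UNIV)"
    and fdd: "has_fdd q z0 M Z"
    and lump: "\<And>c f. (\<Sum>e\<in>UNIV. generator q c e * f (\<phi> e)) = (\<Sum>r\<in>UNIV. generator q' (\<phi> c) r * f r)"
  shows "markov_wrt M (natural_filtration M Z) (\<lambda>t \<omega>. \<phi> (Z t \<omega>))"
  unfolding markov_wrt_def
proof (intro allI impI)
  fix s t :: real and z assume st: "0 \<le> s \<and> s \<le> t"
  let ?X = "\<lambda>t \<omega>. \<phi> (Z t \<omega>)"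
  have X: "?X t \<in> measurable M (count_space UNIV)" if "0 \<le> t" for t
    by (rule measurable_compose[OF Z[OF that]]) simp
  have "AE \<omega> in M. real_cond_exp M (natural_filtration M Z s) (indicator {\<omega>'\<in>space M. ?X t \<omega>' = z}) \<omega>
      = transition q' (t - s) (?X s \<omega>) z"
  proof (rule cond_exp_transition[where X = ?X and s = s and t = t and z = z and g = "\<lambda>a. transition q' (t - s) a z", OF p])
    show "subalgebra M (natural_filtration M Z s)" by (rule natural_filtration_subalgebra[OF Z])
    show "?X s \<in> measurable (natural_filtration M Z s) (count_space UNIV)"
      using st by (intro measurable_compose[OF natural_filtration_measurable]) auto
    show "?X t \<in> measurable M (count_space UNIV)" using st by (intro X) simp
    show "measure M (A \<inter> {\<omega>\<in>space M. ?X s \<omega> = a} \<inter> {\<omega>\<in>space M. ?X t \<omega> = z})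
        = measure M (A \<inter> {\<omega>\<in>space M. ?X s \<omega> = a}) * transition q' (t - s) a z"
      if "A \<in> sets (natural_filtration M Z s)" for A a
      using st that by (intro lumped_markov[where q' = q', OF p Z fdd _ _ lump]) auto
  qed
  moreover have "AE \<omega> in M. real_cond_exp M (vimage_algebra (space M) (?X s) (count_space UNIV))
      (indicator {\<omega>'\<in>space M. ?X t \<omega>' = z}) \<omega> = transition q' (t - s) (?X s \<omega>) z"
    using st by (intro cond_exp_state[where X = ?X, OF p X has_fdd_lump[where q' = q', OF p Z fdd lump]]) auto
  ultimately show "AE \<omega> in M. real_cond_exp M (natural_filtration M Z s) (indicator {\<omega>'\<in>space M. ?X t \<omega>' = z}) \<omega>
      = real_cond_exp M (vimage_algebra (space M) (?X s) (count_space UNIV)) (indicator {\<omega>'\<in>space M. ?X t \<omega>' = z}) \<omega>"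
    by eventually_elim simp
qed

text \<open>The filtration is that of the pair. The projections to the two walks are lumpings of
  \<open>hat_rate\<close> to \<open>walk_rate\<close>, by the row and column sums of the
  matrix.\<close>

lemma hat_coupling_coadapted:
  fixes x y :: "'d::finite \<Rightarrow> 'n::finite" and M :: "'w measure"
  assumes n: "CARD('n) \<ge> 2" and hat: "hat_coupling x y M X Y"
  shows "(M, X, Y) \<in> coadapted_couplings x y"
proof -
  let ?Z = "\<lambda>t \<omega>. (X t \<omega>, Y t \<omega>)"
  note p = hat_couplingD(1)[OF hat] and Z = hat_couplingD(2)[OF hat]
    and cad = hat_couplingD(3)[OF hat] and fdd = hat_couplingD(4)[OF hat]
  have lump1: "(\<Sum>e\<in>UNIV. generator hat_rate c e * f (fst e)) = (\<Sum>r\<in>UNIV. generator walk_rate (fst c) r * f r)"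
    for c :: "('d \<Rightarrow> 'n) \<times> ('d \<Rightarrow> 'n)" and f
    using hat_rate_fst[OF n, of "fst c" "snd c" f] by simp
  have lump2: "(\<Sum>e\<in>UNIV. generator hat_rate c e * f (snd e)) = (\<Sum>r\<in>UNIV. generator walk_rate (snd c) r * f r)"
    for c :: "('d \<Rightarrow> 'n) \<times> ('d \<Rightarrow> 'n)" and f
    using hat_rate_snd[OF n, of "fst c" "snd c" f] by simp
  have X: "X t \<in> measurable M (count_space UNIV)" and Y: "Y t \<in> measurable M (count_space UNIV)" if "0 \<le> t" for t
    using measurable_compose[OF Z[OF that], of fst "count_space UNIV"]
      measurable_compose[OF Z[OF that], of snd "count_space UNIV"] by simp_all
  have "copy_of_walk x M X" "copy_of_walk y M Y"
    using X Y
      cadlag_paths_comp[OF cad, of fst] cadlag_paths_comp[OF cad, of snd]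
      has_fdd_lump[where q' = walk_rate, OF p Z fdd lump1] has_fdd_lump[where q' = walk_rate, OF p Z fdd lump2]
    by (simp_all add: copy_of_walk_iff[OF n p])
  moreover have "coadapted M X Y"
    unfolding coadapted_def
  proof (intro exI conjI allI)
    show "filtration (space M) (natural_filtration M ?Z)"
      by (simp add: filtration_def space_natural_filtration natural_filtration_mono)
    show "subalgebra M (natural_filtration M ?Z t)" for t
      by (rule natural_filtration_subalgebra[OF Z])
    show "adapted_to (natural_filtration M ?Z) X" "adapted_to (natural_filtration M ?Z) Y"
      unfolding adapted_to_def
      using measurable_compose[OF natural_filtration_measurable[where Z = ?Z and M = M], of _ _ fst "count_space UNIV"]
        measurable_compose[OF natural_filtration_measurable[where Z = ?Z and M = M], of _ _ snd "count_space UNIV"]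
      by simp_all
    show "markov_wrt M (natural_filtration M ?Z) X" "markov_wrt M (natural_filtration M ?Z) Y"
      using markov_wrt_lump[where q' = walk_rate, OF p Z fdd lump1]
        markov_wrt_lump[where q' = walk_rate, OF p Z fdd lump2] by simp_all
  qed
  ultimately show ?thesis using p by (simp add: coadapted_couplings_def)
qed

subsection \<open>The coupling time\<close>

text \<open>By right-continuity in a discrete space a disagreement lasts for a positive time. It is
  therefore visible at a rational distance from \<open>t\<close>, and it pushes the coupling time
  strictly beyond \<open>t\<close>. The rational form makes the event a countable union.\<close>

lemma coupling_time_gt_iff:
  assumes X: "cadlag_paths M X" and Y: "cadlag_paths M Y" and \<omega>: "\<omega> \<in> space M" and t: "0 \<le> t"
  shows "ereal t < coupling_time X Y \<omega> \<longleftrightarrow> (\<exists>q\<in>\<rat>. 0 \<le> q \<and> X (t + q) \<omega> \<noteq> Y (t + q) \<omega>)"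
proof -
  have stay: "\<exists>b>u. \<forall>s. u \<le> s \<and> s < b \<longrightarrow> X s \<omega> \<noteq> Y s \<omega>" if u: "0 \<le> u" and ne: "X u \<omega> \<noteq> Y u \<omega>" for u
  proof -
    have "\<forall>\<^sub>F s in at_right u. X s \<omega> = X u \<omega>" "\<forall>\<^sub>F s in at_right u. Y s \<omega> = Y u \<omega>"
      using X Y \<omega> u unfolding cadlag_paths_def by blast+
    then have "\<forall>\<^sub>F s in at_right u. X s \<omega> \<noteq> Y s \<omega>" by eventually_elim (use ne in simp)
    then obtain b where "b > u" "\<forall>s>u. s < b \<longrightarrow> X s \<omega> \<noteq> Y s \<omega>"
      by (auto simp: eventually_at_right_field)
    then show ?thesis using ne by (intro exI[of _ b]) (auto simp: le_less)
  qed
  let ?A = "{ereal a | a. 0 \<le> a \<and> (\<forall>s\<ge>a. X s \<omega> = Y s \<omega>)}"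
  show ?thesis
  proof
    assume gt: "ereal t < coupling_time X Y \<omega>"
    show "\<exists>q\<in>\<rat>. 0 \<le> q \<and> X (t + q) \<omega> \<noteq> Y (t + q) \<omega>"
    proof (rule ccontr)
      assume eq: "\<not> (\<exists>q\<in>\<rat>. 0 \<le> q \<and> X (t + q) \<omega> \<noteq> Y (t + q) \<omega>)"
      have "X s \<omega> = Y s \<omega>" if s: "s \<ge> t" for s
      proof (rule ccontr)
        assume "X s \<omega> \<noteq> Y s \<omega>"
        then obtain b where b: "b > s" "\<forall>r. s \<le> r \<and> r < b \<longrightarrow> X r \<omega> \<noteq> Y r \<omega>"
          using stay[of s] t s by auto
        obtain q where q: "q \<in> \<rat>" "s - t < q" "q < b - t" using Rats_dense_in_real[of "s - t" "b - t"] b(1) by auto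
        then have "X (t + q) \<omega> \<noteq> Y (t + q) \<omega>" using b(2) by auto
        moreover have "0 \<le> q" using q s by simp
        ultimately show False using eq q(1) by blast
      qed
      then have "ereal t \<in> ?A" using t by auto
      then have "coupling_time X Y \<omega> \<le> ereal t" unfolding coupling_time_def by (rule Inf_lower)
      with gt show False by simp
    qed
  next
    assume "\<exists>q\<in>\<rat>. 0 \<le> q \<and> X (t + q) \<omega> \<noteq> Y (t + q) \<omega>"
    then obtain q where q: "0 \<le> q" "X (t + q) \<omega> \<noteq> Y (t + q) \<omega>" by blast
    then obtain b where b: "b > t + q" "\<forall>s. t + q \<le> s \<and> s < b \<longrightarrow> X s \<omega> \<noteq> Y s \<omega>"
      using stay[of "t + q"] t by auto
    have "ereal t < ereal b" using b(1) q(1) by simp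
    also have "ereal b \<le> coupling_time X Y \<omega>"
      unfolding coupling_time_def
    proof (rule Inf_greatest)
      fix r assume "r \<in> ?A"
      then obtain a where a: "r = ereal a" "\<forall>s\<ge>a. X s \<omega> = Y s \<omega>" by auto
      have "b \<le> a"
      proof (rule ccontr)
        assume "\<not> b \<le> a"
        then show False using a(2)[rule_format, of "max a (t + q)"] b by auto
      qed
      then show "ereal b \<le> r" using a(1) by simp
    qed
    finally show "ereal t < coupling_time X Y \<omega>" .
  qed
qed

lemma coupling_time_event_sets:
  fixes X Y :: "real \<Rightarrow> 'w \<Rightarrow> 's::finite"
  assumes X: "cadlag_paths M X" and Y: "cadlag_paths M Y" and t: "0 \<le> t"
    and mX: "\<And>t. 0 \<le> t \<Longrightarrow> X t \<in> measurable M (count_space UNIV)"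
    and mY: "\<And>t. 0 \<le> t \<Longrightarrow> Y t \<in> measurable M (count_space UNIV)"
  shows "{\<omega>\<in>space M. coupling_time X Y \<omega> > ereal t}
      = (\<Union>q\<in>{q\<in>\<rat>. 0 \<le> q}. {\<omega>\<in>space M. X (t + q) \<omega> \<noteq> Y (t + q) \<omega>})"
    and "{\<omega>\<in>space M. coupling_time X Y \<omega> > ereal t} \<in> sets M"
    and "0 \<le> u \<Longrightarrow> {\<omega>\<in>space M. X u \<omega> \<noteq> Y u \<omega>} \<in> sets M"
proof -
  show eq: "{\<omega>\<in>space M. coupling_time X Y \<omega> > ereal t}
      = (\<Union>q\<in>{q\<in>\<rat>. 0 \<le> q}. {\<omega>\<in>space M. X (t + q) \<omega> \<noteq> Y (t + q) \<omega>})"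
    using coupling_time_gt_iff[OF X Y _ t] by auto
  show ne: "{\<omega>\<in>space M. X u \<omega> \<noteq> Y u \<omega>} \<in> sets M" if "0 \<le> u" for u
  proof -
    have "(\<lambda>\<omega>. (X u \<omega>, Y u \<omega>)) -` {z. fst z \<noteq> snd z} \<inter> space M \<in> sets M"
      using that by (intro measurable_sets[OF measurable_pair_count_space] mX mY) auto
    then show ?thesis by (simp add: vimage_def Int_def conj_commute)
  qed
  have "countable {q\<in>\<rat>. 0 \<le> (q :: real)}"
    by (rule countable_subset[OF _ countable_rat]) auto
  then show "{\<omega>\<in>space M. coupling_time X Y \<omega> > ereal t} \<in> sets M"
    unfolding eq using t by (intro sets.countable_UN'') (auto intro!: ne)
qed

lemma card_unmatched_eq_0: "card (unmatched a b) = 0 \<longleftrightarrow> a = (b :: 'd::finite \<Rightarrow> 'n)"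
  by (auto simp: unmatched_def fun_eq_iff)

lemma hat_transition_off_diagonal:
  fixes z :: "('d::finite \<Rightarrow> 'n::finite) \<times> ('d \<Rightarrow> 'n)"
  assumes n: "CARD('n) \<ge> 2"
  shows "(\<Sum>z' | fst z' \<noteq> snd z'. transition hat_rate t z z')
    = surv CARD('n) (t / (real CARD('n) - 1)) (card (unmatched (fst z) (snd z)))"
proof -
  have "(\<Sum>z' | fst z' \<noteq> snd z'. transition hat_rate t z z')
      = (\<Sum>z'\<in>UNIV. if fst z' \<noteq> snd z' then transition hat_rate t z z' else 0)"
    by (simp add: sum.If_cases)
  also have "\<dots> = (\<Sum>z'\<in>UNIV. transition hat_rate t z z' * surv CARD('n) (0 / (real CARD('n) - 1)) (card (unmatched (fst z') (snd z'))))"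
    by (intro sum.cong refl) (auto simp: surv_0 card_unmatched_eq_0)
  also have "\<dots> = surv CARD('n) ((0 + t) / (real CARD('n) - 1)) (card (unmatched (fst z) (snd z)))"
    by (rule hat_transition_surv[OF n, symmetric])
  finally show ?thesis by simp
qed

text \<open>From a diagonal state the probability of disagreement after any further time
  \<open>q\<close> is \<open>surv\<close> at level 0, which vanishes. The exceptional events for
  rational \<open>q\<close> still form a null set, so up to a null set the coupling time exceeds
  \<open>t\<close> exactly if the walks disagree at \<open>t\<close>.\<close>

lemma hat_coupling_survival:
  fixes x y :: "'d::finite \<Rightarrow> 'n::finite" and M :: "'w measure"
  assumes n: "CARD('n) \<ge> 2" and hat: "hat_coupling x y M X Y" and t: "0 \<le> t"
  shows "measure M {\<omega>\<in>space M. coupling_time X Y \<omega> > ereal t}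
    = surv CARD('n) (t / (real CARD('n) - 1)) (card (unmatched x y))"
proof -
  let ?Z = "\<lambda>t \<omega>. (X t \<omega>, Y t \<omega>)"
  note p = hat_couplingD(1)[OF hat] and Z = hat_couplingD(2)[OF hat]
    and cad = hat_couplingD(3)[OF hat] and fdd = hat_couplingD(4)[OF hat]
  interpret prob_space M by (rule p)
  have mX: "X t \<in> measurable M (count_space UNIV)" and mY: "Y t \<in> measurable M (count_space UNIV)" if "0 \<le> t" for t
    using measurable_compose[OF Z[OF that], of fst "count_space UNIV"]
      measurable_compose[OF Z[OF that], of snd "count_space UNIV"] by simp_all
  have X: "cadlag_paths M X" and Y: "cadlag_paths M Y"
    using cadlag_paths_comp[OF cad, of fst] cadlag_paths_comp[OF cad, of snd] by simp_all
  let ?D = "\<lambda>u. {\<omega>\<in>space M. X u \<omega> \<noteq> Y u \<omega>}"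
  have ev: "{\<omega>\<in>space M. coupling_time X Y \<omega> > ereal t} = (\<Union>q\<in>{q\<in>\<rat>. 0 \<le> q}. ?D (t + q))"
    "{\<omega>\<in>space M. coupling_time X Y \<omega> > ereal t} \<in> sets M" "\<And>u. 0 \<le> u \<Longrightarrow> ?D u \<in> sets M"
    using coupling_time_event_sets[OF X Y t] mX mY by simp_all
  have off: "(\<Sum>c | (fst c \<noteq> snd c) = True. F c) = (\<Sum>c | fst c \<noteq> snd c. F c)" for F :: "('d \<Rightarrow> 'n) \<times> ('d \<Rightarrow> 'n) \<Rightarrow> real"
    by simp
  have D: "measure M (?D t) = surv CARD('n) (t / (real CARD('n) - 1)) (card (unmatched x y))"
  proof -
    have "measure M {\<omega>\<in>space M. ?Z t \<omega> = c} = transition hat_rate t (x, y) c" for c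
      using fdd[unfolded has_fdd_def, rule_format, of "\<lambda>_. t" 0 "\<lambda>_. c"] t by (simp add: mono_def)
    moreover have "space M \<inter> {\<omega>\<in>space M. P \<omega>} = {\<omega>\<in>space M. P \<omega>}" for P by auto
    ultimately show ?thesis
      using measure_lump[where \<phi> = "\<lambda>c. fst c \<noteq> snd c" and r = True, OF finite_measure_axioms Z[OF t] sets.top]
        hat_transition_off_diagonal[OF n, of t "(x, y)"] by (simp add: off)
  qed
  have "AE \<omega> in M. \<omega> \<notin> ?D (t + q) - ?D t" if q: "0 \<le> q" for q
  proof -
    have tq: "0 \<le> t" "t \<le> t + q" using t q by auto
    have ms: "{\<omega>\<in>space M. ?Z t \<omega> = c} \<in> sets M" for c
      using measurable_sets[OF Z[OF t], of "{c}"] by (simp add: vimage_def Int_def conj_commute)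
    have "measure M ({\<omega>\<in>space M. ?Z t \<omega> = (a, a)} \<inter> ?D (t + q)) = 0" for a
    proof -
      have "measure M ({\<omega>\<in>space M. ?Z t \<omega> = (a, a)} \<inter> ?D (t + q))
          = (\<Sum>c | fst c \<noteq> snd c. measure M ({\<omega>\<in>space M. ?Z t \<omega> = (a, a)} \<inter> {\<omega>\<in>space M. ?Z (t + q) \<omega> = c}))"
        using measure_lump[where \<phi> = "\<lambda>c. fst c \<noteq> snd c" and r = True, OF finite_measure_axioms Z[of "t + q"] ms[of "(a, a)"]] tq
        by (simp add: off)
      also have "\<dots> = (\<Sum>c | fst c \<noteq> snd c. measure M {\<omega>\<in>space M. ?Z t \<omega> = (a, a)} * transition hat_rate q (a, a) c)"
      proof (intro sum.cong refl)
        fix c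
        have "space M \<inter> {\<omega>\<in>space M. ?Z t \<omega> = (a, a)} = {\<omega>\<in>space M. ?Z t \<omega> = (a, a)}" by auto
        then show "measure M ({\<omega>\<in>space M. ?Z t \<omega> = (a, a)} \<inter> {\<omega>\<in>space M. ?Z (t + q) \<omega> = c})
            = measure M {\<omega>\<in>space M. ?Z t \<omega> = (a, a)} * transition hat_rate q (a, a) c"
          using markov_joint[OF p Z fdd tq sets.top, of "(a, a)" c]
          by (simp only: space_natural_filtration add_diff_cancel_left')
      qed
      also have "\<dots> = 0"
        using hat_transition_off_diagonal[OF n, of q "(a, a)"]
        by (simp add: card_unmatched_eq_0 surv_no_unmatched unmatched_def flip: sum_distrib_left)
      finally show ?thesis .
    qed
    then have "emeasure M ({\<omega>\<in>space M. ?Z t \<omega> = (a, a)} \<inter> ?D (t + q)) = 0" for a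
      by (simp only: emeasure_eq_measure ennreal_0)
    then have "{\<omega>\<in>space M. ?Z t \<omega> = (a, a)} \<inter> ?D (t + q) \<in> null_sets M" for a
      using ms ev(3)[of "t + q"] t q by (intro null_setsI sets.Int) auto
    then have "(\<Union>a\<in>UNIV. {\<omega>\<in>space M. ?Z t \<omega> = (a, a)} \<inter> ?D (t + q)) \<in> null_sets M"
      by (intro null_sets_UN') auto
    moreover have "?D (t + q) - ?D t = (\<Union>a\<in>UNIV. {\<omega>\<in>space M. ?Z t \<omega> = (a, a)} \<inter> ?D (t + q))" by auto
    ultimately have "?D (t + q) - ?D t \<in> null_sets M" by simp
    then show ?thesis by (rule AE_not_in)
  qed
  then have "AE \<omega> in M. \<forall>q\<in>{q\<in>\<rat>. 0 \<le> q}. \<omega> \<notin> ?D (t + q) - ?D t"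
    by (subst AE_ball_countable) (auto intro: countable_subset[OF _ countable_rat])
  then have "AE \<omega> in M. \<omega> \<in> {\<omega>\<in>space M. coupling_time X Y \<omega> > ereal t} \<longleftrightarrow> \<omega> \<in> ?D t"
  proof eventually_elim
    fix \<omega> assume *: "\<forall>q\<in>{q\<in>\<rat>. 0 \<le> q}. \<omega> \<notin> ?D (t + q) - ?D t"
    have "0 \<in> {q\<in>\<rat>. 0 \<le> (q :: real)}" by simp
    then have "\<omega> \<in> ?D t \<Longrightarrow> \<omega> \<in> (\<Union>q\<in>{q\<in>\<rat>. 0 \<le> q}. ?D (t + q))"
      by (intro UN_I[of 0]) simp_all
    with * have "\<omega> \<in> (\<Union>q\<in>{q\<in>\<rat>. 0 \<le> q}. ?D (t + q)) \<longleftrightarrow> \<omega> \<in> ?D t" by blast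
    then show "\<omega> \<in> {\<omega>\<in>space M. coupling_time X Y \<omega> > ereal t} \<longleftrightarrow> \<omega> \<in> ?D t"
      by (simp only: ev(1))
  qed
  then have "measure M {\<omega>\<in>space M. coupling_time X Y \<omega> > ereal t} = measure M (?D t)"
    by (rule measure_eq_AE[OF _ ev(2) ev(3)[OF t]])
  with D show ?thesis by simp
qed

subsection \<open>Optimality\<close>

lemma cond_exp_event:
  assumes p: "prob_space M" and sub: "subalgebra M H" and C: "C \<in> sets M"
    and ae: "AE \<omega> in M. real_cond_exp M H (indicator C) \<omega> = g (X \<omega>)"
    and A: "A \<in> sets H" "\<And>\<omega>. \<omega> \<in> A \<Longrightarrow> X \<omega> = a"
  shows "measure M (A \<inter> C) = measure M A * g a"
proof -
  interpret prob_space M by fact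
  interpret sigma_finite_subalgebra M H
    by (rule finite_measure_subalgebra_is_sigma_finite)
      (simp add: finite_measure_subalgebra_def finite_measure_subalgebra_axioms_def sub finite_measure_axioms)
  have AM [measurable]: "A \<in> sets M" using A(1) sub by (auto simp: subalgebra_def)
  note [measurable] = C
  have "measure M (A \<inter> C) = (LINT \<omega>:A|M. indicator C \<omega>)"
    by (simp add: set_lebesgue_integral_def indicator_inter_arith[symmetric])
  also have "\<dots> = (LINT \<omega>:A|M. real_cond_exp M H (indicator C) \<omega>)"
    by (rule real_cond_exp_intA[OF _ A(1)]) (rule integrable_real_indicator, auto simp: emeasure_eq_measure)
  also have "\<dots> = (LINT \<omega>|M. indicator A \<omega> * g a)"
    unfolding set_lebesgue_integral_def
  proof (rule integral_cong_AE)
    show "AE \<omega> in M. indicator A \<omega> *\<^sub>R real_cond_exp M H (indicator C) \<omega> = indicator A \<omega> * g a"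
      using ae by eventually_elim (auto simp: indicator_def A(2))
  qed measurable
  also have "\<dots> = measure M A * g a" by (simp add: sets.Int_space_eq2)
  finally show ?thesis .
qed

text \<open>Turns \<open>markov_wrt\<close> into a multiplied-out equality for events of the common
  filtration. Such an event may fix the present state of both walks, which is how it is
  applied.\<close>

lemma coadapted_joint:
  fixes x :: "'d::finite \<Rightarrow> 'n::finite"
  assumes n: "CARD('n) \<ge> 2" and p: "prob_space M" and copy: "copy_of_walk x M X"
    and F: "\<And>t. subalgebra M (F t)" "markov_wrt M F X" and st: "0 \<le> s" "s \<le> t"
    and A: "A \<in> sets (F s)" "\<And>\<omega>. \<omega> \<in> A \<Longrightarrow> X s \<omega> = a"
  shows "measure M (A \<inter> {\<omega>\<in>space M. X t \<omega> = a'}) = measure M A * transition walk_rate (t - s) a a'"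
proof -
  have X: "X t \<in> measurable M (count_space UNIV)" if "0 \<le> t" for t
    using copy that by (simp add: copy_of_walk_def)
  have fdd: "has_fdd walk_rate x M X" using copy copy_of_walk_iff[OF n p] by blast
  let ?C = "{\<omega>\<in>space M. X t \<omega> = a'}"
  have "X t -` {a'} \<inter> space M \<in> sets M" using st by (intro measurable_sets[OF X]) auto
  then have C: "?C \<in> sets M" by (simp add: vimage_def Int_def conj_commute)
  have "AE \<omega> in M. real_cond_exp M (F s) (indicator ?C) \<omega> =
      real_cond_exp M (vimage_algebra (space M) (X s) (count_space UNIV)) (indicator ?C) \<omega>"
    using F(2) st unfolding markov_wrt_def by blast
  moreover have "AE \<omega> in M. real_cond_exp M (vimage_algebra (space M) (X s) (count_space UNIV)) (indicator ?C) \<omega>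
      = transition walk_rate (t - s) (X s \<omega>) a'"
    by (rule cond_exp_state[OF p X fdd st])
  ultimately have "AE \<omega> in M. real_cond_exp M (F s) (indicator ?C) \<omega> = transition walk_rate (t - s) (X s \<omega>) a'"
    by eventually_elim simp
  from cond_exp_event[where g = "\<lambda>a. transition walk_rate (t - s) a a'" and X = "X s", OF p F(1) C this A]
  show ?thesis by simp
qed

lemma coupling_lower_bound:
  fixes x y :: "'d::finite \<Rightarrow> 'n::finite" and M :: "'w measure"
  assumes n: "CARD('n) \<ge> 2" and c: "(M, X, Y) \<in> coadapted_couplings x y" and t: "0 \<le> t"
  shows "surv CARD('n) (t / (real CARD('n) - 1)) (card (unmatched x y))
      \<le> measure M {\<omega>\<in>space M. X t \<omega> \<noteq> Y t \<omega>}"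
proof -
  have p: "prob_space M" and cX: "copy_of_walk x M X" and cY: "copy_of_walk y M Y" and "coadapted M X Y"
    using c by (auto simp: coadapted_couplings_def)
  then obtain F where F: "filtration (space M) F" "\<And>t. subalgebra M (F t)"
      "adapted_to F X" "adapted_to F Y" "markov_wrt M F X" "markov_wrt M F Y"
    unfolding coadapted_def by blast
  interpret prob_space M by (rule p)
  have X: "X u \<in> measurable M (count_space UNIV)" and Y: "Y u \<in> measurable M (count_space UNIV)" if "0 \<le> u" for u
    using cX cY that by (simp_all add: copy_of_walk_def)
  define Z where "Z u \<omega> = (X u \<omega>, Y u \<omega>)" for u \<omega>
  have Z: "Z u \<in> measurable M (count_space UNIV)" if "0 \<le> u" for u
    unfolding Z_def[abs_def] using that by (intro measurable_pair_count_space X Y)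
  define N where "N z = card (unmatched (fst z) (snd z))" for z :: "('d \<Rightarrow> 'n) \<times> ('d \<Rightarrow> 'n)"
  define m where "m = real CARD('n) - 1"
  have m: "m > 0" using n by (simp add: m_def)
  let ?S = "\<lambda>u. surv CARD('n) (u / m)"
  let ?E = "\<lambda>u z. {\<omega>\<in>space M. Z u \<omega> = z}"
  \<comment> \<open>The probability of disagreement at time \<open>t\<close> if the given coupling
    runs up to \<open>s\<close> and the specific one takes over for the remaining time
    \<open>t - s\<close>; \<open>V\<close> interpolates between the two quantities to be
    compared.\<close>
  define V where "V s = (\<Sum>z\<in>UNIV. prob (?E s z) * ?S (t - s) (N z))" for s
  have EF: "?E s z \<in> sets (F s)" if "0 \<le> s" for s z
  proof -
    have "X s \<in> measurable (F s) (count_space UNIV)" "Y s \<in> measurable (F s) (count_space UNIV)"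
      using F(3,4) that by (auto simp: adapted_to_def)
    then have "(\<lambda>\<omega>. (X s \<omega>, Y s \<omega>)) -` {z} \<inter> space (F s) \<in> sets (F s)"
      by (intro measurable_sets[OF measurable_pair_count_space]) auto
    moreover have "space (F s) = space M" using F(2) by (simp add: subalgebra_def)
    ultimately show ?thesis by (simp add: Z_def vimage_def Int_def conj_commute)
  qed
  have E: "?E s z \<in> sets M" if "0 \<le> s" for s z
    using EF[OF that, of z] F(2)[of s] by (auto simp: subalgebra_def)
  have total: "(\<Sum>z\<in>UNIV. prob (?E s z)) = 1" if "0 \<le> s" for s
  proof -
    have "space M \<inter> ?E s z = ?E s z" for z by auto
    then show ?thesis
      using measure_split[OF finite_measure_axioms Z[OF that] sets.top] by (simp add: prob_space)
  qed
  obtain C where C: "C \<ge> 0"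
    "\<And>a b h s (\<pi> :: ('d \<Rightarrow> 'n) \<times> ('d \<Rightarrow> 'n) \<Rightarrow> real).
       0 \<le> h \<Longrightarrow> h \<le> 1 \<Longrightarrow> 0 \<le> s \<Longrightarrow> (\<And>z. 0 \<le> \<pi> z) \<Longrightarrow>
       (\<And>a'. (\<Sum>b'\<in>UNIV. \<pi> (a', b')) = transition walk_rate h a a') \<Longrightarrow>
       (\<And>b'. (\<Sum>a'\<in>UNIV. \<pi> (a', b')) = transition walk_rate h b b') \<Longrightarrow>
       ?S (s + h) (N (a, b)) - C * h\<^sup>2 \<le> (\<Sum>z\<in>UNIV. \<pi> z * ?S s (N z))"
    unfolding m_def N_def by (rule coupling_step[OF n]) blast
  have step: "V s - C * h\<^sup>2 \<le> V (s + h)" if s: "0 \<le> s" and h: "0 \<le> h" "h \<le> 1" and sh: "s + h \<le> t" for s h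
  proof -
    have sh0: "0 \<le> s + h" "s \<le> s + h" using s h by auto
    have fst_Z: "\<omega> \<in> ?E s z \<Longrightarrow> X s \<omega> = fst z" and snd_Z: "\<omega> \<in> ?E s z \<Longrightarrow> Y s \<omega> = snd z" for z \<omega>
      by (auto simp: Z_def)
    define J where "J z z' = prob (?E s z \<inter> ?E (s + h) z')" for z z'
    \<comment> \<open>Given \<open>Z s = z\<close>, the law of \<open>Z (s + h)\<close> has the two
      marginals that \<open>coupling_step\<close> asks for. States of probability 0 are treated
      apart because of the division.\<close>
    have J: "prob (?E s z) * (?S (t - s) (N z) - C * h\<^sup>2) \<le> (\<Sum>z'\<in>UNIV. J z z' * ?S (t - (s + h)) (N z'))" for z
    proof (cases "prob (?E s z) = 0")
      case True
      have "0 \<le> J z z' * ?S (t - (s + h)) (N z')" for z'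
        using sh m by (intro mult_nonneg_nonneg surv_nonneg n) (auto simp: J_def)
      then show ?thesis using True by (simp add: sum_nonneg)
    next
      case False
      then have pos: "prob (?E s z) > 0" by (simp add: zero_less_measure_iff)
      have "(\<Sum>b'\<in>UNIV. J z (a', b') / prob (?E s z)) = transition walk_rate h (fst z) a'" for a'
      proof -
        have "prob (?E s z \<inter> {\<omega>\<in>space M. X (s + h) \<omega> = a'})
            = (\<Sum>b'\<in>UNIV. prob (?E s z \<inter> {\<omega>\<in>space M. X (s + h) \<omega> = a'} \<inter> {\<omega>\<in>space M. Y (s + h) \<omega> = b'}))"
          by (rule measure_split[OF finite_measure_axioms Y[OF sh0(1)]])
            (use E[OF s] measurable_sets[OF X[OF sh0(1)], of "{a'}"] in \<open>auto simp: vimage_def Int_def conj_commute\<close>)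
        also have "\<dots> = (\<Sum>b'\<in>UNIV. J z (a', b'))"
          unfolding J_def by (intro sum.cong refl arg_cong[where f = prob]) (auto simp: Z_def)
        finally have "(\<Sum>b'\<in>UNIV. J z (a', b')) = prob (?E s z) * transition walk_rate h (fst z) a'"
          using coadapted_joint[where A = "?E s z" and a = "fst z" and a' = a', OF n p cX F(2,5) s sh0(2) EF[OF s] fst_Z]
          by simp
        then show ?thesis using pos by (simp flip: sum_divide_distrib)
      qed
      moreover have "(\<Sum>a'\<in>UNIV. J z (a', b') / prob (?E s z)) = transition walk_rate h (snd z) b'" for b'
      proof -
        have "prob (?E s z \<inter> {\<omega>\<in>space M. Y (s + h) \<omega> = b'})
            = (\<Sum>a'\<in>UNIV. prob (?E s z \<inter> {\<omega>\<in>space M. Y (s + h) \<omega> = b'} \<inter> {\<omega>\<in>space M. X (s + h) \<omega> = a'}))"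
          by (rule measure_split[OF finite_measure_axioms X[OF sh0(1)]])
            (use E[OF s] measurable_sets[OF Y[OF sh0(1)], of "{b'}"] in \<open>auto simp: vimage_def Int_def conj_commute\<close>)
        also have "\<dots> = (\<Sum>a'\<in>UNIV. J z (a', b'))"
          unfolding J_def by (intro sum.cong refl arg_cong[where f = prob]) (auto simp: Z_def)
        finally have "(\<Sum>a'\<in>UNIV. J z (a', b')) = prob (?E s z) * transition walk_rate h (snd z) b'"
          using coadapted_joint[where A = "?E s z" and a = "snd z" and a' = b', OF n p cY F(2,6) s sh0(2) EF[OF s] snd_Z]
          by simp
        then show ?thesis using pos by (simp flip: sum_divide_distrib)
      qed
      moreover have "0 \<le> J z z' / prob (?E s z)" for z' by (simp add: J_def)
      moreover have "0 \<le> t - (s + h)" using sh by simp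
      ultimately have "?S (t - (s + h) + h) (N (fst z, snd z)) - C * h\<^sup>2
          \<le> (\<Sum>z'\<in>UNIV. J z z' / prob (?E s z) * ?S (t - (s + h)) (N z'))"
        using C(2)[OF h, of "t - (s + h)" "\<lambda>z'. J z z' / prob (?E s z)" "fst z" "snd z"] by blast
      then have "prob (?E s z) * (?S (t - s) (N z) - C * h\<^sup>2)
          \<le> prob (?E s z) * (\<Sum>z'\<in>UNIV. J z z' / prob (?E s z) * ?S (t - (s + h)) (N z'))"
        using pos by (intro mult_left_mono) auto
      also have "\<dots> = (\<Sum>z'\<in>UNIV. J z z' * ?S (t - (s + h)) (N z'))"
        using pos by (simp add: sum_distrib_left)
      finally show ?thesis .
    qed
    have "V s - C * h\<^sup>2 = (\<Sum>z\<in>UNIV. prob (?E s z) * (?S (t - s) (N z) - C * h\<^sup>2))"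
      using total[OF s] by (simp add: V_def right_diff_distrib sum_subtractf flip: sum_distrib_right)
    also have "\<dots> \<le> (\<Sum>z\<in>UNIV. \<Sum>z'\<in>UNIV. J z z' * ?S (t - (s + h)) (N z'))"
      by (rule sum_mono) (rule J)
    also have "\<dots> = (\<Sum>z'\<in>UNIV. (\<Sum>z\<in>UNIV. J z z') * ?S (t - (s + h)) (N z'))"
      by (subst sum.swap) (simp add: sum_distrib_right)
    also have "\<dots> = V (s + h)"
    proof -
      have "prob (?E (s + h) z') = (\<Sum>z\<in>UNIV. J z z')" for z'
        unfolding J_def using measure_split[OF finite_measure_axioms Z[OF s] E[OF sh0(1)], of z'] by (simp add: Int_commute)
      then show ?thesis by (simp add: V_def)
    qed
    finally show ?thesis .
  qed
  have start: "?S t (N (x, y)) \<le> V 0"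
  proof -
    have init: "prob {\<omega>\<in>space M. X' 0 \<omega> = x'} = 1" if "copy_of_walk x' M X'" for x' :: "'d \<Rightarrow> 'n" and X'
    proof -
      have "has_fdd walk_rate x' M X'" using that copy_of_walk_iff[OF n p] by blast
      from this[unfolded has_fdd_def, rule_format, of "\<lambda>_. 0" 0 "\<lambda>_. x'"]
      show ?thesis by (simp add: mono_def transition_eq_mexp mexp_0)
    qed
    have sx: "{\<omega>\<in>space M. X 0 \<omega> = x} \<in> sets M" and sy: "{\<omega>\<in>space M. Y 0 \<omega> = y} \<in> sets M"
      using measurable_sets[OF X[of 0], of "{x}"] measurable_sets[OF Y[of 0], of "{y}"]
      by (simp_all add: vimage_def Int_def conj_commute)
    have "AE \<omega> in M. X 0 \<omega> = x" "AE \<omega> in M. Y 0 \<omega> = y"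
      using prob_Collect_eq_1[OF sx] prob_Collect_eq_1[OF sy] init[OF cX] init[OF cY] by auto
    then have "AE \<omega> in M. Z 0 \<omega> = (x, y)" by eventually_elim (simp add: Z_def)
    then have "prob (?E 0 (x, y)) = 1" using prob_Collect_eq_1[OF E[of 0 "(x, y)"]] by simp
    then have "?S t (N (x, y)) = (\<Sum>z\<in>{(x, y)}. prob (?E 0 z) * ?S (t - 0) (N z))" by simp
    also have "\<dots> \<le> V 0"
      unfolding V_def using t m by (intro sum_mono2) (auto intro!: mult_nonneg_nonneg surv_nonneg n)
    finally show ?thesis .
  qed
  have final: "V t = prob {\<omega>\<in>space M. X t \<omega> \<noteq> Y t \<omega>}"
  proof -
    have "space M \<inter> ?E t z = ?E t z" "space M \<inter> {\<omega>\<in>space M. P \<omega>} = {\<omega>\<in>space M. P \<omega>}" for z P by auto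
    then have "prob {\<omega>\<in>space M. fst (Z t \<omega>) \<noteq> snd (Z t \<omega>)} = (\<Sum>z | fst z \<noteq> snd z. prob (?E t z))"
      using measure_lump[where \<phi> = "\<lambda>c. fst c \<noteq> snd c" and r = True, OF finite_measure_axioms Z[OF t] sets.top] by simp
    also have "\<dots> = (\<Sum>z\<in>UNIV. if fst z \<noteq> snd z then prob (?E t z) else 0)"
      by (simp add: sum.If_cases)
    also have "\<dots> = V t"
      unfolding V_def by (intro sum.cong refl) (auto simp: surv_0 N_def card_unmatched_eq_0)
    finally show ?thesis by (simp add: Z_def)
  qed
  have iter: "V 0 - real k * (C * h\<^sup>2) \<le> V (real k * h)" if h: "0 \<le> h" "h \<le> 1" and "real k * h \<le> t" for k h
    using that(3)
  proof (induction k)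
    case (Suc k)
    then have "real k * h \<le> t" "real k * h + h \<le> t" using h by (simp_all add: algebra_simps)
    then have "V (real k * h) - C * h\<^sup>2 \<le> V (real k * h + h)" using h by (intro step) auto
    with Suc.IH[OF \<open>real k * h \<le> t\<close>] show ?case by (simp add: algebra_simps)
  qed simp
  \<comment> \<open>\<open>K\<close> steps of length \<open>t / K\<close>, at most 1 by
    \<open>K \<ge> t\<close>, accumulate the error \<open>K C (t / K)\<^sup>2\<close>.\<close>
  have bound: "V 0 - C * t\<^sup>2 / real K \<le> V t" if "K > 0" "real K \<ge> t" for K :: nat
    using iter[of "t / real K" K] that t by (simp add: power_divide power2_eq_square field_simps)
  have "V 0 \<le> V t"
  proof (rule ccontr)
    assume "\<not> V 0 \<le> V t"
    then have gap: "0 < V 0 - V t" by simp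
    obtain K :: nat where K: "real K > max t (C * t\<^sup>2 / (V 0 - V t))" using reals_Archimedean2 by blast
    then have "K > 0" using t by (cases K) auto
    have "C * t\<^sup>2 / (V 0 - V t) < real K" using K by simp
    then have "C * t\<^sup>2 / real K < V 0 - V t" using gap \<open>K > 0\<close> by (simp add: field_simps)
    with bound[OF \<open>K > 0\<close>] K show False by simp
  qed
  with start final show ?thesis by (simp add: N_def m_def)
qed

lemma coupling_time_lower_bound:
  fixes x y :: "'d::finite \<Rightarrow> 'n::finite" and M :: "'w measure"
  assumes n: "CARD('n) \<ge> 2" and c: "(M, X, Y) \<in> coadapted_couplings x y" and t: "0 \<le> t"
  shows "surv CARD('n) (t / (real CARD('n) - 1)) (card (unmatched x y))
      \<le> measure M {\<omega>\<in>space M. coupling_time X Y \<omega> > ereal t}"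
proof -
  have p: "prob_space M" and cX: "copy_of_walk x M X" and cY: "copy_of_walk y M Y"
    using c by (auto simp: coadapted_couplings_def)
  interpret prob_space M by (rule p)
  have ev: "{\<omega>\<in>space M. coupling_time X Y \<omega> > ereal t}
      = (\<Union>q\<in>{q\<in>\<rat>. 0 \<le> q}. {\<omega>\<in>space M. X (t + q) \<omega> \<noteq> Y (t + q) \<omega>})"
    "{\<omega>\<in>space M. coupling_time X Y \<omega> > ereal t} \<in> sets M"
    using cX cY t by (intro coupling_time_event_sets; simp add: copy_of_walk_def)+
  have "{\<omega>\<in>space M. X (t + 0) \<omega> \<noteq> Y (t + 0) \<omega>} \<subseteq> {\<omega>\<in>space M. coupling_time X Y \<omega> > ereal t}"
    unfolding ev(1) by (rule UN_upper) simp
  then have "measure M {\<omega>\<in>space M. X t \<omega> \<noteq> Y t \<omega>} \<le> measure M {\<omega>\<in>space M. coupling_time X Y \<omega> > ereal t}"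
    by (intro finite_measure_mono ev(2)) simp
  with coupling_lower_bound[OF n c t] show ?thesis by simp
qed

subsection \<open>Existence of jump processes\<close>

lemma clock_locally_constant:
  assumes r: "regular \<eta>" and L: "\<Lambda> > 0"
  shows "0 \<le> t \<Longrightarrow> \<forall>\<^sub>F s in at_right t. clock \<eta> (\<Lambda> * s) = clock \<eta> (\<Lambda> * t)"
    and "0 < t \<Longrightarrow> \<exists>k. \<forall>\<^sub>F s in at_left t. clock \<eta> (\<Lambda> * s) = k"
proof -
  have nn: "\<And>j. 0 \<le> fst (\<eta> j)" using r by (auto simp: regular_def)
  let ?S = "\<lambda>k. \<Sum>j<k. fst (\<eta> j)"
  show "\<forall>\<^sub>F s in at_right t. clock \<eta> (\<Lambda> * s) = clock \<eta> (\<Lambda> * t)" if t: "0 \<le> t"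
  proof -
    define k where "k = clock \<eta> (\<Lambda> * t)"
    have k: "hit k (\<Lambda> * t) \<eta>" unfolding k_def using t L by (intro regular_hit[OF r]) simp
    then have "t < ?S (Suc k) / \<Lambda>" using L by (simp add: hit_def field_simps)
    then have "\<forall>\<^sub>F s in at_right t. s \<in> {t<..<?S (Suc k) / \<Lambda>}" by (rule eventually_at_right_real)
    then show ?thesis
    proof eventually_elim
      fix s assume s: "s \<in> {t<..<?S (Suc k) / \<Lambda>}"
      then have "\<Lambda> * t \<le> \<Lambda> * s" "\<Lambda> * s < ?S (Suc k)" using L by (auto simp: field_simps)
      then have "hit k (\<Lambda> * s) \<eta>" using k by (auto simp: hit_def)
      then show "clock \<eta> (\<Lambda> * s) = clock \<eta> (\<Lambda> * t)" using clock_eqI[OF nn] by (simp add: k_def)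
    qed
  qed
  show "\<exists>k. \<forall>\<^sub>F s in at_left t. clock \<eta> (\<Lambda> * s) = k" if t: "0 < t"
  proof -
    have "hit (clock \<eta> (\<Lambda> * t)) (\<Lambda> * t) \<eta>" using t L by (intro regular_hit[OF r]) simp
    then have ex: "\<exists>m. \<Lambda> * t \<le> ?S (Suc m)" by (auto simp: hit_def intro: less_imp_le)
    \<comment> \<open>The left limit counts the rings strictly before \<open>\<Lambda> * t\<close>.
      One or more rings may fall on that very time, hence the least \<open>m\<close>.\<close>
    define m where "m = (LEAST m. \<Lambda> * t \<le> ?S (Suc m))"
    have up: "\<Lambda> * t \<le> ?S (Suc m)" using LeastI_ex[OF ex] by (simp add: m_def)
    have lo: "?S m < \<Lambda> * t"
    proof (cases m)
      case 0
      then show ?thesis using t L by simp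
    next
      case (Suc m')
      then have "\<not> \<Lambda> * t \<le> ?S (Suc m')"
        using not_less_Least[of m' "\<lambda>m. \<Lambda> * t \<le> ?S (Suc m)"] by (auto simp: m_def)
      then show ?thesis using Suc by (simp del: sum.lessThan_Suc)
    qed
    then have "?S m / \<Lambda> < t" using L by (simp add: field_simps)
    then have "\<forall>\<^sub>F s in at_left t. s \<in> {?S m / \<Lambda><..<t}" by (rule eventually_at_left_real)
    then have "\<forall>\<^sub>F s in at_left t. clock \<eta> (\<Lambda> * s) = m"
    proof eventually_elim
      fix s assume s: "s \<in> {?S m / \<Lambda><..<t}"
      then have "?S m \<le> \<Lambda> * s" "\<Lambda> * s < \<Lambda> * t" using L by (auto simp: field_simps)
      then have "hit m (\<Lambda> * s) \<eta>" using up by (auto simp: hit_def)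
      then show "clock \<eta> (\<Lambda> * s) = m" by (rule clock_eqI[OF nn])
    qed
    then show ?thesis ..
  qed
qed

text \<open>\<open>K = 1 + G / \<Lambda>\<close> is stochastic once \<open>\<Lambda>\<close>
  dominates the diagonal of the generator \<open>G\<close>. Drawing the images of all states
  independently turns its rows into the law of a random map, and running the clock at speed
  \<open>\<Lambda>\<close> restores the rates.\<close>

lemma uniformisation_exists:
  fixes q :: "'s::finite \<Rightarrow> 's \<Rightarrow> real"
  assumes q: "\<And>a b. a \<noteq> b \<Longrightarrow> 0 \<le> q a b"
  obtains \<Lambda> :: real and \<phi> :: "('s \<Rightarrow> 's) pmf"
  where "\<Lambda> > 0" "\<And>t. transition q t = mexp (chain_rate \<phi>) (\<Lambda> * t)"
proof -
  let ?G = "generator q"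
  \<comment> \<open>The summand 1 keeps \<open>\<Lambda>\<close> positive if all rates
    vanish.\<close>
  define \<Lambda> where "\<Lambda> = 1 + (\<Sum>a\<in>UNIV. \<Sum>b\<in>UNIV. \<bar>?G a b\<bar>)"
  have L: "\<Lambda> > 0" unfolding \<Lambda>_def by (intro add_pos_nonneg sum_nonneg) auto
  have diag: "\<bar>?G a a\<bar> \<le> \<Lambda>" for a
  proof -
    have "\<bar>?G a a\<bar> \<le> (\<Sum>b\<in>UNIV. \<bar>?G a b\<bar>)" by (intro member_le_sum[of a UNIV "\<lambda>b. \<bar>?G a b\<bar>"]) auto
    also have "\<dots> \<le> (\<Sum>a\<in>UNIV. \<Sum>b\<in>UNIV. \<bar>?G a b\<bar>)"
      by (intro member_le_sum[of a UNIV "\<lambda>a. \<Sum>b\<in>UNIV. \<bar>?G a b\<bar>"]) (auto intro: sum_nonneg)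
    finally show ?thesis by (simp add: \<Lambda>_def)
  qed
  define K where "K a b = (if a = b then 1 else 0) + ?G a b / \<Lambda>" for a b
  have K0: "0 \<le> K a b" for a b
    using q[of a b] diag[of a] L by (auto simp: K_def generator_def field_simps)
  have K1: "(\<Sum>b\<in>UNIV. K a b) = 1" for a
    using generator_apply[of q a "\<lambda>_. 1"] by (simp add: K_def sum.distrib flip: sum_divide_distrib)
  have pmf: "pmf (embed_pmf (K a)) b = K a b" for a b
  proof (rule pmf_embed_pmf)
    show "(\<integral>\<^sup>+b. ennreal (K a b) \<partial>count_space UNIV) = 1"
      using K1[of a] by (simp add: nn_integral_count_space_finite sum_ennreal K0)
  qed (rule K0)
  define \<phi> where "\<phi> = Pi_pmf UNIV undefined (\<lambda>a. embed_pmf (K a))"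
  have "step_prob \<phi> a b = K a b" for a b
  proof -
    have "step_prob \<phi> a b = pmf (map_pmf (\<lambda>g. g a) \<phi>) b"
      by (simp add: step_prob_def pmf_map vimage_def)
    also have "map_pmf (\<lambda>g. g a) \<phi> = embed_pmf (K a)"
      unfolding \<phi>_def by (subst Pi_pmf_component) auto
    finally show ?thesis by (simp add: pmf)
  qed
  then have rate: "generator q = (\<lambda>a b. \<Lambda> * chain_rate \<phi> a b)"
    using L by (intro ext) (simp add: chain_rate_def K_def)
  have "transition q t = mexp (chain_rate \<phi>) (\<Lambda> * t)" for t
    unfolding transition_eq_mexp rate by (intro ext) (rule mexp_scale)
  with L show ?thesis by (rule that)
qed

lemma jump_process_exists:
  fixes q :: "'s::finite \<Rightarrow> 's \<Rightarrow> real"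
  assumes q: "\<And>a b. a \<noteq> b \<Longrightarrow> 0 \<le> q a b"
  shows "\<exists>M :: (real \<Rightarrow> 's) measure. jump_process q z M (\<lambda>t p. p t)"
proof -
  obtain \<Lambda> :: real and \<phi> :: "('s \<Rightarrow> 's) pmf"
    where L: "\<Lambda> > 0" and trans: "\<And>t. transition q t = mexp (chain_rate \<phi>) (\<Lambda> * t)"
    by (rule uniformisation_exists[OF q]) blast+
  let ?P = "PiM {0..} (\<lambda>_::real. count_space (UNIV :: 's set))"
  define R where "R = {\<eta> \<in> space (clock_space \<phi>). regular \<eta>}"
  \<comment> \<open>\<open>cadlag_paths\<close> allows no exceptional null set, so irregular clocks
    get a constant path.\<close>
  define Z where "Z t \<eta> = (if \<eta> \<in> R then chain z (\<Lambda> * t) \<eta> else z)" for t \<eta>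
  have reg_iff: "{\<eta> \<in> space (clock_space \<phi>). regular \<eta>} \<in> sets (clock_space \<phi>)"
    unfolding regular_def by measurable
  then have R [measurable]: "R \<in> sets (clock_space \<phi>)" by (simp add: R_def)
  have Z: "Z t \<in> measurable (clock_space \<phi>) (count_space UNIV)" for t
    unfolding Z_def[abs_def] by measurable
  \<comment> \<open>Membership in \<open>S\<close> involves uncountably many times; the path space
    itself is cut down to \<open>S\<close> instead of treating \<open>S\<close> as an event of
    probability 1.\<close>
  define S where "S = {p :: real \<Rightarrow> 's. (\<forall>t\<ge>0. \<forall>\<^sub>F s in at_right t. p s = p t) \<and>
      (\<forall>t>0. \<exists>c. \<forall>\<^sub>F s in at_left t. p s = c)}"
  let ?path = "\<lambda>\<eta>. \<lambda>t\<in>{0..}. Z t \<eta>"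
  have S: "?path \<eta> \<in> S" for \<eta>
    unfolding S_def
  proof (intro CollectI conjI allI impI)
    fix t :: real assume t: "0 \<le> t"
    have "\<forall>\<^sub>F s in at_right t. Z s \<eta> = Z t \<eta>"
    proof (cases "\<eta> \<in> R")
      case True
      then have "regular \<eta>" by (simp add: R_def)
      from clock_locally_constant(1)[OF this L t] show ?thesis by eventually_elim (simp add: Z_def chain_def)
    qed (simp add: Z_def)
    moreover have "\<forall>\<^sub>F s in at_right t. t < s" by (simp add: eventually_at_right_less)
    ultimately show "\<forall>\<^sub>F s in at_right t. ?path \<eta> s = ?path \<eta> t"
      by eventually_elim (use t in simp)
  next
    fix t :: real assume t: "0 < t"
    have "\<exists>c. \<forall>\<^sub>F s in at_left t. Z s \<eta> = c"
    proof (cases "\<eta> \<in> R")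
      case True
      then have "regular \<eta>" by (simp add: R_def)
      from clock_locally_constant(2)[OF this L t]
      obtain k where "\<forall>\<^sub>F s in at_left t. clock \<eta> (\<Lambda> * s) = k" ..
      then have "\<forall>\<^sub>F s in at_left t. Z s \<eta> = jump_chain z \<eta> k"
        by eventually_elim (use True in \<open>simp add: Z_def chain_def\<close>)
      then show ?thesis ..
    qed (simp add: Z_def)
    then obtain c where "\<forall>\<^sub>F s in at_left t. Z s \<eta> = c" ..
    moreover have "\<forall>\<^sub>F s in at_left t. s \<in> {0<..<t}" by (rule eventually_at_left_real[OF t])
    ultimately have "\<forall>\<^sub>F s in at_left t. ?path \<eta> s = c" by eventually_elim simp
    then show "\<exists>c. \<forall>\<^sub>F s in at_left t. ?path \<eta> s = c" ..
  qed
  define M where "M = distr (clock_space \<phi>) (restrict_space ?P S) ?path"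
  have path: "?path \<in> measurable (clock_space \<phi>) (restrict_space ?P S)"
    using S by (intro measurable_restrict_space2 path_measurable Z) auto
  have "prob_space M"
    unfolding M_def by (rule prob_space.prob_space_distr[OF prob_space_clock_space path])
  moreover have coord: "(\<lambda>p. p t) \<in> measurable M (count_space UNIV)" if "0 \<le> t" for t
  proof -
    have "(\<lambda>p. p t) \<in> measurable ?P (count_space UNIV)"
      using that by (intro measurable_component_singleton) auto
    then show ?thesis by (simp add: M_def measurable_restrict_space1)
  qed
  moreover have "cadlag_paths M (\<lambda>t p. p t)"
    unfolding cadlag_paths_def by (auto simp: M_def space_restrict_space S_def)
  moreover have "measure M {p\<in>space M. \<forall>k\<le>m. p (ts k) = zs k} =
      transition q (ts 0) z (zs 0) * (\<Prod>k<m. transition q (ts (Suc k) - ts k) (zs k) (zs (Suc k)))"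
    if ts: "0 \<le> ts 0 \<and> mono ts" for m :: nat and ts zs
  proof -
    have nn: "0 \<le> ts k" for k using ts monoD[of ts 0 k] by auto
    have "{p\<in>space M. \<forall>k\<le>m. p (ts k) = zs k} \<in> sets M"
      by (rule fdd_event_sets[where Z = "\<lambda>t p. p t", OF coord nn])
    then have ev: "{p\<in>space (restrict_space ?P S). \<forall>k\<le>m. p (ts k) = zs k} \<in> sets (restrict_space ?P S)"
      by (simp only: M_def space_distr sets_distr)
    have "measure M {p\<in>space M. \<forall>k\<le>m. p (ts k) = zs k}
        = measure (clock_space \<phi>) (?path -` {p\<in>space (restrict_space ?P S). \<forall>k\<le>m. p (ts k) = zs k} \<inter> space (clock_space \<phi>))"
      unfolding M_def space_distr by (rule measure_distr[OF path ev])
    also have "?path -` {p\<in>space (restrict_space ?P S). \<forall>k\<le>m. p (ts k) = zs k} \<inter> space (clock_space \<phi>)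
        = {\<eta>\<in>space (clock_space \<phi>). \<forall>k\<le>m. Z (ts k) \<eta> = zs k}"
      using S nn by (auto simp: space_restrict_space space_PiM)
    also have "measure (clock_space \<phi>) \<dots> = measure (clock_space \<phi>) {\<eta>\<in>space (clock_space \<phi>). \<forall>k\<le>m. chain z (\<Lambda> * ts k) \<eta> = zs k}"
    proof (rule measure_eq_AE)
      show "AE \<eta> in clock_space \<phi>. \<eta> \<in> {\<eta>\<in>space (clock_space \<phi>). \<forall>k\<le>m. Z (ts k) \<eta> = zs k} \<longleftrightarrow>
          \<eta> \<in> {\<eta>\<in>space (clock_space \<phi>). \<forall>k\<le>m. chain z (\<Lambda> * ts k) \<eta> = zs k}"
        using AE_regular[of \<phi>] by eventually_elim (simp add: Z_def R_def space_clock_space)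
      show "{\<eta>\<in>space (clock_space \<phi>). \<forall>k\<le>m. Z (ts k) \<eta> = zs k} \<in> sets (clock_space \<phi>)"
        by (rule fdd_event_sets[OF Z nn])
      show "{\<eta>\<in>space (clock_space \<phi>). \<forall>k\<le>m. chain z (\<Lambda> * ts k) \<eta> = zs k} \<in> sets (clock_space \<phi>)"
        by measurable
    qed
    also have "\<dots> = transition q (ts 0) z (zs 0) * (\<Prod>k<m. transition q (ts (Suc k) - ts k) (zs k) (zs (Suc k)))"
    proof -
      interpret prob_space "clock_space \<phi>" by (rule prob_space_clock_space)
      have "0 \<le> \<Lambda> * ts 0" "mono (\<lambda>k. \<Lambda> * ts k)" using ts L by (auto simp: mono_def)
      from chain_fdd[where ts = "\<lambda>k. \<Lambda> * ts k", OF this, of \<phi> m z zs]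
      have "emeasure (clock_space \<phi>) {\<eta>. \<forall>k\<le>m. chain z (\<Lambda> * ts k) \<eta> = zs k} =
          ennreal (transition q (ts 0) z (zs 0) * (\<Prod>k<m. transition q (ts (Suc k) - ts k) (zs k) (zs (Suc k))))"
        by (simp add: trans right_diff_distrib)
      moreover have "0 \<le> transition q (ts 0) z (zs 0) * (\<Prod>k<m. transition q (ts (Suc k) - ts k) (zs k) (zs (Suc k)))"
        unfolding trans using ts L
        by (intro mult_nonneg_nonneg prod_nonneg ballI mexp_chain_rate_nonneg) (auto simp: mono_def)
      ultimately show ?thesis
        by (simp only: space_clock_space UNIV_I simp_thms emeasure_eq_measure ennreal_inj measure_nonneg)
    qed
    finally show ?thesis .
  qed
  ultimately have "jump_process q z M (\<lambda>t p. p t)"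
    unfolding jump_process_def by blast
  then show ?thesis ..
qed

lemma hat_rate_nonneg:
  fixes z z' :: "('d::finite \<Rightarrow> 'n::finite) \<times> ('d \<Rightarrow> 'n)"
  assumes n: "CARD('n) \<ge> 2"
  shows "0 \<le> hat_rate z z'"
proof -
  have "0 \<le> q_hat a b p r" for a b :: "'d \<Rightarrow> 'n" and p r
    using card_unmatched_ge_2[OF n, of "fst p" a b] by (auto simp: q_hat_def split: prod.splits)
  then show ?thesis
    using n by (auto simp: hat_rate_def split: prod.splits intro!: sum_nonneg divide_nonneg_nonneg)
qed

theorem theorem2p1:
  fixes x y :: "'d::finite \<Rightarrow> 'n::finite" and t :: real
  assumes "CARD('n) \<ge> 2" and "t \<ge> 0"
  shows
    "(\<exists>(M0 :: (real \<Rightarrow> ('d \<Rightarrow> 'n) \<times> ('d \<Rightarrow> 'n)) measure) X0 Y0. hat_coupling x y M0 X0 Y0) \<and>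
     (\<forall>(M :: 'w measure) Xh Yh. hat_coupling x y M Xh Yh \<longrightarrow>
        (M, Xh, Yh) \<in> coadapted_couplings x y \<and>
        measure M {\<omega>\<in>space M. coupling_time Xh Yh \<omega> > ereal t} =
          (INF (M', X, Y) \<in> (coadapted_couplings x y :: ('w measure \<times> _ \<times> _) set).
             measure M' {\<omega>\<in>space M'. coupling_time X Y \<omega> > ereal t}))"
proof (intro conjI allI impI)
  obtain M0 :: "(real \<Rightarrow> ('d \<Rightarrow> 'n) \<times> ('d \<Rightarrow> 'n)) measure" where "jump_process hat_rate (x, y) M0 (\<lambda>t p. p t)"
    using jump_process_exists[of hat_rate "(x, y)"] hat_rate_nonneg[OF assms(1)] by blast
  then have "hat_coupling x y M0 (\<lambda>t p. fst (p t)) (\<lambda>t p. snd (p t))"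
    by (simp add: hat_coupling_def)
  then show "\<exists>(M0 :: (real \<Rightarrow> ('d \<Rightarrow> 'n) \<times> ('d \<Rightarrow> 'n)) measure) X0 Y0. hat_coupling x y M0 X0 Y0"
    by blast
next
  fix M :: "'w measure" and Xh Yh assume hat: "hat_coupling x y M Xh Yh"
  show mem: "(M, Xh, Yh) \<in> coadapted_couplings x y"
    by (rule hat_coupling_coadapted[OF assms(1) hat])
  let ?f = "\<lambda>(M', X, Y). measure M' {\<omega>\<in>space M'. coupling_time X Y \<omega> > ereal t}"
  let ?C = "coadapted_couplings x y :: ('w measure \<times> _ \<times> _) set"
  \<comment> \<open>The specific coupling belongs to the class and attains the lower bound valid for
    all its members, so the infimum is a minimum.\<close>
  have "(INF c \<in> ?C. ?f c)
      = surv CARD('n) (t / (real CARD('n) - 1)) (card (unmatched x y))"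
  proof (rule cInf_eq_minimum)
    show "surv CARD('n) (t / (real CARD('n) - 1)) (card (unmatched x y)) \<in> ?f ` ?C"
      by (rule image_eqI[OF _ mem]) (simp add: hat_coupling_survival[OF assms(1) hat assms(2)])
    show "surv CARD('n) (t / (real CARD('n) - 1)) (card (unmatched x y)) \<le> v"
      if "v \<in> ?f ` ?C" for v
      using that coupling_time_lower_bound[OF assms(1) _ assms(2)] by auto
  qed
  then show "measure M {\<omega>\<in>space M. coupling_time Xh Yh \<omega> > ereal t} =
      (INF (M', X, Y) \<in> (coadapted_couplings x y :: ('w measure \<times> _ \<times> _) set).
         measure M' {\<omega>\<in>space M'. coupling_time X Y \<omega> > ereal t})"
    using hat_coupling_survival[OF assms(1) hat assms(2)] by simp
qed

end
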